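(* Let $(M,\xi)$ be any contact 3-manifold with $2e(\xi)\neq 0$ in $H^2(M)$. Then for any compatible metric $g$ with instantaneous rotation $\theta'$, there exists some point $x\in M$ at which $Ricci(X_\alpha)(x)=\frac{\theta'^2}{2}$, where $X_\alpha$ is the Reeb vector field associated with $g$.
   Context: $M$ is a closed, connected, oriented 3-manifold; all objects are smooth. A (positive) contact form is a 1-form $\alpha$ with $\alpha\wedge d\alpha>0$; $\xi=\ker\alpha$ is a contact structure, an oriented plane field with Euler class $e(\xi)\in H^2(M)=H^2(M;\mathbb{Z})$. Convention: $d\alpha(u,v)=u(\alpha(v))-v(\alpha(u))-\alpha([u,v])$. The Reeb vector field $X_\alpha$ is the unique vector field with $d\alpha(X_\alpha,\cdot)=0$, $\alpha(X_\alpha)=1$. A Riemannian metric $g$ is compatible with $(M,\xi)$ if $g(u,v)=\frac{1}{\theta'}d\alpha(u,Jv)+\alpha(u)\alpha(v)$ for all $u,v\in TM$, where $\alpha$ is a contact form for $\xi$, $\theta'$ is a positive constant (the instantaneous rotation), and $J$ is a complex structure on $\xi$ (with $d\alpha(u,Ju)>0$ for $0\ne u\in\xi$), extended to $TM$ by first projecting to $\xi$ along $X_\alpha$. $X_\alpha$ is called the Reeb vector field associated with $g$; $Ricci(X_\alpha)=k(e,X_\alpha)+k(Je,X_\alpha)$ for a unit $e\in\xi$, $k$ the sectional curvature. *)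

theory Defs
  imports
    "HOL-Complex_Analysis.Winding_Numbers"
    "HOL-Homology.Homology_Groups"
    "HOL-Algebra.Product_Groups"
begin

section \<open>Smooth 3-manifolds\<close>

text \<open>The underlying point set of a manifold is a topological type \<open>'a\<close>; its smooth structure is
  given by an atlas, a set of charts \<open>(U, \<phi>)\<close>.\<close>

primrec C_k_on :: "nat \<Rightarrow> 'b::real_normed_vector set \<Rightarrow> ('b \<Rightarrow> 'c::real_normed_vector) \<Rightarrow> bool" where
  "C_k_on 0 S f \<longleftrightarrow> continuous_on S f"
| "C_k_on (Suc k) S f \<longleftrightarrow>
     (\<forall>x\<in>S. f differentiable (at x)) \<and>
     (\<forall>v. C_k_on k S (\<lambda>x. frechet_derivative f (at x) v))"

text \<open>Only used on open sets.\<close>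

definition smooth_on :: "'b::real_normed_vector set \<Rightarrow> ('b \<Rightarrow> 'c::real_normed_vector) \<Rightarrow> bool" where
  "smooth_on S f \<longleftrightarrow> (\<forall>k. C_k_on k S f)"

type_synonym 'a atlas3 = "('a set \<times> ('a \<Rightarrow> real^3)) set"

definition smooth_atlas :: "'a::topological_space atlas3 \<Rightarrow> bool" where
  "smooth_atlas A \<longleftrightarrow>
     (\<forall>(U, \<phi>)\<in>A. open U \<and> open (\<phi> ` U) \<and> homeomorphism U (\<phi> ` U) \<phi> (inv_into U \<phi>)) \<and>
     (\<Union>(U, \<phi>)\<in>A. U) = UNIV \<and>
     (\<forall>(U, \<phi>)\<in>A. \<forall>(V, \<psi>)\<in>A. smooth_on (\<phi> ` (U \<inter> V)) (\<psi> \<circ> inv_into U \<phi>))"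

definition smooth_functions :: "'a::topological_space atlas3 \<Rightarrow> ('a \<Rightarrow> real) set" where
  "smooth_functions A = {f. \<forall>(U, \<phi>)\<in>A. smooth_on (\<phi> ` U) (f \<circ> inv_into U \<phi>)}"

section \<open>Tangent vectors, vector fields and forms\<close>

text \<open>A tangent vector at \<open>p\<close> is a derivation at \<open>p\<close> of the algebra of smooth functions.
  It is required to be \<open>0\<close> on non-smooth functions, so that equality of tangent vectors is equality
  of derivations.\<close>

type_synonym 'a tvec = "('a \<Rightarrow> real) \<Rightarrow> real"

definition lincomb :: "real \<Rightarrow> 'a tvec \<Rightarrow> real \<Rightarrow> 'a tvec \<Rightarrow> 'a tvec" where
  "lincomb a u b v = (\<lambda>f. a * u f + b * v f)"

definition zero_tvec :: "'a tvec" where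
  "zero_tvec = (\<lambda>f. 0)"

definition tangent_space :: "'a::topological_space atlas3 \<Rightarrow> 'a \<Rightarrow> 'a tvec set" where
  "tangent_space A p =
     {v. (\<forall>f\<in>smooth_functions A. \<forall>h\<in>smooth_functions A. \<forall>a b.
            v (\<lambda>x. a * f x + b * h x) = a * v f + b * v h) \<and>
         (\<forall>f\<in>smooth_functions A. \<forall>h\<in>smooth_functions A.
            v (\<lambda>x. f x * h x) = f p * v h + h p * v f) \<and>
         (\<forall>f. f \<notin> smooth_functions A \<longrightarrow> v f = 0)}"

type_synonym 'a vfield = "'a \<Rightarrow> 'a tvec"

definition vector_field :: "'a::topological_space atlas3 \<Rightarrow> 'a vfield \<Rightarrow> bool" where
  "vector_field A X \<longleftrightarrow>
     (\<forall>p. X p \<in> tangent_space A p) \<and>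
     (\<forall>f\<in>smooth_functions A. (\<lambda>p. X p f) \<in> smooth_functions A)"

definition lie_bracket :: "'a::topological_space atlas3 \<Rightarrow> 'a vfield \<Rightarrow> 'a vfield \<Rightarrow> 'a vfield" where
  "lie_bracket A X Y = (\<lambda>p f.
     if f \<in> smooth_functions A then X p (\<lambda>q. Y q f) - Y p (\<lambda>q. X q f) else 0)"

text \<open>Expressions that are tensorial in vector fields are evaluated on tangent vectors
  by extending the latter; the result does not depend on the extension.\<close>

definition extend_tvec :: "'a::topological_space atlas3 \<Rightarrow> 'a \<Rightarrow> 'a tvec \<Rightarrow> 'a vfield" where
  "extend_tvec A p u = (SOME X. vector_field A X \<and> X p = u)"

definition linear_at :: "'a::topological_space atlas3 \<Rightarrow> 'a \<Rightarrow> ('a tvec \<Rightarrow> real) \<Rightarrow> bool" where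
  "linear_at A p l \<longleftrightarrow>
     (\<forall>u\<in>tangent_space A p. \<forall>v\<in>tangent_space A p. \<forall>a b.
        l (lincomb a u b v) = a * l u + b * l v)"

definition one_form :: "'a::topological_space atlas3 \<Rightarrow> ('a \<Rightarrow> 'a tvec \<Rightarrow> real) \<Rightarrow> bool" where
  "one_form A \<alpha> \<longleftrightarrow>
     (\<forall>p. linear_at A p (\<alpha> p)) \<and>
     (\<forall>X. vector_field A X \<longrightarrow> (\<lambda>p. \<alpha> p (X p)) \<in> smooth_functions A)"

definition ext_deriv_fields ::
    "'a::topological_space atlas3 \<Rightarrow> ('a \<Rightarrow> 'a tvec \<Rightarrow> real) \<Rightarrow> 'a vfield \<Rightarrow> 'a vfield \<Rightarrow> 'a \<Rightarrow> real" where
  "ext_deriv_fields A \<alpha> X Y p =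
     X p (\<lambda>q. \<alpha> q (Y q)) - Y p (\<lambda>q. \<alpha> q (X q)) - \<alpha> p (lie_bracket A X Y p)"

definition ext_deriv ::
    "'a::topological_space atlas3 \<Rightarrow> ('a \<Rightarrow> 'a tvec \<Rightarrow> real) \<Rightarrow> 'a \<Rightarrow> 'a tvec \<Rightarrow> 'a tvec \<Rightarrow> real" where
  "ext_deriv A \<alpha> p u v = ext_deriv_fields A \<alpha> (extend_tvec A p u) (extend_tvec A p v) p"

text \<open>An orientation is given by a nowhere vanishing 3-form: a frame is positive iff the form is
  positive on it.\<close>

definition volume_form ::
    "'a::topological_space atlas3 \<Rightarrow> ('a \<Rightarrow> 'a tvec \<Rightarrow> 'a tvec \<Rightarrow> 'a tvec \<Rightarrow> real) \<Rightarrow> bool" where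
  "volume_form A \<mu> \<longleftrightarrow>
     (\<forall>p. \<forall>v\<in>tangent_space A p. \<forall>w\<in>tangent_space A p. linear_at A p (\<lambda>u. \<mu> p u v w)) \<and>
     (\<forall>p. \<forall>u\<in>tangent_space A p. \<forall>v\<in>tangent_space A p. \<forall>w\<in>tangent_space A p.
        \<mu> p v u w = - \<mu> p u v w \<and> \<mu> p u w v = - \<mu> p u v w) \<and>
     (\<forall>X Y Z. vector_field A X \<longrightarrow> vector_field A Y \<longrightarrow> vector_field A Z \<longrightarrow>
        (\<lambda>p. \<mu> p (X p) (Y p) (Z p)) \<in> smooth_functions A) \<and>
     (\<forall>p. \<exists>u\<in>tangent_space A p. \<exists>v\<in>tangent_space A p. \<exists>w\<in>tangent_space A p. \<mu> p u v w \<noteq> 0)"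

section \<open>Contact structures\<close>

definition wedge_ext_deriv ::
    "'a::topological_space atlas3 \<Rightarrow> ('a \<Rightarrow> 'a tvec \<Rightarrow> real) \<Rightarrow>
       'a \<Rightarrow> 'a tvec \<Rightarrow> 'a tvec \<Rightarrow> 'a tvec \<Rightarrow> real" where
  "wedge_ext_deriv A \<alpha> p u v w =
     \<alpha> p u * ext_deriv A \<alpha> p v w + \<alpha> p v * ext_deriv A \<alpha> p w u + \<alpha> p w * ext_deriv A \<alpha> p u v"

definition contact_form ::
    "'a::topological_space atlas3 \<Rightarrow> ('a \<Rightarrow> 'a tvec \<Rightarrow> 'a tvec \<Rightarrow> 'a tvec \<Rightarrow> real) \<Rightarrow>
       ('a \<Rightarrow> 'a tvec \<Rightarrow> real) \<Rightarrow> bool" where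
  "contact_form A \<mu> \<alpha> \<longleftrightarrow> one_form A \<alpha> \<and>
     (\<forall>p. \<forall>u\<in>tangent_space A p. \<forall>v\<in>tangent_space A p. \<forall>w\<in>tangent_space A p.
        \<mu> p u v w > 0 \<longrightarrow> wedge_ext_deriv A \<alpha> p u v w > 0)"

text \<open>An oriented plane field: at each point a plane and the set of its positive frames.\<close>

record 'a oriented_plane_field =
  plane :: "'a \<Rightarrow> 'a tvec set"
  positive_frames :: "'a \<Rightarrow> ('a tvec \<times> 'a tvec) set"

definition ker_form ::
    "'a::topological_space atlas3 \<Rightarrow> ('a \<Rightarrow> 'a tvec \<Rightarrow> real) \<Rightarrow> 'a \<Rightarrow> 'a tvec set" where
  "ker_form A \<alpha> p = {u \<in> tangent_space A p. \<alpha> p u = 0}"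

text \<open>The kernel of a contact form \<open>\<alpha>\<close> is oriented by \<open>d\<alpha>\<close>; if \<open>\<alpha> \<and> d\<alpha> > 0\<close>, this is the orientation
  induced by the orientation of the manifold and the coorientation \<open>\<alpha>\<close>.\<close>

definition contact_planes ::
    "'a::topological_space atlas3 \<Rightarrow> ('a \<Rightarrow> 'a tvec \<Rightarrow> real) \<Rightarrow> 'a oriented_plane_field" where
  "contact_planes A \<alpha> =
     \<lparr>plane = ker_form A \<alpha>,
      positive_frames =
        (\<lambda>p. {(u, v). u \<in> ker_form A \<alpha> p \<and> v \<in> ker_form A \<alpha> p \<and> ext_deriv A \<alpha> p u v > 0})\<rparr>"

definition contact_structure ::
    "'a::topological_space atlas3 \<Rightarrow> ('a \<Rightarrow> 'a tvec \<Rightarrow> 'a tvec \<Rightarrow> 'a tvec \<Rightarrow> real) \<Rightarrow>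
       'a oriented_plane_field \<Rightarrow> bool" where
  "contact_structure A \<mu> \<xi> \<longleftrightarrow> (\<exists>\<alpha>. contact_form A \<mu> \<alpha> \<and> \<xi> = contact_planes A \<alpha>)"

definition reeb_field ::
    "'a::topological_space atlas3 \<Rightarrow> ('a \<Rightarrow> 'a tvec \<Rightarrow> real) \<Rightarrow> 'a vfield" where
  "reeb_field A \<alpha> = (THE X. vector_field A X \<and>
     (\<forall>p. \<alpha> p (X p) = 1 \<and> (\<forall>u\<in>tangent_space A p. ext_deriv A \<alpha> p (X p) u = 0)))"

section \<open>Riemannian metrics and curvature\<close>

definition riemannian_metric ::
    "'a::topological_space atlas3 \<Rightarrow> ('a \<Rightarrow> 'a tvec \<Rightarrow> 'a tvec \<Rightarrow> real) \<Rightarrow> bool" where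
  "riemannian_metric A g \<longleftrightarrow>
     (\<forall>p. \<forall>v\<in>tangent_space A p. linear_at A p (\<lambda>u. g p u v)) \<and>
     (\<forall>p. \<forall>u\<in>tangent_space A p. \<forall>v\<in>tangent_space A p. g p u v = g p v u) \<and>
     (\<forall>p. \<forall>u\<in>tangent_space A p. u \<noteq> zero_tvec \<longrightarrow> g p u u > 0) \<and>
     (\<forall>X Y. vector_field A X \<longrightarrow> vector_field A Y \<longrightarrow>
        (\<lambda>p. g p (X p) (Y p)) \<in> smooth_functions A)"

definition is_levi_civita ::
    "'a::topological_space atlas3 \<Rightarrow> ('a \<Rightarrow> 'a tvec \<Rightarrow> 'a tvec \<Rightarrow> real) \<Rightarrow>
       ('a vfield \<Rightarrow> 'a vfield \<Rightarrow> 'a vfield) \<Rightarrow> bool" where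
  "is_levi_civita A g D \<longleftrightarrow>
     (\<forall>X Y. vector_field A X \<longrightarrow> vector_field A Y \<longrightarrow> vector_field A (D X Y)) \<and>
     (\<forall>X Y Z. vector_field A X \<longrightarrow> vector_field A Y \<longrightarrow> vector_field A Z \<longrightarrow>
        D (\<lambda>p. lincomb 1 (X p) 1 (Y p)) Z = (\<lambda>p. lincomb 1 (D X Z p) 1 (D Y Z p)) \<and>
        D X (\<lambda>p. lincomb 1 (Y p) 1 (Z p)) = (\<lambda>p. lincomb 1 (D X Y p) 1 (D X Z p))) \<and>
     (\<forall>X Y. \<forall>f\<in>smooth_functions A. vector_field A X \<longrightarrow> vector_field A Y \<longrightarrow>
        D (\<lambda>p h. f p * X p h) Y = (\<lambda>p h. f p * D X Y p h) \<and>
        D X (\<lambda>p h. f p * Y p h) = (\<lambda>p. lincomb (X p f) (Y p) (f p) (D X Y p))) \<and>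
     (\<forall>X Y. vector_field A X \<longrightarrow> vector_field A Y \<longrightarrow>
        (\<lambda>p. lincomb 1 (D X Y p) (- 1) (D Y X p)) = lie_bracket A X Y) \<and>
     (\<forall>X Y Z. vector_field A X \<longrightarrow> vector_field A Y \<longrightarrow> vector_field A Z \<longrightarrow>
        (\<forall>p. X p (\<lambda>q. g q (Y q) (Z q)) = g p (D X Y p) (Z p) + g p (Y p) (D X Z p)))"

text \<open>The Levi-Civita connection is unique on vector fields; its values on other arguments are
  irrelevant, whence \<open>SOME\<close>.\<close>

definition levi_civita ::
    "'a::topological_space atlas3 \<Rightarrow> ('a \<Rightarrow> 'a tvec \<Rightarrow> 'a tvec \<Rightarrow> real) \<Rightarrow>
       'a vfield \<Rightarrow> 'a vfield \<Rightarrow> 'a vfield" where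
  "levi_civita A g = (SOME D. is_levi_civita A g D)"

definition riemann_curvature ::
    "'a::topological_space atlas3 \<Rightarrow> ('a \<Rightarrow> 'a tvec \<Rightarrow> 'a tvec \<Rightarrow> real) \<Rightarrow>
       'a vfield \<Rightarrow> 'a vfield \<Rightarrow> 'a vfield \<Rightarrow> 'a vfield" where
  "riemann_curvature A g X Y Z =
     (let D = levi_civita A g in
        (\<lambda>p f. D X (D Y Z) p f - D Y (D X Z) p f - D (lie_bracket A X Y) Z p f))"

definition sectional_curvature ::
    "'a::topological_space atlas3 \<Rightarrow> ('a \<Rightarrow> 'a tvec \<Rightarrow> 'a tvec \<Rightarrow> real) \<Rightarrow>
       'a \<Rightarrow> 'a tvec \<Rightarrow> 'a tvec \<Rightarrow> real" where
  "sectional_curvature A g p u v =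
     (let U = extend_tvec A p u; V = extend_tvec A p v in
        g p (riemann_curvature A g U V V p) u / (g p u u * g p v v - (g p u v)\<^sup>2))"

section \<open>Compatible metrics\<close>

text \<open>\<open>J\<close> acts on the planes \<open>ker \<alpha>\<close> and is extended by \<open>J X\<^sub>\<alpha> = 0\<close>.\<close>

definition extend_J ::
    "'a::topological_space atlas3 \<Rightarrow> ('a \<Rightarrow> 'a tvec \<Rightarrow> real) \<Rightarrow> ('a \<Rightarrow> 'a tvec \<Rightarrow> 'a tvec) \<Rightarrow>
       'a \<Rightarrow> 'a tvec \<Rightarrow> 'a tvec" where
  "extend_J A \<alpha> J p u = J p (lincomb 1 u (- \<alpha> p u) (reeb_field A \<alpha> p))"

definition complex_structure ::
    "'a::topological_space atlas3 \<Rightarrow> ('a \<Rightarrow> 'a tvec \<Rightarrow> real) \<Rightarrow> ('a \<Rightarrow> 'a tvec \<Rightarrow> 'a tvec) \<Rightarrow> bool" where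
  "complex_structure A \<alpha> J \<longleftrightarrow>
     (\<forall>p. \<forall>u\<in>ker_form A \<alpha> p. J p u \<in> ker_form A \<alpha> p \<and> J p (J p u) = (\<lambda>f. - u f)) \<and>
     (\<forall>p. \<forall>u\<in>ker_form A \<alpha> p. \<forall>v\<in>ker_form A \<alpha> p. \<forall>a b.
        J p (lincomb a u b v) = lincomb a (J p u) b (J p v)) \<and>
     (\<forall>p. \<forall>u\<in>ker_form A \<alpha> p. u \<noteq> zero_tvec \<longrightarrow> ext_deriv A \<alpha> p u (J p u) > 0) \<and>
     (\<forall>X. vector_field A X \<longrightarrow> vector_field A (\<lambda>p. extend_J A \<alpha> J p (X p)))"

text \<open>\<open>\<theta>\<close> is the instantaneous rotation of \<open>g\<close>.\<close>

definition compatible_metric ::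
    "'a::topological_space atlas3 \<Rightarrow> ('a \<Rightarrow> 'a tvec \<Rightarrow> 'a tvec \<Rightarrow> 'a tvec \<Rightarrow> real) \<Rightarrow>
       'a oriented_plane_field \<Rightarrow> ('a \<Rightarrow> 'a tvec \<Rightarrow> real) \<Rightarrow> real \<Rightarrow> ('a \<Rightarrow> 'a tvec \<Rightarrow> 'a tvec) \<Rightarrow>
       ('a \<Rightarrow> 'a tvec \<Rightarrow> 'a tvec \<Rightarrow> real) \<Rightarrow> bool" where
  "compatible_metric A \<mu> \<xi> \<alpha> \<theta> J g \<longleftrightarrow>
     riemannian_metric A g \<and>
     contact_form A \<mu> \<alpha> \<and> ker_form A \<alpha> = plane \<xi> \<and>
     \<theta> > 0 \<and> complex_structure A \<alpha> J \<and>
     (\<forall>p. \<forall>u\<in>tangent_space A p. \<forall>v\<in>tangent_space A p.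
        g p u v = 1 / \<theta> * ext_deriv A \<alpha> p u (extend_J A \<alpha> J p v) + \<alpha> p u * \<alpha> p v)"

text \<open>The value does not depend on the unit vector \<open>e\<close>.\<close>

definition ricci_reeb ::
    "'a::topological_space atlas3 \<Rightarrow> ('a \<Rightarrow> 'a tvec \<Rightarrow> real) \<Rightarrow> ('a \<Rightarrow> 'a tvec \<Rightarrow> 'a tvec) \<Rightarrow>
       ('a \<Rightarrow> 'a tvec \<Rightarrow> 'a tvec \<Rightarrow> real) \<Rightarrow> 'a \<Rightarrow> real" where
  "ricci_reeb A \<alpha> J g p = (THE r. \<forall>e\<in>ker_form A \<alpha> p. g p e e = 1 \<longrightarrow>
     r = sectional_curvature A g p e (reeb_field A \<alpha> p)
         + sectional_curvature A g p (J p e) (reeb_field A \<alpha> p))"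

section \<open>Singular cohomology with integer coefficients\<close>

text \<open>A homomorphism on the free abelian group of singular chains is identified with its restriction
  to the singular simplices.\<close>

definition cochain_group :: "nat \<Rightarrow> 'a topology \<Rightarrow> (((nat \<Rightarrow> real) \<Rightarrow> 'a) \<Rightarrow> int) monoid" where
  "cochain_group n X = product_group (singular_simplex_set n X) (\<lambda>_. integer_group)"

definition cochain_eval :: "(((nat \<Rightarrow> real) \<Rightarrow> 'a) \<Rightarrow> int) \<Rightarrow> 'a chain \<Rightarrow> int" where
  "cochain_eval c b = (\<Sum>\<sigma>\<in>Poly_Mapping.keys b. Poly_Mapping.lookup b \<sigma> * c \<sigma>)"

definition coboundary ::
    "nat \<Rightarrow> 'a topology \<Rightarrow> (((nat \<Rightarrow> real) \<Rightarrow> 'a) \<Rightarrow> int) \<Rightarrow> ((nat \<Rightarrow> real) \<Rightarrow> 'a) \<Rightarrow> int" where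
  "coboundary n X c =
     (\<lambda>\<sigma>\<in>singular_simplex_set (Suc n) X. cochain_eval c (chain_boundary (Suc n) (frag_of \<sigma>)))"

definition cocycle_group :: "nat \<Rightarrow> 'a topology \<Rightarrow> (((nat \<Rightarrow> real) \<Rightarrow> 'a) \<Rightarrow> int) monoid" where
  "cocycle_group n X = subgroup_generated (cochain_group n X)
     (kernel (cochain_group n X) (cochain_group (Suc n) X) (coboundary n X))"

definition coboundary_set :: "nat \<Rightarrow> 'a topology \<Rightarrow> (((nat \<Rightarrow> real) \<Rightarrow> 'a) \<Rightarrow> int) set" where
  "coboundary_set n X =
     (if n = 0 then {\<one>\<^bsub>cochain_group n X\<^esub>}
      else coboundary (n - 1) X ` carrier (cochain_group (n - 1) X))"

definition cohomology_group ::
    "nat \<Rightarrow> 'a topology \<Rightarrow> (((nat \<Rightarrow> real) \<Rightarrow> 'a) \<Rightarrow> int) set monoid" where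
  "cohomology_group n X = cocycle_group n X Mod coboundary_set n X"

definition cohomology_class ::
    "nat \<Rightarrow> 'a topology \<Rightarrow> (((nat \<Rightarrow> real) \<Rightarrow> 'a) \<Rightarrow> int) \<Rightarrow> (((nat \<Rightarrow> real) \<Rightarrow> 'a) \<Rightarrow> int) set" where
  "cohomology_class n X c = coboundary_set n X #>\<^bsub>cocycle_group n X\<^esub> c"

section \<open>The Euler class of an oriented plane field\<close>

text \<open>The Euler class is defined as the primary obstruction to a nowhere vanishing section,
  on the singular complex: choose a nonzero vector of the plane field at every point
  (singular 0-simplex), extend this choice to a nonvanishing section along every singular 1-simplex,
  and assign to each singular 2-simplex the winding number of the resulting section along its
  boundary with respect to a positive frame of the pulled-back plane field.
  The class of this cocycle does not depend on the choices.

  A field of tangent vectors along a continuous map is continuous in the tangent bundle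
  iff its derivatives of all smooth functions are continuous.\<close>

definition continuous_along ::
    "'a::topological_space atlas3 \<Rightarrow> nat \<Rightarrow> ((nat \<Rightarrow> real) \<Rightarrow> 'a tvec) \<Rightarrow> bool" where
  "continuous_along A n w \<longleftrightarrow> (\<forall>f\<in>smooth_functions A.
     continuous_map (subtopology (powertop_real UNIV) (standard_simplex n)) euclideanreal
       (\<lambda>x. w x f))"

definition nonvanishing_section ::
    "'a::topological_space atlas3 \<Rightarrow> 'a oriented_plane_field \<Rightarrow> nat \<Rightarrow> ((nat \<Rightarrow> real) \<Rightarrow> 'a) \<Rightarrow>
       ((nat \<Rightarrow> real) \<Rightarrow> 'a tvec) \<Rightarrow> bool" where
  "nonvanishing_section A \<xi> n \<sigma> w \<longleftrightarrow> continuous_along A n w \<and>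
     (\<forall>x\<in>standard_simplex n. w x \<in> plane \<xi> (\<sigma> x) \<and> w x \<noteq> zero_tvec)"

definition positive_frame ::
    "'a::topological_space atlas3 \<Rightarrow> 'a oriented_plane_field \<Rightarrow> nat \<Rightarrow> ((nat \<Rightarrow> real) \<Rightarrow> 'a) \<Rightarrow>
       ((nat \<Rightarrow> real) \<Rightarrow> 'a tvec) \<Rightarrow> ((nat \<Rightarrow> real) \<Rightarrow> 'a tvec) \<Rightarrow> bool" where
  "positive_frame A \<xi> n \<sigma> t1 t2 \<longleftrightarrow>
     continuous_along A n t1 \<and> continuous_along A n t2 \<and>
     (\<forall>x\<in>standard_simplex n. (t1 x, t2 x) \<in> positive_frames \<xi> (\<sigma> x))"

definition simplex_vertex :: "nat \<Rightarrow> nat \<Rightarrow> real" where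
  "simplex_vertex i = (\<lambda>j. if j = i then 1 else 0)"

definition edge_point :: "real \<Rightarrow> nat \<Rightarrow> real" where
  "edge_point t = (\<lambda>i. if i = 0 then 1 - t else if i = 1 then t else 0)"

text \<open>A nonvanishing section on the 1-skeleton: \<open>s0\<close> on points, \<open>s1 \<tau>\<close> along the singular
  1-simplex \<open>\<tau>\<close>.\<close>

definition one_skeleton_section ::
    "'a::topological_space atlas3 \<Rightarrow> 'a oriented_plane_field \<Rightarrow>
       ('a \<Rightarrow> 'a tvec) \<Rightarrow> (((nat \<Rightarrow> real) \<Rightarrow> 'a) \<Rightarrow> (nat \<Rightarrow> real) \<Rightarrow> 'a tvec) \<Rightarrow> bool" where
  "one_skeleton_section A \<xi> s0 s1 \<longleftrightarrow>
     (\<forall>p. s0 p \<in> plane \<xi> p \<and> s0 p \<noteq> zero_tvec) \<and>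
     (\<forall>\<tau>. singular_simplex 1 euclidean \<tau> \<longrightarrow>
        nonvanishing_section A \<xi> 1 \<tau> (s1 \<tau>) \<and>
        (\<forall>i\<in>{0, 1}. s1 \<tau> (simplex_vertex i) = s0 (\<tau> (simplex_vertex i))))"

definition frame_coordinate :: "'a tvec \<Rightarrow> 'a tvec \<Rightarrow> 'a tvec \<Rightarrow> complex" where
  "frame_coordinate u v w = (THE z. w = lincomb (Re z) u (Im z) v)"

definition face_path ::
    "(((nat \<Rightarrow> real) \<Rightarrow> 'a) \<Rightarrow> (nat \<Rightarrow> real) \<Rightarrow> 'a tvec) \<Rightarrow> ((nat \<Rightarrow> real) \<Rightarrow> 'a) \<Rightarrow>
       ((nat \<Rightarrow> real) \<Rightarrow> 'a tvec) \<Rightarrow> ((nat \<Rightarrow> real) \<Rightarrow> 'a tvec) \<Rightarrow> nat \<Rightarrow> real \<Rightarrow> complex" where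
  "face_path s1 \<sigma> t1 t2 k = (\<lambda>t.
     let x = simplical_face k (edge_point t) in
       frame_coordinate (t1 x) (t2 x) (s1 (singular_face 2 k \<sigma>) (edge_point t)))"

text \<open>The boundary of the 2-simplex is traversed as \<open>v\<^sub>0 \<rightarrow> v\<^sub>1 \<rightarrow> v\<^sub>2 \<rightarrow> v\<^sub>0\<close>, with face \<open>k\<close> opposite
  to \<open>v\<^sub>k\<close>.\<close>

definition boundary_loop ::
    "(((nat \<Rightarrow> real) \<Rightarrow> 'a) \<Rightarrow> (nat \<Rightarrow> real) \<Rightarrow> 'a tvec) \<Rightarrow> ((nat \<Rightarrow> real) \<Rightarrow> 'a) \<Rightarrow>
       ((nat \<Rightarrow> real) \<Rightarrow> 'a tvec) \<Rightarrow> ((nat \<Rightarrow> real) \<Rightarrow> 'a tvec) \<Rightarrow> real \<Rightarrow> complex" where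
  "boundary_loop s1 \<sigma> t1 t2 =
     face_path s1 \<sigma> t1 t2 2 +++ (face_path s1 \<sigma> t1 t2 0 +++ reversepath (face_path s1 \<sigma> t1 t2 1))"

definition obstruction_cochain ::
    "'a::topological_space atlas3 \<Rightarrow> 'a oriented_plane_field \<Rightarrow>
       (((nat \<Rightarrow> real) \<Rightarrow> 'a) \<Rightarrow> int) \<Rightarrow> bool" where
  "obstruction_cochain A \<xi> c \<longleftrightarrow>
     c \<in> carrier (cochain_group 2 euclidean) \<and>
     (\<exists>s0 s1. one_skeleton_section A \<xi> s0 s1 \<and>
        (\<forall>\<sigma>. singular_simplex 2 euclidean \<sigma> \<longrightarrow>
           (\<exists>t1 t2. positive_frame A \<xi> 2 \<sigma> t1 t2 \<and>
              winding_number (boundary_loop s1 \<sigma> t1 t2) 0 = of_int (c \<sigma>))))"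

definition euler_class ::
    "'a::topological_space atlas3 \<Rightarrow> 'a oriented_plane_field \<Rightarrow> (((nat \<Rightarrow> real) \<Rightarrow> 'a) \<Rightarrow> int) set" where
  "euler_class A \<xi> =
     (THE e. \<exists>c. obstruction_cochain A \<xi> c \<and> e = cohomology_class 2 euclidean c)"

end

theory Submission
  imports Defs "HOL-Complex_Analysis.Riemann_Mapping"
begin

text \<open>If the Ricci curvature \<open>Ricci(X)\<close> of the Reeb field \<open>X\<close> avoids the value \<open>\<theta>\<^sup>2 / 2\<close>, then the complex line bundle
  \<open>\<xi>\<close> has a trivial square, whence \<open>2 e(\<xi>) = 0\<close>. The link between the two is the Lie derivative \<open>L\<^sub>X J\<close> of the
  complex structure along the Reeb flow.

  On the curvature side, \<open>L\<^sub>X d\<alpha> = 0\<close>, so \<open>L\<^sub>X J\<close> alone is responsible for the derivative of the metric along the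
  Reeb flow. The endomorphism \<open>u \<mapsto> \<nabla>\<^sub>u X\<close> of \<open>\<xi>\<close> is the sum of \<open>(\<theta>/2) J\<close> and of a symmetric trace-free part \<open>S\<close>
  that is equivalent to \<open>L\<^sub>X J\<close>, and \<open>Ricci(X) = \<theta>\<^sup>2 / 2 - tr S\<^sup>2\<close>. In particular
  \<open>Ricci(X) = \<theta>\<^sup>2 / 2\<close> at every point where \<open>L\<^sub>X J = 0\<close> (\<open>ricci_reeb_eq\<close>). If the value is never attained,
  \<open>L\<^sub>X J\<close> vanishes nowhere (\<open>P_nonzero\<close>).

  Differentiating \<open>J\<^sup>2 = -1\<close> shows that \<open>L\<^sub>X J\<close> anticommutes with \<open>J\<close>. It is therefore an antilinear endomorphism
  \<open>P\<close> of the complex line bundle \<open>\<xi>\<close>, and the complex number \<open>q(w)\<close> that expresses \<open>P w\<close> in terms of \<open>w\<close>, scaled by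
  \<open>|w|\<^sup>2\<close>, satisfies \<open>q(\<zeta> w) = cnj(\<zeta>)\<^sup>2 q(w)\<close> (\<open>q_transform\<close>). If \<open>P\<close> has no zeros, \<open>q\<close> takes
  nonzero vectors to nonzero numbers, so around the boundary of a 2-simplex the argument of \<open>q\<close> along a
  section turns by \<open>-2\<close> times the obstruction of that section. On the other hand these total changes add
  up to the coboundary of an integral 1-cochain, because at the vertices the argument of \<open>q\<close> depends on the
  chosen vectors only (\<open>turns_coboundary\<close>, \<open>euler_class_square_trivial\<close>). The same argument, applied to the
  ratio of two sections, shows that the class of the obstruction cochain is well defined
  (\<open>obstruction_class_unique\<close>); that such a cochain exists rests on sections over simplices, which are
  produced by transport along segments (\<open>section_exists\<close>).

  All tensor calculus is done with derivations of the algebra of smooth functions. Its foundation is a finite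
  family of functions \<open>F k\<close> and vector fields \<open>E k\<close> with \<open>v = \<Sum>k. v(F k) E k\<close> for every tangent vector \<open>v\<close>
  (\<open>global_frame\<close>), obtained from Hadamard's lemma, bump functions and compactness. With it, expressions
  that are linear over the smooth functions are pointwise for purely algebraic reasons (\<open>tensorial\<close>), and
  the Reeb field, the inverse metric and hence the Levi-Civita connection are given by global formulas.\<close>

section \<open>Functions of class \<open>C\<^sup>k\<close>\<close>

lemma C_k_on_cong:
  assumes "open S" "\<And>x. x \<in> S \<Longrightarrow> f x = g x" "C_k_on k S f"
  shows "C_k_on k S g"
  using assms(2,3)
proof (induction k arbitrary: f g)
  case 0
  then show ?case by (simp cong: continuous_on_cong)
next
  case (Suc k)
  have d: "(g has_derivative frechet_derivative f (at x)) (at x)" if "x \<in> S" for x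
  proof (rule has_derivative_transform_within_open[OF _ assms(1) that])
    show "(f has_derivative frechet_derivative f (at x)) (at x)"
      using Suc.prems(2) that unfolding C_k_on.simps using frechet_derivative_works by blast
  qed (rule Suc.prems(1))
  then have "frechet_derivative g (at x) = frechet_derivative f (at x)" if "x \<in> S" for x
    using that frechet_derivative_at by metis
  then have "C_k_on k S (\<lambda>x. frechet_derivative g (at x) v)" for v
    by (intro Suc.IH[OF _ spec[OF conjunct2[OF Suc.prems(2)[unfolded C_k_on.simps]], of v]]) simp
  moreover have "\<forall>x\<in>S. g differentiable (at x)" using d by (auto simp: differentiable_def)
  ultimately show ?case by simp
qed

lemma C_k_on_subset: "C_k_on k S f \<Longrightarrow> T \<subseteq> S \<Longrightarrow> C_k_on k T f"
  by (induction k arbitrary: f) (auto intro: continuous_on_subset)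

lemma C_k_on_Un:
  assumes "open S" "open T" "C_k_on k S f" "C_k_on k T f"
  shows "C_k_on k (S \<union> T) f"
  using assms(3,4) by (induction k arbitrary: f) (auto simp: assms(1,2) continuous_on_open_Un)

lemma C_k_on_Suc_lower: "C_k_on (Suc k) S f \<Longrightarrow> C_k_on k S f"
proof (induction k arbitrary: f)
  case 0
  then show ?case
    by (auto intro!: continuous_at_imp_continuous_on differentiable_imp_continuous_within)
next
  case (Suc k)
  then have 1: "\<forall>x\<in>S. f differentiable (at x)"
    and 2: "\<And>v. C_k_on (Suc k) S (\<lambda>x. frechet_derivative f (at x) v)"
    unfolding C_k_on.simps(2)[of "Suc k"] by blast+
  from 1 Suc.IH[OF 2] show ?case unfolding C_k_on.simps(2)[of k] by blast
qed

lemma C_k_on_continuous: "C_k_on k S f \<Longrightarrow> continuous_on S f"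
proof (induction k)
  case (Suc k)
  then show ?case using C_k_on_Suc_lower by blast
qed simp

text \<open>Membership in \<open>C\<^sup>k\<^sup>+\<^sup>1\<close> read off from any formula for the derivative.\<close>

lemma C_k_on_SucI:
  assumes "open S"
    and "\<And>x. x \<in> S \<Longrightarrow> (f has_derivative f' x) (at x)"
    and "\<And>v. C_k_on k S (\<lambda>x. f' x v)"
  shows "C_k_on (Suc k) S f"
proof -
  have "frechet_derivative f (at x) = f' x" if "x \<in> S" for x
    using assms(2)[OF that] frechet_derivative_at by metis
  then have "C_k_on k S (\<lambda>x. frechet_derivative f (at x) v)" for v
    by (intro C_k_on_cong[OF assms(1) _ assms(3)[of v]]) simp
  with assms(2) show ?thesis by (auto simp: differentiable_def)
qed

lemma C_k_on_has_derivative: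
  "C_k_on (Suc k) S f \<Longrightarrow> x \<in> S \<Longrightarrow> (f has_derivative frechet_derivative f (at x)) (at x)"
  unfolding C_k_on.simps using frechet_derivative_works by blast

lemma C_k_on_const: "open S \<Longrightarrow> C_k_on k S (\<lambda>x. c)"
proof (induction k arbitrary: c)
  case (Suc k)
  show ?case
    by (rule C_k_on_SucI[OF Suc.prems, where f' = "\<lambda>_ _. 0", OF has_derivative_const Suc.IH[OF Suc.prems]])
qed simp

lemma C_k_on_linear:
  assumes "open S" "bounded_linear L" "C_k_on k S f"
  shows "C_k_on k S (\<lambda>x. L (f x))"
  using assms(3)
proof (induction k arbitrary: f)
  case 0
  then show ?case using assms(2) by (simp add: bounded_linear.continuous_on)
next
  case (Suc k)
  show ?case
  proof (rule C_k_on_SucI[OF assms(1)])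
    show "((\<lambda>x. L (f x)) has_derivative (\<lambda>v. L (frechet_derivative f (at x) v))) (at x)"
      if "x \<in> S" for x
      using C_k_on_has_derivative[OF Suc.prems that] bounded_linear.has_derivative[OF assms(2)] by blast
    show "C_k_on k S (\<lambda>x. L (frechet_derivative f (at x) v))" for v
      using Suc by simp
  qed
qed

lemma C_k_on_minus: "open S \<Longrightarrow> C_k_on k S f \<Longrightarrow> C_k_on k S (\<lambda>x. - f x)"
  using C_k_on_linear[OF _ bounded_linear_minus[OF bounded_linear_ident]] .

lemma C_k_on_inner: "open S \<Longrightarrow> C_k_on k S f \<Longrightarrow> C_k_on k S (\<lambda>x. f x \<bullet> b)"
  using C_k_on_linear[OF _ bounded_linear_inner_left] .

lemma C_k_on_id:
  assumes "open S" shows "C_k_on k S (\<lambda>x. x)"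
proof (cases k)
  case (Suc n)
  show ?thesis unfolding Suc
    by (rule C_k_on_SucI[OF assms, where f' = "\<lambda>_ v. v", OF has_derivative_ident C_k_on_const[OF assms]])
qed simp

lemma C_k_on_add:
  assumes "open S" "C_k_on k S f" "C_k_on k S g"
  shows "C_k_on k S (\<lambda>x. f x + g x)"
  using assms(2,3)
proof (induction k arbitrary: f g)
  case 0
  then show ?case by (simp add: continuous_intros)
next
  case (Suc k)
  show ?case
  proof (rule C_k_on_SucI[OF assms(1)])
    show "((\<lambda>x. f x + g x) has_derivative
        (\<lambda>v. frechet_derivative f (at x) v + frechet_derivative g (at x) v)) (at x)" if "x \<in> S" for x
      using Suc.prems that by (intro has_derivative_add C_k_on_has_derivative)
  qed (use Suc in simp)
qed

lemma C_k_on_mult: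
  fixes f g :: "'b::real_normed_vector \<Rightarrow> real"
  assumes "open S" "C_k_on k S f" "C_k_on k S g"
  shows "C_k_on k S (\<lambda>x. f x * g x)"
  using assms(2,3)
proof (induction k arbitrary: f g)
  case 0
  then show ?case by (simp add: continuous_intros)
next
  case (Suc k)
  show ?case
  proof (rule C_k_on_SucI[OF assms(1)])
    show "((\<lambda>x. f x * g x) has_derivative
        (\<lambda>v. f x * frechet_derivative g (at x) v + frechet_derivative f (at x) v * g x)) (at x)" if "x \<in> S" for x
      using Suc.prems that by (intro has_derivative_mult C_k_on_has_derivative)
    show "C_k_on k S (\<lambda>x. f x * frechet_derivative g (at x) v + frechet_derivative f (at x) v * g x)" for v
      using Suc.prems C_k_on_Suc_lower[OF Suc.prems(1)] C_k_on_Suc_lower[OF Suc.prems(2)]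
      by (intro C_k_on_add[OF assms(1)] Suc.IH) auto
  qed
qed

lemma C_k_on_sum:
  assumes "open S" "\<And>i. i \<in> I \<Longrightarrow> C_k_on k S (f i)"
  shows "C_k_on k S (\<lambda>x. \<Sum>i\<in>I. f i x)"
  using assms(2)
  by (induction I rule: infinite_finite_induct) (auto intro: C_k_on_add C_k_on_const assms(1))

lemma C_k_on_inverse:
  fixes f :: "'b::real_normed_vector \<Rightarrow> real"
  assumes "open S" "C_k_on k S f" "\<And>x. x \<in> S \<Longrightarrow> f x \<noteq> 0"
  shows "C_k_on k S (\<lambda>x. inverse (f x))"
  using assms(2)
proof (induction k)
  case 0
  then show ?case using assms(3) by (simp add: continuous_on_inverse)
next
  case (Suc k)
  have i: "C_k_on k S (\<lambda>x. inverse (f x))"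
    by (rule Suc.IH[OF C_k_on_Suc_lower[OF Suc.prems]])
  show ?case
  proof (rule C_k_on_SucI[OF assms(1)])
    show "((\<lambda>x. inverse (f x)) has_derivative
        (\<lambda>v. - (inverse (f x) * frechet_derivative f (at x) v * inverse (f x)))) (at x)" if "x \<in> S" for x
      by (rule Deriv.has_derivative_inverse[OF assms(3)[OF that] C_k_on_has_derivative[OF Suc.prems that]])
    show "C_k_on k S (\<lambda>x. - (inverse (f x) * frechet_derivative f (at x) v * inverse (f x)))" for v
      using Suc.prems by (intro C_k_on_minus C_k_on_mult assms(1) i) auto
  qed
qed

text \<open>The chain rule evaluates the derivative of \<open>f\<close> in a direction that varies with \<open>x\<close>. Expanding this direction
  in the basis leaves derivatives in constant directions, the only ones in the definition of \<open>C_k_on\<close>.\<close>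

lemma C_k_on_compose:
  fixes g :: "'d::real_normed_vector \<Rightarrow> 'b::euclidean_space" and f :: "'b \<Rightarrow> real"
  assumes "open S" "open T" "C_k_on k T f" "C_k_on k S g" "g ` S \<subseteq> T"
  shows "C_k_on k S (\<lambda>x. f (g x))"
  using assms(3,4)
proof (induction k arbitrary: f)
  case 0
  then show ?case using assms(5) continuous_on_compose2 by auto
next
  case (Suc k)
  show ?case
  proof (rule C_k_on_SucI[OF assms(1)])
    fix x assume x: "x \<in> S"
    have df: "(f has_derivative frechet_derivative f (at (g x))) (at (g x))"
      using Suc.prems(1) x assms(5) by (intro C_k_on_has_derivative) auto
    have exp: "frechet_derivative f (at (g x)) w = (\<Sum>b\<in>Basis. (w \<bullet> b) * frechet_derivative f (at (g x)) b)" for w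
    proof -
      have "linear (frechet_derivative f (at (g x)))" using df has_derivative_linear by blast
      from linear_sum[OF this, of "\<lambda>b. (w \<bullet> b) *\<^sub>R b" Basis] linear_cmul[OF this]
      show ?thesis by (simp add: euclidean_representation)
    qed
    show "((\<lambda>x. f (g x)) has_derivative (\<lambda>v. \<Sum>b\<in>Basis.
        (frechet_derivative g (at x) v \<bullet> b) * frechet_derivative f (at (g x)) b)) (at x)"
      unfolding exp[symmetric]
      using diff_chain_at[OF C_k_on_has_derivative[OF Suc.prems(2) x] df] by (simp add: o_def)
  next
    show "C_k_on k S (\<lambda>x. \<Sum>b\<in>Basis.
        (frechet_derivative g (at x) v \<bullet> b) * frechet_derivative f (at (g x)) b)" for v
    proof (intro C_k_on_sum C_k_on_mult C_k_on_inner assms(1) Suc.IH)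
      show "C_k_on k S g" by (rule C_k_on_Suc_lower[OF Suc.prems(2)])
    qed (use Suc.prems in simp_all)
  qed
qed

subsection \<open>A smooth bump function\<close>

text \<open>The functions \<open>t\<^sup>-\<^sup>n exp(- 1 / t)\<close>, extended by 0. The derivative of each is a combination of the next two, so
  that one induction shows that all of them are smooth.\<close>

definition flat_exp :: "nat \<Rightarrow> real \<Rightarrow> real" where
  "flat_exp n t = (if t \<le> 0 then 0 else (1 / t) ^ n * exp (- (1 / t)))"

lemma flat_exp_deriv:
  "(flat_exp n has_field_derivative flat_exp (n + 2) t - real n * flat_exp (n + 1) t) (at t)"
proof -
  consider "t > 0" | "t < 0" | "t = 0" by linarith
  then show ?thesis
  proof cases
    case 1
    have e: "flat_exp (n + 2) t - real n * flat_exp (n + 1) t =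
        (1 / t) ^ n * (exp (- (1 / t)) * (1 / t\<^sup>2)) + real n * (1 / t) ^ (n - 1) * (- 1 / t\<^sup>2) * exp (- (1 / t))"
      using 1 by (cases n) (auto simp: flat_exp_def power2_eq_square field_simps)
    have "((\<lambda>t. (1 / t) ^ n * exp (- (1 / t))) has_field_derivative
        (flat_exp (n + 2) t - real n * flat_exp (n + 1) t)) (at t)"
      unfolding e using 1 by (auto intro!: derivative_eq_intros simp: power2_eq_square)
    moreover have "eventually (\<lambda>s. (1 / s) ^ n * exp (- (1 / s)) = flat_exp n s) (nhds t)"
      using eventually_nhds_in_open[of "{0<..}" t] 1
      by (auto simp: flat_exp_def elim!: eventually_mono)
    ultimately show ?thesis
      by (rule DERIV_cong_ev[OF refl _ refl, THEN iffD1, rotated])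
  next
    case 2
    have "eventually (\<lambda>s. 0 = flat_exp n s) (nhds t)"
      using eventually_nhds_in_open[of "{..<0}" t] 2
      by (auto simp: flat_exp_def elim!: eventually_mono)
    moreover have "((\<lambda>s. 0) has_field_derivative
        (flat_exp (n + 2) t - real n * flat_exp (n + 1) t)) (at t)"
      using 2 by (simp add: flat_exp_def)
    ultimately show ?thesis
      by (rule DERIV_cong_ev[OF refl _ refl, THEN iffD1])
  next
    case 3
    have "((\<lambda>t::real. (1 / t) ^ Suc n * exp (- (1 / t))) \<longlongrightarrow> 0) (at_right 0)"
    proof -
      have "((\<lambda>y::real. y ^ Suc n / exp y) \<longlongrightarrow> 0) at_top" by (rule tendsto_power_div_exp_0)
      moreover have "filterlim (\<lambda>t::real. 1 / t) at_top (at_right 0)"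
        using filterlim_inverse_at_top_right by (simp add: inverse_eq_divide)
      ultimately have "((\<lambda>t::real. (1 / t) ^ Suc n / exp (1 / t)) \<longlongrightarrow> 0) (at_right 0)"
        by (rule filterlim_compose)
      then show ?thesis by (simp add: exp_minus divide_inverse)
    qed
    then have "((\<lambda>t. flat_exp (Suc n) t) \<longlongrightarrow> 0) (at_right 0)"
      by (rule Lim_transform_eventually)
         (auto simp: eventually_at_filter flat_exp_def)
    moreover have "((\<lambda>t. flat_exp (Suc n) t) \<longlongrightarrow> 0) (at_left 0)"
      by (rule Lim_transform_eventually[OF tendsto_const])
         (auto simp: eventually_at_filter flat_exp_def)
    ultimately have "((\<lambda>t. flat_exp (Suc n) t) \<longlongrightarrow> 0) (at 0)"
      by (simp add: filterlim_split_at)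
    then have "((\<lambda>t. (flat_exp n t - flat_exp n 0) / (t - 0)) \<longlongrightarrow> 0) (at 0)"
      by (rule Lim_transform_eventually) (auto simp: eventually_at_filter flat_exp_def)
    then show ?thesis
      using 3 by (simp add: has_field_derivative_iff flat_exp_def)
  qed
qed

lemma C_k_on_flat_exp: "C_k_on k UNIV (flat_exp n)"
proof (induction k arbitrary: n)
  case 0
  have "isCont (flat_exp n) x" for x using flat_exp_deriv DERIV_isCont by blast
  then show ?case by (simp add: continuous_at_imp_continuous_on)
next
  case (Suc k)
  show ?case
  proof (rule C_k_on_SucI)
    show "(flat_exp n has_derivative
       (\<lambda>v. (flat_exp (n + 2) t + (- real n) * flat_exp (n + 1) t) * v)) (at t)" for t
      using flat_exp_deriv[of n t] by (simp add: has_field_derivative_def)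
    show "C_k_on k UNIV (\<lambda>t. (flat_exp (n + 2) t + (- real n) * flat_exp (n + 1) t) * v)" for v
      by (intro C_k_on_mult C_k_on_add C_k_on_const Suc open_UNIV)
  qed simp
qed

definition bump :: "real^3 \<Rightarrow> real \<Rightarrow> real^3 \<Rightarrow> real" where
  "bump c r y = flat_exp 0 (r\<^sup>2 - (y - c) \<bullet> (y - c))"

lemma bump_pos: "r > 0 \<Longrightarrow> bump c r y > 0 \<longleftrightarrow> y \<in> ball c r"
  and bump_eq_0: "r > 0 \<Longrightarrow> y \<notin> ball c r \<Longrightarrow> bump c r y = 0"
  and bump_nonneg: "bump c r y \<ge> 0"
proof -
  assume r: "r > 0"
  have "y \<in> ball c r \<longleftrightarrow> norm (y - c) < r" by (simp add: dist_norm norm_minus_commute)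
  also have "\<dots> \<longleftrightarrow> (norm (y - c))\<^sup>2 < r\<^sup>2" 
    using r by (auto intro: power_strict_mono dest: power_less_imp_less_base)
  finally have *: "y \<in> ball c r \<longleftrightarrow> (y - c) \<bullet> (y - c) < r\<^sup>2" by (simp add: power2_norm_eq_inner)
  show "bump c r y > 0 \<longleftrightarrow> y \<in> ball c r" unfolding * by (auto simp: bump_def flat_exp_def)
  show "y \<notin> ball c r \<Longrightarrow> bump c r y = 0" unfolding * by (auto simp: bump_def flat_exp_def)
next
  show "bump c r y \<ge> 0" by (simp add: bump_def flat_exp_def)
qed

lemma C_k_on_component: "open S \<Longrightarrow> C_k_on k S (\<lambda>y::real^3. y \<bullet> b)"
  by (rule C_k_on_inner[OF _ C_k_on_id])

lemma C_k_on_bump: "C_k_on k UNIV (bump c r)"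
proof -
  have "C_k_on k UNIV (\<lambda>y. r\<^sup>2 + (- 1) * (\<Sum>b\<in>Basis. (y \<bullet> b + (- (c \<bullet> b))) * (y \<bullet> b + (- (c \<bullet> b)))))"
    by (intro C_k_on_add C_k_on_mult C_k_on_sum C_k_on_const C_k_on_component) auto
  moreover have "(\<Sum>b\<in>Basis. (y \<bullet> b + (- (c \<bullet> b))) * (y \<bullet> b + (- (c \<bullet> b)))) = (y - c) \<bullet> (y - c)" for y :: "real^3"
    by (subst (3) euclidean_inner) (simp add: inner_diff_left)
  ultimately have "C_k_on k UNIV (\<lambda>y. r\<^sup>2 - (y - c) \<bullet> (y - c))" by simp
  then show ?thesis
    unfolding bump_def[abs_def]
    by (rule C_k_on_compose[OF _ _ C_k_on_flat_exp, rotated 2]) auto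
qed

subsection \<open>Hadamard's lemma\<close>

text \<open>The integral is the factor of Hadamard's lemma. Differentiating under the integral sign turns the weight \<open>t\<^sup>n\<close> into \<open>t\<^sup>n\<^sup>+\<^sup>1\<close>, so the weight must
  be arbitrary for the induction on the order of differentiability.\<close>

lemma C_k_on_ray_integral:
  fixes h :: "real^3 \<Rightarrow> real"
  assumes B: "open B" "convex B" "y0 \<in> B" and h: "C_k_on (Suc k) B h"
  shows "C_k_on k B (\<lambda>y. integral (cbox 0 1) (\<lambda>t. t ^ n * h (y0 + t *\<^sub>R (y - y0))))"
  using h
proof (induction k arbitrary: h n)
  have inB: "y0 + t *\<^sub>R (y - y0) \<in> B" if "y \<in> B" "t \<in> cbox 0 1" for y t
  proof -
    have "(1 - t) *\<^sub>R y0 + t *\<^sub>R y \<in> B" using that B by (intro convexD) auto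
    then show ?thesis by (simp add: algebra_simps)
  qed
  have cont: "continuous_on (B \<times> cbox 0 1) (\<lambda>(y, t). t ^ m * h (y0 + t *\<^sub>R (y - y0)))"
    if "continuous_on B h" for h :: "real^3 \<Rightarrow> real" and m :: nat
    unfolding split_beta
    by (intro continuous_intros continuous_on_compose2[OF that]) (use inB in auto)
  {
    case 0
    have "continuous_on B (\<lambda>y. integral (cbox 0 1) (\<lambda>t. t ^ n * h (y0 + t *\<^sub>R (y - y0))))"
      by (rule integral_continuous_on_param[OF cont[OF C_k_on_continuous[OF "0.prems"]]])
    then show ?case by simp
  next
    case (Suc k)
    let ?D = "\<lambda>y b. frechet_derivative h (at y) b"
    let ?G = "\<lambda>y t. \<Sum>b\<in>Basis. (t ^ Suc n * ?D (y0 + t *\<^sub>R (y - y0)) b) *\<^sub>R b"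
    have Dc: "continuous_on B (\<lambda>y. ?D y b)" for b
    proof (rule C_k_on_continuous)
      show "C_k_on (Suc k) B (\<lambda>y. ?D y b)" using Suc.prems unfolding C_k_on.simps(2)[of "Suc k"] by blast
    qed
    have lin: "linear (?D y)" if "y \<in> B" for y
      using C_k_on_has_derivative[OF Suc.prems that] has_derivative_linear by blast
    have rep: "?D y w = (\<Sum>b\<in>Basis. (w \<bullet> b) * ?D y b)" if "y \<in> B" for y w
      using linear_sum[OF lin[OF that], of "\<lambda>b. (w \<bullet> b) *\<^sub>R b" Basis] linear_cmul[OF lin[OF that]]
      by (simp add: euclidean_representation)
    have contG: "continuous_on (B \<times> cbox 0 1) (\<lambda>(y, t). ?G y t)"
      using cont[OF Dc, of "Suc n"] unfolding split_beta
      by (intro continuous_on_sum continuous_on_scaleR continuous_on_const)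
    have GB: "?G y t \<bullet> v = t ^ Suc n * ?D (y0 + t *\<^sub>R (y - y0)) v" if "y \<in> B" "t \<in> cbox 0 1" for y t v
    proof -
      have "?G y t \<bullet> v = t ^ Suc n * (\<Sum>b\<in>Basis. (v \<bullet> b) * ?D (y0 + t *\<^sub>R (y - y0)) b)"
        by (simp add: inner_sum_left sum_distrib_left inner_commute[of v] mult_ac)
      then show ?thesis using rep[OF inB[OF that], of v] by simp
    qed
    have int: "?G y integrable_on cbox 0 1" if "y \<in> B" for y
    proof (rule integrable_continuous)
      have "continuous_on (cbox 0 1) (\<lambda>t. (\<lambda>(y, t). ?G y t) (y, t))"
        by (rule continuous_on_compose2[OF contG]) (use that in \<open>auto intro!: continuous_intros\<close>)
      then show "continuous_on (cbox 0 1) (?G y)" by simp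
    qed
    show ?case
    proof (rule C_k_on_SucI[OF B(1)])
      fix y assume y: "y \<in> B"
      have "((\<lambda>y. integral (cbox 0 1) (\<lambda>t. t ^ n * h (y0 + t *\<^sub>R (y - y0)))) has_derivative
          integral (cbox 0 1) (\<lambda>t. blinfun_inner_right (?G y t))) (at y within B)"
      proof (rule leibniz_rule[OF _ _ _ y B(2)])
        fix z t assume z: "z \<in> B" and t: "t \<in> cbox 0 (1::real)"
        have a: "((\<lambda>z. y0 + t *\<^sub>R (z - y0)) has_derivative (\<lambda>v. t *\<^sub>R v)) (at z)"
          by (auto intro!: derivative_eq_intros simp: algebra_simps)
        have "((\<lambda>z. h (y0 + t *\<^sub>R (z - y0))) has_derivative (\<lambda>v. ?D (y0 + t *\<^sub>R (z - y0)) (t *\<^sub>R v))) (at z)"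
          using diff_chain_at[OF a C_k_on_has_derivative[OF Suc.prems inB[OF z t]]] by (simp add: o_def)
        then have "((\<lambda>z. t ^ n * h (y0 + t *\<^sub>R (z - y0))) has_derivative
            (\<lambda>v. t ^ n * ?D (y0 + t *\<^sub>R (z - y0)) (t *\<^sub>R v))) (at z)"
          by (rule has_derivative_mult_right)
        moreover have "t ^ n * ?D (y0 + t *\<^sub>R (z - y0)) (t *\<^sub>R v) = ?G z t \<bullet> v" for v
          unfolding GB[OF z t] using linear_cmul[OF lin[OF inB[OF z t]]] by (simp add: mult_ac)
        ultimately show "((\<lambda>z. t ^ n * h (y0 + t *\<^sub>R (z - y0))) has_derivative
            blinfun_apply (blinfun_inner_right (?G z t))) (at z within B)"
          by (simp add: has_derivative_at_withinI)
      next
        fix z assume z: "z \<in> B"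
        have "continuous_on (cbox 0 1) (\<lambda>t. (\<lambda>(y, t). t ^ n * h (y0 + t *\<^sub>R (y - y0))) (z, t))"
          by (rule continuous_on_compose2[OF cont[OF C_k_on_continuous[OF Suc.prems]]])
             (use z in \<open>auto intro!: continuous_intros\<close>)
        then show "(\<lambda>t. t ^ n * h (y0 + t *\<^sub>R (z - y0))) integrable_on cbox 0 1"
          by (intro integrable_continuous) simp
      next
        show "continuous_on (B \<times> cbox 0 1) (\<lambda>(x, t). blinfun_inner_right (?G x t))"
          using bounded_linear.continuous_on[OF bounded_linear_blinfun_inner_right contG]
          by (simp add: split_beta)
      qed
      moreover have "blinfun_apply (integral (cbox 0 1) (\<lambda>t. blinfun_inner_right (?G y t))) =
          (\<lambda>v. integral (cbox 0 1) (\<lambda>t. t ^ Suc n * ?D (y0 + t *\<^sub>R (y - y0)) v))"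
      proof
        fix v
        have "integral (cbox 0 1) (\<lambda>t. blinfun_inner_right (?G y t)) = blinfun_inner_right (integral (cbox 0 1) (?G y))"
          using integral_linear[OF int[OF y] bounded_linear_blinfun_inner_right] by (simp add: o_def)
        then have "blinfun_apply (integral (cbox 0 1) (\<lambda>t. blinfun_inner_right (?G y t))) v = integral (cbox 0 1) (?G y) \<bullet> v"
          by simp
        also have "\<dots> = integral (cbox 0 1) (\<lambda>t. ?G y t \<bullet> v)"
          using integral_linear[OF int[OF y] bounded_linear_inner_left[of v]] by (simp add: o_def)
        also have "\<dots> = integral (cbox 0 1) (\<lambda>t. t ^ Suc n * ?D (y0 + t *\<^sub>R (y - y0)) v)"
          by (rule integral_cong) (use GB[OF y] in auto)
        finally show "blinfun_apply (integral (cbox 0 1) (\<lambda>t. blinfun_inner_right (?G y t))) v =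
          integral (cbox 0 1) (\<lambda>t. t ^ Suc n * ?D (y0 + t *\<^sub>R (y - y0)) v)" .
      qed
      ultimately show "((\<lambda>y. integral (cbox 0 1) (\<lambda>t. t ^ n * h (y0 + t *\<^sub>R (y - y0)))) has_derivative
          (\<lambda>v. integral (cbox 0 1) (\<lambda>t. t ^ Suc n * ?D (y0 + t *\<^sub>R (y - y0)) v))) (at y)"
        using at_within_open[OF y B(1)] by simp
    next
      show "C_k_on k B (\<lambda>y. integral (cbox 0 1) (\<lambda>t. t ^ Suc n * ?D (y0 + t *\<^sub>R (y - y0)) v))" for v
        using Suc.prems by (intro Suc.IH) simp
    qed
  }
qed

text \<open>The fundamental theorem of calculus on the segment from \<open>y0\<close> to \<open>y\<close>.\<close>

lemma Hadamard:
  fixes h :: "real^3 \<Rightarrow> real"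
  assumes B: "open B" "convex B" "y0 \<in> B" and h: "smooth_on B h"
  shows "\<exists>G. (\<forall>b. smooth_on B (G b)) \<and>
    (\<forall>y\<in>B. h y - h y0 = (\<Sum>b\<in>Basis. (y \<bullet> b - y0 \<bullet> b) * G b y)) \<and>
    (\<forall>b. G b y0 = frechet_derivative h (at y0) b)"
proof -
  define G where "G = (\<lambda>b y. integral (cbox 0 1) (\<lambda>t. t ^ 0 * frechet_derivative h (at (y0 + t *\<^sub>R (y - y0))) b))"
  let ?D = "\<lambda>y b. frechet_derivative h (at y) b"
  have hk: "C_k_on k B h" for k using h by (simp add: smooth_on_def)
  have Dk: "C_k_on k B (\<lambda>y. ?D y b)" for k b using hk[of "Suc k"] by simp
  have "smooth_on B (G b)" for b
    unfolding smooth_on_def G_def by (intro allI C_k_on_ray_integral B Dk)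
  moreover have "G b y0 = ?D y0 b" for b by (simp add: G_def)
  moreover have "h y - h y0 = (\<Sum>b\<in>Basis. (y \<bullet> b - y0 \<bullet> b) * G b y)" if y: "y \<in> B" for y
  proof -
    have inB: "y0 + t *\<^sub>R (y - y0) \<in> B" if "t \<in> {0..1}" for t
    proof -
      have "(1 - t) *\<^sub>R y0 + t *\<^sub>R y \<in> B" using that B y by (intro convexD) auto
      then show ?thesis by (simp add: algebra_simps)
    qed
    have hd: "((\<lambda>t. h (y0 + t *\<^sub>R (y - y0))) has_vector_derivative ?D (y0 + t *\<^sub>R (y - y0)) (y - y0)) (at t within {0..1})"
      if t: "t \<in> {0..1}" for t
    proof -
      have a: "((\<lambda>t. y0 + t *\<^sub>R (y - y0)) has_derivative (\<lambda>s. s *\<^sub>R (y - y0))) (at t)"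
        by (auto intro!: derivative_eq_intros)
      have d: "(h has_derivative ?D (y0 + t *\<^sub>R (y - y0))) (at (y0 + t *\<^sub>R (y - y0)))"
        by (rule C_k_on_has_derivative[OF hk inB[OF t]])
      have "((\<lambda>t. h (y0 + t *\<^sub>R (y - y0))) has_derivative (\<lambda>s. ?D (y0 + t *\<^sub>R (y - y0)) (s *\<^sub>R (y - y0)))) (at t)"
        using diff_chain_at[OF a d] by (simp add: o_def)
      then show ?thesis
        unfolding has_vector_derivative_def
        using linear_cmul[OF has_derivative_linear[OF d]] by (simp add: has_derivative_at_withinI)
    qed
    have "((\<lambda>t. ?D (y0 + t *\<^sub>R (y - y0)) (y - y0)) has_integral
        (h (y0 + 1 *\<^sub>R (y - y0)) - h (y0 + 0 *\<^sub>R (y - y0)))) {0..1}"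
      by (rule fundamental_theorem_of_calculus[OF _ hd]) auto
    then have "h y - h y0 = integral {0..1} (\<lambda>t. ?D (y0 + t *\<^sub>R (y - y0)) (y - y0))"
      by (simp add: integral_unique)
    also have "\<dots> = integral {0..1} (\<lambda>t. \<Sum>b\<in>Basis. (y \<bullet> b - y0 \<bullet> b) * ?D (y0 + t *\<^sub>R (y - y0)) b)"
    proof (rule integral_cong)
      fix t :: real assume t: "t \<in> {0..1}"
      have lin: "linear (?D (y0 + t *\<^sub>R (y - y0)))"
        using C_k_on_has_derivative[OF hk inB[OF t]] has_derivative_linear by blast
      have "?D (y0 + t *\<^sub>R (y - y0)) (\<Sum>b\<in>Basis. ((y - y0) \<bullet> b) *\<^sub>R b) =
          (\<Sum>b\<in>Basis. (y \<bullet> b - y0 \<bullet> b) * ?D (y0 + t *\<^sub>R (y - y0)) b)"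
        unfolding linear_sum[OF lin] linear_cmul[OF lin] by (simp add: inner_diff_left)
      then show "?D (y0 + t *\<^sub>R (y - y0)) (y - y0) = (\<Sum>b\<in>Basis. (y \<bullet> b - y0 \<bullet> b) * ?D (y0 + t *\<^sub>R (y - y0)) b)"
        unfolding euclidean_representation .
    qed
    also have "\<dots> = (\<Sum>b\<in>Basis. (y \<bullet> b - y0 \<bullet> b) * G b y)"
    proof -
      have i: "(\<lambda>t. ?D (y0 + t *\<^sub>R (y - y0)) b) integrable_on {0..1}" for b
      proof (intro integrable_continuous_real continuous_on_compose2[OF C_k_on_continuous[OF Dk[of 0 b]]])
        show "continuous_on {0..1} (\<lambda>t. y0 + t *\<^sub>R (y - y0))" by (intro continuous_intros)
      qed (use inB in auto)
      have "((\<lambda>t. ?D (y0 + t *\<^sub>R (y - y0)) b) has_integral G b y) {0..1}" for b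
        using integrable_integral[OF i[of b]] by (simp add: G_def cbox_interval)
      then show ?thesis
        by (intro integral_unique has_integral_sum has_integral_mult_right) auto
    qed
    finally show ?thesis .
  qed
  ultimately show ?thesis by blast
qed


section \<open>Smooth functions and tangent vectors on a manifold\<close>

locale smooth_manifold =
  fixes A :: "'a::t2_space atlas3"
  assumes atlas: "smooth_atlas A"
begin

abbreviation C where "C \<equiv> smooth_functions A"
abbreviation T where "T \<equiv> tangent_space A"
abbreviation VF where "VF \<equiv> vector_field A"

lemma chart:
  assumes "(U, \<phi>) \<in> A"
  shows "open U" "open (\<phi> ` U)" "continuous_on U \<phi>" "continuous_on (\<phi> ` U) (inv_into U \<phi>)" "inj_on \<phi> U"
    "x \<in> U \<Longrightarrow> inv_into U \<phi> (\<phi> x) = x"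
proof -
  have h: "homeomorphism U (\<phi> ` U) \<phi> (inv_into U \<phi>)" and o: "open U" "open (\<phi> ` U)"
    using atlas assms unfolding smooth_atlas_def by blast+
  show "open U" "open (\<phi> ` U)" by fact+
  show "continuous_on U \<phi>" "continuous_on (\<phi> ` U) (inv_into U \<phi>)"
    using h by (auto simp: homeomorphism_def)
  show "x \<in> U \<Longrightarrow> inv_into U \<phi> (\<phi> x) = x" for x using h by (auto simp: homeomorphism_def)
  then show "inj_on \<phi> U" by (metis inj_onI)
qed

lemma chart_cover: obtains U \<phi> where "(U, \<phi>) \<in> A" "x \<in> U"
proof -
  have "x \<in> (\<Union>(U, \<phi>)\<in>A. U)" using atlas by (simp add: smooth_atlas_def)
  then show ?thesis using that by auto
qed

lemma chart_transition:
  "(U, \<phi>) \<in> A \<Longrightarrow> (V, \<psi>) \<in> A \<Longrightarrow> smooth_on (\<phi> ` (U \<inter> V)) (\<psi> \<circ> inv_into U \<phi>)"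
  using atlas unfolding smooth_atlas_def by blast

lemma chart_image_open:
  assumes "(U, \<phi>) \<in> A" "open O'"
  shows "open (\<phi> ` (U \<inter> O'))"
proof -
  have "\<phi> ` (U \<inter> O') = \<phi> ` U \<inter> inv_into U \<phi> -` O'"
    using chart(6)[OF assms(1)] by auto
  then show ?thesis
    using continuous_open_preimage[OF chart(4)[OF assms(1)] chart(2)[OF assms(1)] assms(2)] by (simp add: Int_commute)
qed

lemma smooth_functions_iff:
  "f \<in> C \<longleftrightarrow> (\<forall>U \<phi> k. (U, \<phi>) \<in> A \<longrightarrow> C_k_on k (\<phi> ` U) (\<lambda>y. f (inv_into U \<phi> y)))"
  unfolding smooth_functions_def smooth_on_def by (auto simp: o_def)

lemma C_const: "(\<lambda>x. c) \<in> C"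
  by (auto simp: smooth_functions_iff intro: C_k_on_const chart)

lemma C_add: "f \<in> C \<Longrightarrow> h \<in> C \<Longrightarrow> (\<lambda>x. f x + h x) \<in> C"
  by (auto simp: smooth_functions_iff intro: C_k_on_add chart)

lemma C_mult: "f \<in> C \<Longrightarrow> h \<in> C \<Longrightarrow> (\<lambda>x. f x * h x) \<in> C"
  by (auto simp: smooth_functions_iff intro: C_k_on_mult chart)

lemma C_minus: "f \<in> C \<Longrightarrow> (\<lambda>x. - f x) \<in> C"
  by (auto simp: smooth_functions_iff intro: C_k_on_minus chart)

lemma C_diff: "f \<in> C \<Longrightarrow> h \<in> C \<Longrightarrow> (\<lambda>x. f x - h x) \<in> C"
  using C_add[of f "\<lambda>x. - h x"] C_minus by simp

lemma C_sum: "(\<And>i. i \<in> I \<Longrightarrow> f i \<in> C) \<Longrightarrow> (\<lambda>x. \<Sum>i\<in>I. f i x) \<in> C"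
  by (auto simp: smooth_functions_iff intro!: C_k_on_sum chart)

lemma C_inverse: "f \<in> C \<Longrightarrow> (\<And>x. f x \<noteq> 0) \<Longrightarrow> (\<lambda>x. inverse (f x)) \<in> C"
  by (auto simp: smooth_functions_iff intro: C_k_on_inverse chart)

lemma C_divide: "f \<in> C \<Longrightarrow> h \<in> C \<Longrightarrow> (\<And>x. h x \<noteq> 0) \<Longrightarrow> (\<lambda>x. f x / h x) \<in> C"
  using C_mult[OF _ C_inverse, of f h] by (simp add: divide_inverse)

lemma C_power2: "f \<in> C \<Longrightarrow> (\<lambda>x. (f x)\<^sup>2) \<in> C"
  unfolding power2_eq_square by (rule C_mult)

lemmas C_intros = C_const C_add C_mult C_minus C_diff C_sum C_power2

lemma C_continuous:
  assumes "f \<in> C" shows "continuous_on UNIV f"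
proof -
  have "continuous_on U f" if "(U, \<phi>) \<in> A" for U \<phi>
  proof -
    have "continuous_on (\<phi> ` U) (\<lambda>y. f (inv_into U \<phi> y))"
      using assms that C_k_on_continuous smooth_functions_iff by blast
    then have "continuous_on U (\<lambda>x. f (inv_into U \<phi> (\<phi> x)))"
      by (rule continuous_on_compose2[OF _ chart(3)[OF that]]) simp
    then show ?thesis using chart(6)[OF that] by (simp cong: continuous_on_cong)
  qed
  then have "continuous_on (\<Union>c\<in>A. fst c) f"
    by (intro continuous_on_open_UN) (auto intro: chart)
  moreover have "x \<in> (\<Union>c\<in>A. fst c)" for x
  proof (rule chart_cover[of x])
    fix U \<phi> assume "(U, \<phi>) \<in> A" "x \<in> U"
    then show ?thesis by (intro UN_I[of "(U, \<phi>)"]) auto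
  qed
  then have "(\<Union>c\<in>A. fst c) = UNIV" by blast
  ultimately show ?thesis by simp
qed

subsection \<open>Derivations\<close>

lemma T_nonsmooth: "v \<in> T p \<Longrightarrow> f \<notin> C \<Longrightarrow> v f = 0"
  by (simp add: tangent_space_def)

lemma T_lincomb: "v \<in> T p \<Longrightarrow> f \<in> C \<Longrightarrow> h \<in> C \<Longrightarrow> v (\<lambda>x. a * f x + b * h x) = a * v f + b * v h"
  by (simp add: tangent_space_def)

lemma T_mult: "v \<in> T p \<Longrightarrow> f \<in> C \<Longrightarrow> h \<in> C \<Longrightarrow> v (\<lambda>x. f x * h x) = f p * v h + h p * v f"
  by (simp add: tangent_space_def)

lemma T_const: assumes "v \<in> T p" shows "v (\<lambda>x. c) = 0"
proof -
  have "v (\<lambda>x. 1 * 1) = 0" using T_mult[OF assms C_const C_const, of 1 1] by simp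
  then show ?thesis using T_lincomb[OF assms C_const C_const, of c 1 0 1] by simp
qed

lemma T_add: "v \<in> T p \<Longrightarrow> f \<in> C \<Longrightarrow> h \<in> C \<Longrightarrow> v (\<lambda>x. f x + h x) = v f + v h"
  using T_lincomb[of v p f h 1 1] by simp

lemma T_diff: "v \<in> T p \<Longrightarrow> f \<in> C \<Longrightarrow> h \<in> C \<Longrightarrow> v (\<lambda>x. f x - h x) = v f - v h"
  using T_lincomb[of v p f h 1 "-1"] by simp

lemma T_cmult: "v \<in> T p \<Longrightarrow> f \<in> C \<Longrightarrow> v (\<lambda>x. a * f x) = a * v f"
  using T_lincomb[of v p f f a 0] by simp

lemma T_minus: "v \<in> T p \<Longrightarrow> f \<in> C \<Longrightarrow> v (\<lambda>x. - f x) = - v f"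
  using T_cmult[of v p f "-1"] by simp

lemma T_sum:
  assumes "v \<in> T p" "\<And>i. i \<in> I \<Longrightarrow> f i \<in> C"
  shows "v (\<lambda>x. \<Sum>i\<in>I. f i x) = (\<Sum>i\<in>I. v (f i))"
  using assms(2)
  by (induction I rule: infinite_finite_induct)
     (auto simp: T_const[OF assms(1)] T_add[OF assms(1)] C_sum)

lemma TI:
  assumes "\<And>f h a b. f \<in> C \<Longrightarrow> h \<in> C \<Longrightarrow> v (\<lambda>x. a * f x + b * h x) = a * v f + b * v h"
    and "\<And>f h. f \<in> C \<Longrightarrow> h \<in> C \<Longrightarrow> v (\<lambda>x. f x * h x) = f p * v h + h p * v f"
    and "\<And>f. f \<notin> C \<Longrightarrow> v f = 0"
  shows "v \<in> T p"
  using assms by (auto simp: tangent_space_def)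

lemma T_sum_closed:
  assumes "\<And>i. i \<in> I \<Longrightarrow> v i \<in> T p"
  shows "(\<lambda>f. \<Sum>i\<in>I. c i * v i f) \<in> T p"
proof (rule TI)
  fix f h a b assume fh: "f \<in> C" "h \<in> C"
  have "(\<Sum>i\<in>I. c i * v i (\<lambda>x. a * f x + b * h x)) = (\<Sum>i\<in>I. c i * (a * v i f + b * v i h))"
    using T_lincomb[OF assms fh] by (intro sum.cong) auto
  then show "(\<Sum>i\<in>I. c i * v i (\<lambda>x. a * f x + b * h x)) = a * (\<Sum>i\<in>I. c i * v i f) + b * (\<Sum>i\<in>I. c i * v i h)"
    by (simp add: sum_distrib_left algebra_simps sum.distrib)
  have "(\<Sum>i\<in>I. c i * v i (\<lambda>x. f x * h x)) = (\<Sum>i\<in>I. c i * (f p * v i h + h p * v i f))"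
    using T_mult[OF assms fh] by (intro sum.cong) auto
  then show "(\<Sum>i\<in>I. c i * v i (\<lambda>x. f x * h x)) = f p * (\<Sum>i\<in>I. c i * v i h) + h p * (\<Sum>i\<in>I. c i * v i f)"
    by (simp add: sum_distrib_left algebra_simps sum.distrib)
next
  show "(\<Sum>i\<in>I. c i * v i f) = 0" if "f \<notin> C" for f
    using T_nonsmooth[OF assms that] by simp
qed

lemma lincomb_T:
  assumes "u \<in> T p" "v \<in> T p"
  shows "lincomb a u b v \<in> T p"
proof -
  have "(\<lambda>f. \<Sum>i\<in>{True, False}. (if i then a else b) * (if i then u else v) f) \<in> T p"
    by (rule T_sum_closed) (use assms in auto)
  then show ?thesis by (simp add: lincomb_def)
qed

lemma VF_T: "VF X \<Longrightarrow> X p \<in> T p"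
  by (simp add: vector_field_def)

lemma VF_C: "VF X \<Longrightarrow> f \<in> C \<Longrightarrow> (\<lambda>p. X p f) \<in> C"
  by (simp add: vector_field_def)

lemma VF_sum:
  assumes "\<And>i. i \<in> I \<Longrightarrow> c i \<in> C" "\<And>i. i \<in> I \<Longrightarrow> VF (X i)"
  shows "VF (\<lambda>p f. \<Sum>i\<in>I. c i p * X i p f)"
  unfolding vector_field_def
proof (intro conjI allI ballI)
  show "(\<lambda>f. \<Sum>i\<in>I. c i p * X i p f) \<in> T p" for p
    by (rule T_sum_closed) (rule VF_T[OF assms(2)])
  show "(\<lambda>p. \<Sum>i\<in>I. c i p * X i p f) \<in> C" if "f \<in> C" for f
    by (rule C_sum, rule C_mult[OF assms(1) VF_C[OF assms(2) that]])
qed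

lemma VF_scale: "c \<in> C \<Longrightarrow> VF X \<Longrightarrow> VF (\<lambda>p f. c p * X p f)"
  using VF_sum[of "{()}" "\<lambda>_. c" "\<lambda>_. X"] by simp

lemma VF_combine:
  assumes "a \<in> C" "b \<in> C" "VF X" "VF Y"
  shows "VF (\<lambda>p f. a p * X p f + b p * Y p f)"
proof -
  have "VF (\<lambda>p f. \<Sum>i\<in>{True, False}. (if i then a else b) p * (if i then X else Y) p f)"
    by (rule VF_sum) (use assms in auto)
  then show ?thesis by simp
qed

lemma VF_add: "VF X \<Longrightarrow> VF Y \<Longrightarrow> VF (\<lambda>p f. X p f + Y p f)"
  using VF_combine[OF C_const[of 1] C_const[of 1]] by simp

subsection \<open>Local coordinates extended by bump functions\<close>

text \<open>A function in the coordinates of a chart, made global by multiplication with a bump function.\<close>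

definition lift :: "'a set \<Rightarrow> ('a \<Rightarrow> real^3) \<Rightarrow> real^3 \<Rightarrow> real \<Rightarrow> (real^3 \<Rightarrow> real) \<Rightarrow> 'a \<Rightarrow> real" where
  "lift U \<phi> c r G = (\<lambda>x. if x \<in> U \<and> \<phi> x \<in> ball c r then bump c r (\<phi> x) * G (\<phi> x) else 0)"

text \<open>The support lies in the compact set \<open>K\<close> corresponding to \<open>cball c r\<close>, which is closed because the manifold is
  Hausdorff; away from it the function is 0. Smoothness of \<open>G\<close> is required on a larger ball because it could
  blow up at the boundary of the support.\<close>

lemma lift_smooth:
  assumes ch: "(U, \<phi>) \<in> A" and r: "0 < r" "r < R" and B: "ball c R \<subseteq> \<phi> ` U"
    and G: "smooth_on (ball c R) G"
  shows "lift U \<phi> c r G \<in> C"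
  unfolding smooth_functions_iff
proof (intro allI impI)
  fix V \<psi> k assume ch': "(V, \<psi>) \<in> A"
  let ?W = "U \<inter> \<phi> -` ball c R" and ?K = "inv_into U \<phi> ` cball c r"
  have sub: "cball c r \<subseteq> ball c R" using r by auto
  have oW: "open ?W"
    using continuous_open_preimage[OF chart(3)[OF ch] chart(1)[OF ch], of "ball c R"] by (simp add: Int_commute)
  have cK: "closed ?K"
    by (intro compact_imp_closed compact_continuous_image continuous_on_subset[OF chart(4)[OF ch]])
       (use sub B in auto)
  have KW: "?K \<subseteq> ?W"
  proof
    fix x assume "x \<in> ?K"
    then obtain y where y: "y \<in> cball c r" "x = inv_into U \<phi> y" by auto
    then have "y \<in> \<phi> ` U" using sub B by auto
    with y show "x \<in> ?W" using sub by (auto simp: inv_into_into f_inv_into_f)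
  qed
  define \<tau> where "\<tau> = (\<phi> \<circ> inv_into V \<psi>)"
  have o1: "open (\<psi> ` (V \<inter> ?W))" and o2: "open (\<psi> ` (V \<inter> - ?K))"
    by (intro chart_image_open[OF ch'] oW, intro chart_image_open[OF ch'] open_Compl cK)
  have t: "C_k_on k (\<psi> ` (V \<inter> ?W)) \<tau>"
  proof (rule C_k_on_subset)
    show "C_k_on k (\<psi> ` (V \<inter> U)) \<tau>"
      using chart_transition[OF ch' ch] unfolding smooth_on_def \<tau>_def by blast
  qed auto
  have im: "\<tau> ` (\<psi> ` (V \<inter> ?W)) \<subseteq> ball c R"
    using chart(6)[OF ch'] by (auto simp: \<tau>_def)
  have 1: "C_k_on k (\<psi> ` (V \<inter> ?W)) (\<lambda>y. lift U \<phi> c r G (inv_into V \<psi> y))"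
  proof (rule C_k_on_cong[OF o1])
    show "C_k_on k (\<psi> ` (V \<inter> ?W)) (\<lambda>y. bump c r (\<tau> y) * G (\<tau> y))"
    proof (rule C_k_on_mult[OF o1])
      show "C_k_on k (\<psi> ` (V \<inter> ?W)) (\<lambda>y. bump c r (\<tau> y))"
        by (rule C_k_on_compose[OF o1 open_UNIV C_k_on_bump t]) simp
      show "C_k_on k (\<psi> ` (V \<inter> ?W)) (\<lambda>y. G (\<tau> y))"
        by (rule C_k_on_compose[OF o1 _ _ t im]) (use G in \<open>auto simp: smooth_on_def\<close>)
    qed
  qed (use chart(6)[OF ch'] bump_eq_0[OF r(1)] in \<open>auto simp: lift_def \<tau>_def\<close>)
  have 2: "C_k_on k (\<psi> ` (V \<inter> - ?K)) (\<lambda>y. lift U \<phi> c r G (inv_into V \<psi> y))"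
  proof (rule C_k_on_cong[OF o2 _ C_k_on_const[OF o2]])
    fix y assume "y \<in> \<psi> ` (V \<inter> - ?K)"
    then obtain x where x: "x \<in> V" "x \<notin> ?K" "y = \<psi> x" by auto
    have "x \<notin> U \<or> \<phi> x \<notin> ball c r"
    proof (rule ccontr)
      assume "\<not> ?thesis"
      then have "inv_into U \<phi> (\<phi> x) \<in> ?K" "x \<in> U" by (auto simp del: inv_into_f_f)
      then show False using x(2) chart(6)[OF ch] by simp
    qed
    then show "0 = lift U \<phi> c r G (inv_into V \<psi> y)"
      using x chart(6)[OF ch'] by (auto simp: lift_def)
  qed
  have "\<psi> ` V = \<psi> ` (V \<inter> ?W) \<union> \<psi> ` (V \<inter> - ?K)" using KW by blast
  then show "C_k_on k (\<psi> ` V) (\<lambda>y. lift U \<phi> c r G (inv_into V \<psi> y))"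
    using C_k_on_Un[OF o1 o2 1 2] by simp
qed

text \<open>The coordinate vector field in the direction \<open>b\<close>, multiplied by the bump function.\<close>

definition coord_field :: "'a set \<Rightarrow> ('a \<Rightarrow> real^3) \<Rightarrow> real^3 \<Rightarrow> real \<Rightarrow> real^3 \<Rightarrow> 'a vfield" where
  "coord_field U \<phi> c r b = (\<lambda>q f. if f \<in> C
      then lift U \<phi> c r (\<lambda>y. frechet_derivative (\<lambda>y. f (inv_into U \<phi> y)) (at y) b) q else 0)"

lemma coord_field_VF:
  assumes ch: "(U, \<phi>) \<in> A" and r: "0 < r" "r < R" and B: "ball c R \<subseteq> \<phi> ` U"
  shows "VF (coord_field U \<phi> c r b)"
  unfolding vector_field_def
proof (intro conjI allI ballI)
  fix f assume f: "f \<in> C"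
  have k: "C_k_on (Suc k) (\<phi> ` U) (\<lambda>y. f (inv_into U \<phi> y))" for k
    using f ch smooth_functions_iff by blast
  have "smooth_on (ball c R) (\<lambda>y. frechet_derivative (\<lambda>y. f (inv_into U \<phi> y)) (at y) b)"
    unfolding smooth_on_def
  proof
    show "C_k_on k (ball c R) (\<lambda>y. frechet_derivative (\<lambda>y. f (inv_into U \<phi> y)) (at y) b)" for k
      using k[of k] B unfolding C_k_on.simps by (blast intro: C_k_on_subset)
  qed
  from lift_smooth[OF ch r B this]
  show "(\<lambda>p. coord_field U \<phi> c r b p f) \<in> C" using f by (simp add: coord_field_def)
next
  fix p
  show "coord_field U \<phi> c r b p \<in> T p"
  proof (cases "p \<in> U \<and> \<phi> p \<in> ball c r")
    case False
    then show ?thesis by (auto intro!: TI simp: coord_field_def lift_def)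
  next
    case True
    let ?D = "\<lambda>f. frechet_derivative (\<lambda>y. f (inv_into U \<phi> y)) (at (\<phi> p))"
    have D: "((\<lambda>y. f (inv_into U \<phi> y)) has_derivative ?D f) (at (\<phi> p))" if "f \<in> C" for f
    proof (rule C_k_on_has_derivative)
      show "C_k_on (Suc 0) (\<phi> ` U) (\<lambda>y. f (inv_into U \<phi> y))" using that ch smooth_functions_iff by blast
    qed (use True in simp)
    have p: "inv_into U \<phi> (\<phi> p) = p" using True chart(6)[OF ch] by simp
    show ?thesis
    proof (rule TI)
      fix f h :: "'a \<Rightarrow> real" and a a' :: real assume fh: "f \<in> C" "h \<in> C"
      have "?D (\<lambda>x. a * f x + a' * h x) = (\<lambda>v. a * ?D f v + a' * ?D h v)"
        by (rule frechet_derivative_at[symmetric])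
           (intro has_derivative_add has_derivative_mult_right D fh)
      then show "coord_field U \<phi> c r b p (\<lambda>x. a * f x + a' * h x) =
          a * coord_field U \<phi> c r b p f + a' * coord_field U \<phi> c r b p h"
        using fh True by (simp add: coord_field_def lift_def C_intros algebra_simps)
      have "?D (\<lambda>x. f x * h x) = (\<lambda>v. f p * ?D h v + ?D f v * h p)"
        using has_derivative_mult[OF D[OF fh(1)] D[OF fh(2)]] unfolding p
        by (rule frechet_derivative_at[symmetric])
      then show "coord_field U \<phi> c r b p (\<lambda>x. f x * h x) =
          f p * coord_field U \<phi> c r b p h + h p * coord_field U \<phi> c r b p f"
        using fh True by (simp add: coord_field_def lift_def C_intros algebra_simps)
    qed (simp add: coord_field_def)
  qed
qed

text \<open>Hadamard's lemma says that a derivation is determined by its values on the coordinates.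
  With the coordinates \<open>x\<^sub>b\<close> replaced by the global functions \<open>\<eta> x\<^sub>b\<close> for a bump function \<open>\<eta>\<close>, the Leibniz
  rule gives \<open>\<eta> v(x\<^sub>b) = v(\<eta> x\<^sub>b) - x\<^sub>b v(\<eta>)\<close>, which explains the correction term; the powers of \<open>\<eta>\<close> keep
  all terms globally defined.\<close>

lemma derivation_expansion:
  assumes ch: "(U, \<phi>) \<in> A" and r: "0 < r" "r < R" and B: "ball c R \<subseteq> \<phi> ` U"
    and v: "v \<in> T q" and f: "f \<in> C"
  defines "\<eta> \<equiv> lift U \<phi> c r (\<lambda>y. 1)" and "x \<equiv> \<lambda>b. lift U \<phi> c r (\<lambda>y. y \<bullet> b)"
  shows "(\<eta> q)^3 * v f = (\<Sum>b\<in>Basis. (\<eta> q * v (x b) - x b q * v \<eta>) * coord_field U \<phi> c r b q f)"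
proof (cases "q \<in> U \<and> \<phi> q \<in> ball c r")
  case False
  then show ?thesis by (auto simp: \<eta>_def x_def lift_def)
next
  case True
  let ?B = "ball c R" and ?y0 = "\<phi> q"
  have y0: "?y0 \<in> ?B" using True r by auto
  have \<eta>q: "\<eta> q = bump c r ?y0" and xq: "x b q = \<eta> q * (?y0 \<bullet> b)" for b
    using True by (auto simp: \<eta>_def x_def lift_def)
  have hs: "smooth_on ?B (\<lambda>y. f (inv_into U \<phi> y))"
    unfolding smooth_on_def
  proof
    show "C_k_on k ?B (\<lambda>y. f (inv_into U \<phi> y))" for k
      using f ch B smooth_functions_iff C_k_on_subset by blast
  qed
  obtain G where Gs: "\<And>b. smooth_on ?B (G b)"
    and Ge: "\<And>y. y \<in> ?B \<Longrightarrow> f (inv_into U \<phi> y) - f (inv_into U \<phi> ?y0) = (\<Sum>b\<in>Basis. (y \<bullet> b - ?y0 \<bullet> b) * G b y)"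
    and G0: "\<And>b. G b ?y0 = frechet_derivative (\<lambda>y. f (inv_into U \<phi> y)) (at ?y0) b"
    using Hadamard[OF open_ball convex_ball y0 hs] by blast
  have \<eta>C: "\<eta> \<in> C" and xC: "x b \<in> C" for b
    unfolding \<eta>_def x_def
    by (rule lift_smooth[OF ch r B]; simp add: smooth_on_def C_k_on_const C_k_on_component)+
  have GC: "lift U \<phi> c r (G b) \<in> C" for b by (rule lift_smooth[OF ch r B Gs])
  let ?L = "\<lambda>z. (\<eta> z * \<eta> z) * (f z - f q)"
    and ?R = "\<lambda>b z. (x b z - (?y0 \<bullet> b) * \<eta> z) * lift U \<phi> c r (G b) z"
  have eq: "?L = (\<lambda>z. \<Sum>b\<in>Basis. ?R b z)"
  proof
    fix z
    show "?L z = (\<Sum>b\<in>Basis. ?R b z)"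
    proof (cases "z \<in> U \<and> \<phi> z \<in> ball c r")
      case False
      then show ?thesis by (auto simp: \<eta>_def x_def lift_def)
    next
      case t: True
      have "f z - f q = (\<Sum>b\<in>Basis. (\<phi> z \<bullet> b - ?y0 \<bullet> b) * G b (\<phi> z))"
        using Ge[of "\<phi> z"] t True r chart(6)[OF ch] by auto
      then show ?thesis
        using t by (simp add: \<eta>_def x_def lift_def sum_distrib_left algebra_simps)
    qed
  qed
  have "v ?L = (\<eta> q)\<^sup>2 * v f"
    using T_mult[OF v C_mult[OF \<eta>C \<eta>C] C_diff[OF f C_const[of "f q"]]]
    by (simp add: T_diff[OF v f C_const] T_const[OF v] power2_eq_square)
  moreover have "v (?R b) = (v (x b) - (?y0 \<bullet> b) * v \<eta>) * (\<eta> q * G b ?y0)" for b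
  proof -
    have "v (?R b) = lift U \<phi> c r (G b) q * v (\<lambda>z. x b z - (?y0 \<bullet> b) * \<eta> z)"
      by (subst T_mult[OF v C_diff[OF xC C_mult[OF C_const \<eta>C]] GC]) (simp add: xq)
    then show ?thesis
      using True by (simp add: T_diff[OF v xC C_mult[OF C_const \<eta>C]] T_cmult[OF v \<eta>C] lift_def \<eta>q)
  qed
  then have "v (\<lambda>z. \<Sum>b\<in>Basis. ?R b z) = (\<Sum>b\<in>Basis. (v (x b) - (?y0 \<bullet> b) * v \<eta>) * (\<eta> q * G b ?y0))"
    by (subst T_sum[OF v]) (auto intro!: C_intros xC \<eta>C GC)
  ultimately have "(\<eta> q)\<^sup>2 * v f = (\<Sum>b\<in>Basis. (v (x b) - (?y0 \<bullet> b) * v \<eta>) * (\<eta> q * G b ?y0))"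
    using eq by simp
  then have "\<eta> q * ((\<eta> q)\<^sup>2 * v f) = (\<Sum>b\<in>Basis. \<eta> q * ((v (x b) - (?y0 \<bullet> b) * v \<eta>) * (\<eta> q * G b ?y0)))"
    by (simp add: sum_distrib_left)
  moreover have "coord_field U \<phi> c r b q f = \<eta> q * G b ?y0" for b
    using True f by (simp add: coord_field_def lift_def \<eta>q G0)
  ultimately show ?thesis
    by (simp add: xq power3_eq_cube power2_eq_square algebra_simps)
qed

text \<open>The expansion of a derivation, rearranged as a sum of values \<open>v(F i)\<close> on functions times vector fields. The
  three correction terms with \<open>v(\<eta>)\<close> are collected under the index 0, which does not occur in the basis.
  At \<open>p\<close> itself the three coordinate fields span the tangent space.\<close>

lemma local_frame:
  obtains w I F E where "w \<in> C" "\<And>x. w x \<ge> (0::real)" "w p > 0"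
    "finite I" "\<And>i::real^3. F i \<in> C" "\<And>i. VF (E i)" 
    "\<And>q v f. v \<in> T q \<Longrightarrow> f \<in> C \<Longrightarrow> w q * v f = (\<Sum>i\<in>I. v (F i) * E i q f)"
    and "\<exists>e. (\<forall>i\<in>{0, 1, 2::nat}. e i \<in> T p) \<and> (\<forall>v\<in>T p. \<exists>d. v = (\<lambda>f. \<Sum>i\<in>{0, 1, 2}. d i * e i f))"
proof -
  obtain U \<phi> where ch: "(U, \<phi>) \<in> A" and p: "p \<in> U" by (rule chart_cover)
  obtain R where R: "R > 0" "ball (\<phi> p) R \<subseteq> \<phi> ` U"
    using chart(2)[OF ch] p open_contains_ball by blast
  define c r where "c = \<phi> p" and "r = R / 2"
  have r: "0 < r" "r < R" and B: "ball c R \<subseteq> \<phi> ` U" using R by (auto simp: r_def c_def)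
  define \<eta> where "\<eta> = lift U \<phi> c r (\<lambda>y. 1)"
  define x where "x = (\<lambda>b. lift U \<phi> c r (\<lambda>y. y \<bullet> b))"
  define D where "D = coord_field U \<phi> c r"
  have \<eta>C: "\<eta> \<in> C" and xC: "x b \<in> C" for b
    unfolding \<eta>_def x_def
    by (rule lift_smooth[OF ch r B]; simp add: smooth_on_def C_k_on_const C_k_on_component)+
  have DV: "VF (D b)" for b unfolding D_def by (rule coord_field_VF[OF ch r B])
  have ex: "(\<eta> q)^3 * v f = (\<Sum>b\<in>Basis. (\<eta> q * v (x b) - x b q * v \<eta>) * D b q f)"
    if "v \<in> T q" "f \<in> C" for v q f
    unfolding \<eta>_def x_def D_def by (rule derivation_expansion[OF ch r B that])
  have \<eta>0: "\<eta> q \<ge> 0" for q by (auto simp: \<eta>_def lift_def bump_nonneg)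
  have \<eta>p: "\<eta> p > 0" using p r bump_pos[OF r(1), of c c] by (simp add: \<eta>_def lift_def c_def)
  define I :: "(real^3) set" where "I = insert 0 Basis"
  define F where "F = (\<lambda>i. if i = 0 then \<eta> else x i)"
  define E where "E = (\<lambda>i. if i = 0 then (\<lambda>q f. \<Sum>b\<in>Basis. (- x b q) * D b q f)
      else (\<lambda>q f. \<eta> q * D i q f))"
  have expansion: "(\<eta> q * \<eta> q * \<eta> q) * v f = (\<Sum>i\<in>I. v (F i) * E i q f)" if "v \<in> T q" "f \<in> C" for v q f
  proof -
    have "(\<Sum>i\<in>I. v (F i) * E i q f) = v \<eta> * (\<Sum>b\<in>Basis. (- x b q) * D b q f) + (\<Sum>i\<in>Basis. v (F i) * E i q f)"
      unfolding I_def by (subst sum.insert) (auto simp: F_def E_def)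
    also have "(\<Sum>i\<in>Basis. v (F i) * E i q f) = (\<Sum>b\<in>Basis. v (x b) * (\<eta> q * D b q f))"
      by (rule sum.cong) (auto simp: F_def E_def)
    finally show ?thesis
      using ex[OF that] by (simp add: sum_distrib_left sum.distrib[symmetric] power3_eq_cube algebra_simps
          sum_negf sum_subtractf)
  qed
  show ?thesis
  proof (rule that)
    show "(\<lambda>q. \<eta> q * \<eta> q * \<eta> q) \<in> C" by (intro C_intros \<eta>C)
    show "\<And>q. \<eta> q * \<eta> q * \<eta> q \<ge> 0" using \<eta>0 by simp
    show "\<eta> p * \<eta> p * \<eta> p > 0" using \<eta>p by simp
    show "finite I" by (simp add: I_def)
    show "F i \<in> C" for i using \<eta>C xC by (simp add: F_def)
    show "VF (E i)" for i
      using VF_scale[OF \<eta>C DV] VF_sum[of Basis "\<lambda>b q. - x b q" D] DV C_minus[OF xC] by (auto simp: E_def)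
    show "\<And>q v f. v \<in> T q \<Longrightarrow> f \<in> C \<Longrightarrow> (\<eta> q * \<eta> q * \<eta> q) * v f = (\<Sum>i\<in>I. v (F i) * E i q f)"
      by (rule expansion)
  next
    obtain \<beta> where \<beta>: "bij_betw \<beta> {0, 1, 2::nat} (Basis :: (real^3) set)"
      using finite_same_card_bij[of "{0, 1, 2::nat}" "Basis :: (real^3) set"] by auto
    have span: "\<exists>d. v = (\<lambda>f. \<Sum>i\<in>{0, 1, 2}. d i * D (\<beta> i) p f)" if v: "v \<in> T p" for v
    proof -
      define d where "d = (\<lambda>b. (\<eta> p * v (x b) - x b p * v \<eta>) / (\<eta> p)^3)"
      have "v = (\<lambda>f. \<Sum>i\<in>{0, 1, 2}. (d \<circ> \<beta>) i * D (\<beta> i) p f)"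
      proof
        fix f
        have "v f = (\<Sum>b\<in>Basis. d b * D b p f)"
        proof (cases "f \<in> C")
          case True
          have "v f = (\<Sum>b\<in>Basis. (\<eta> p * v (x b) - x b p * v \<eta>) * D b p f) / (\<eta> p)^3"
            using ex[OF v True] \<eta>p by (simp add: field_simps)
          then show ?thesis by (simp add: sum_divide_distrib d_def)
        next
          case False
          then show ?thesis using T_nonsmooth[OF VF_T[OF DV] False] T_nonsmooth[OF v False] by simp
        qed
        also have "\<dots> = (\<Sum>i\<in>{0, 1, 2}. d (\<beta> i) * D (\<beta> i) p f)"
          using sum.reindex_bij_betw[OF \<beta>, of "\<lambda>b. d b * D b p f"] by simp
        finally show "v f = (\<Sum>i\<in>{0, 1, 2}. (d \<circ> \<beta>) i * D (\<beta> i) p f)" by simp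
      qed
      then show ?thesis by (intro exI[of _ "d \<circ> \<beta>"])
    qed
    define e where "e = (\<lambda>i. D (\<beta> i) p)"
    have "\<forall>i\<in>{0, 1, 2}. e i \<in> T p" unfolding e_def using VF_T[OF DV] by simp
    moreover have "\<forall>v\<in>T p. \<exists>d. v = (\<lambda>f. \<Sum>i\<in>{0, 1, 2}. d i * e i f)"
      unfolding e_def using span by simp
    ultimately show "\<exists>e. (\<forall>i\<in>{0, 1, 2::nat}. e i \<in> T p) \<and> (\<forall>v\<in>T p. \<exists>d. v = (\<lambda>f. \<Sum>i\<in>{0, 1, 2}. d i * e i f))"
      by blast
  qed
qed

text \<open>On a compact manifold finitely many functions and vector fields suffice to expand every tangent
  vector. This makes the module of vector fields a direct summand of a free module, so that every
  expression that is linear over the smooth functions is a pointwise one.\<close>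

lemma global_frame:
  assumes "compact (UNIV :: 'a set)"
  obtains n F E where "\<And>k. F k \<in> C" "\<And>k. VF (E k)"
    "\<And>q v. v \<in> T q \<Longrightarrow> v = (\<lambda>f. \<Sum>k<n::nat. v (F k) * E k q f)"
proof -
  define Q where "Q = (\<lambda>p w (I :: (real^3) set) F E. w \<in> C \<and> (\<forall>x. w x \<ge> (0::real)) \<and> w p > 0 \<and>
    finite I \<and> (\<forall>i. F i \<in> C) \<and> (\<forall>i. VF (E i)) \<and>
    (\<forall>q v f. v \<in> T q \<longrightarrow> f \<in> C \<longrightarrow> w q * v f = (\<Sum>i\<in>I. v (F i) * E i q f)))"
  have "\<exists>w I F E. Q p w I F E" for p
  proof (rule local_frame[of p])
    fix w I F E assume "w \<in> C" "\<And>x. w x \<ge> 0" "w p > 0" "finite (I :: (real^3) set)"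
      "\<And>i. F i \<in> C" "\<And>i. VF (E i)"
      "\<And>q v f. v \<in> T q \<Longrightarrow> f \<in> C \<Longrightarrow> w q * v f = (\<Sum>i\<in>I. v (F i) * E i q f)"
    then have "Q p w I F E" unfolding Q_def by simp
    then show ?thesis by blast
  qed
  then obtain w I F E where Q: "\<And>p. Q p (w p) (I p) (F p) (E p)" by metis
  then have w: "\<And>p. w p \<in> C" "\<And>p x. w p x \<ge> 0" "\<And>p. w p p > 0"
    and I: "\<And>p. finite (I p)" and F: "\<And>p i. F p i \<in> C" and E: "\<And>p i. VF (E p i)"
    and ex: "\<And>p q v f. v \<in> T q \<Longrightarrow> f \<in> C \<Longrightarrow> w p q * v f = (\<Sum>i\<in>I p. v (F p i) * E p i q f)"
    unfolding Q_def by blast+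
  let ?O = "\<lambda>p. {x. w p x > 0}"
  have "open (?O p)" for p
    using C_continuous[OF w(1)] by (intro open_Collect_less continuous_on_const)
  moreover have "UNIV \<subseteq> (\<Union>p\<in>UNIV. ?O p)" using w(3) by blast
  ultimately obtain S where S: "finite S" "UNIV \<subseteq> (\<Union>p\<in>S. ?O p)"
    using compactE_image[OF assms, of UNIV ?O] by metis
  define W where "W = (\<lambda>x. \<Sum>p\<in>S. w p x)"
  have WC: "W \<in> C" unfolding W_def by (intro C_intros w)
  have Wpos: "W x > 0" for x
  proof -
    obtain p where "p \<in> S" "w p x > 0" using S(2) by blast
    then show ?thesis unfolding W_def using S(1) w(2) by (intro sum_pos2) auto
  qed
  define K where "K = (SIGMA p:S. I p)"
  have fK: "finite K" unfolding K_def using S I by auto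
  obtain \<beta> where \<beta>: "bij_betw \<beta> {..<card K} K"
    using ex_bij_betw_nat_finite[OF fK] by (auto simp: atLeast0LessThan)
  define F' E' where "F' = (\<lambda>k. F (fst (\<beta> k)) (snd (\<beta> k)))"
    and "E' = (\<lambda>k q f. inverse (W q) * E (fst (\<beta> k)) (snd (\<beta> k)) q f)"
  show ?thesis
  proof (rule that)
    show "F' k \<in> C" for k by (simp add: F'_def F)
    show VE: "VF (E' k)" for k unfolding E'_def
      using Wpos by (intro VF_scale C_inverse WC E) (metis less_irrefl)
    show "v = (\<lambda>f. \<Sum>k<card K. v (F' k) * E' k q f)" if v: "v \<in> T q" for q v
    proof
      fix f
      show "v f = (\<Sum>k<card K. v (F' k) * E' k q f)"
      proof (cases "f \<in> C")
        case True
        have "W q * v f = (\<Sum>p\<in>S. \<Sum>i\<in>I p. v (F p i) * E p i q f)"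
          unfolding W_def sum_distrib_right by (intro sum.cong refl ex v True)
        also have "\<dots> = (\<Sum>(p, i)\<in>K. v (F p i) * E p i q f)"
          unfolding K_def using S I by (intro sum.Sigma) auto
        also have "\<dots> = (\<Sum>k<card K. (\<lambda>(p, i). v (F p i) * E p i q f) (\<beta> k))"
          using sum.reindex_bij_betw[OF \<beta>, of "\<lambda>(p, i). v (F p i) * E p i q f"] by simp
        finally have "v f = inverse (W q) * (\<Sum>k<card K. (\<lambda>(p, i). v (F p i) * E p i q f) (\<beta> k))"
          using Wpos[of q] by (simp add: field_simps)
        then show ?thesis by (simp add: sum_distrib_left F'_def E'_def split_beta mult_ac)
      next
        case False
        then show ?thesis using T_nonsmooth[OF VF_T[OF VE] False] T_nonsmooth[OF v False] by simp
      qed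
    qed
  qed
qed

end


section \<open>Tensors, brackets and exterior derivatives\<close>

context smooth_manifold
begin

lemma linear_at_lincomb:
  "linear_at A p l \<Longrightarrow> u \<in> T p \<Longrightarrow> v \<in> T p \<Longrightarrow> l (\<lambda>f. a * u f + b * v f) = a * l u + b * l v"
  by (simp add: linear_at_def lincomb_def)

lemma linear_at_add: "linear_at A p l \<Longrightarrow> u \<in> T p \<Longrightarrow> v \<in> T p \<Longrightarrow> l (\<lambda>f. u f + v f) = l u + l v"
  using linear_at_lincomb[of p l u v 1 1] by simp

lemma linear_at_diff: "linear_at A p l \<Longrightarrow> u \<in> T p \<Longrightarrow> v \<in> T p \<Longrightarrow> l (\<lambda>f. u f - v f) = l u - l v"
  using linear_at_lincomb[of p l u v 1 "-1"] by simp

lemma linear_at_scale: "linear_at A p l \<Longrightarrow> u \<in> T p \<Longrightarrow> l (\<lambda>f. a * u f) = a * l u"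
  using linear_at_lincomb[of p l u u a 0] by simp

lemma linear_at_minus: "linear_at A p l \<Longrightarrow> u \<in> T p \<Longrightarrow> l (\<lambda>f. - u f) = - l u"
  using linear_at_scale[of p l u "-1"] by simp

lemma T_zero: "(\<lambda>f. 0) \<in> T p"
  by (rule TI) auto

lemma linear_at_zero: "linear_at A p l \<Longrightarrow> l (\<lambda>f. 0) = 0"
  using linear_at_scale[OF _ T_zero, of p l 0] by simp

lemma linear_at_sum:
  assumes "linear_at A p l" "\<And>i. i \<in> I \<Longrightarrow> v i \<in> T p"
  shows "l (\<lambda>f. \<Sum>i\<in>I. c i * v i f) = (\<Sum>i\<in>I. c i * l (v i))"
  using assms(2)
proof (induction I rule: infinite_finite_induct)
  case (insert i I)
  have "l (\<lambda>f. \<Sum>i\<in>insert i I. c i * v i f) = l (\<lambda>f. c i * v i f + 1 * (\<Sum>i\<in>I. c i * v i f))"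
    using insert by simp
  also have "\<dots> = c i * l (v i) + 1 * l (\<lambda>f. \<Sum>i\<in>I. c i * v i f)"
    by (rule linear_at_lincomb[OF assms(1)]) (use insert in \<open>auto intro: T_sum_closed\<close>)
  finally show ?case using insert by simp
qed (simp_all add: linear_at_zero[OF assms(1)])

lemma linear_atI:
  "(\<And>u v a b. u \<in> T p \<Longrightarrow> v \<in> T p \<Longrightarrow> l (\<lambda>f. a * u f + b * v f) = a * l u + b * l v) \<Longrightarrow> linear_at A p l"
  by (simp add: linear_at_def lincomb_def)

lemma T_combine: "u \<in> T p \<Longrightarrow> v \<in> T p \<Longrightarrow> (\<lambda>f. a * u f + b * v f) \<in> T p"
  using lincomb_T by (simp add: lincomb_def)

lemma T_scale: "u \<in> T p \<Longrightarrow> (\<lambda>f. a * u f) \<in> T p"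
  using T_combine[of u p u a 0] by simp

lemma T_plus: "u \<in> T p \<Longrightarrow> v \<in> T p \<Longrightarrow> (\<lambda>f. u f + v f) \<in> T p"
  using T_combine[of u p v 1 1] by simp

lemma T_sub: "u \<in> T p \<Longrightarrow> v \<in> T p \<Longrightarrow> (\<lambda>f. u f - v f) \<in> T p"
  using T_combine[of u p v 1 "-1"] by simp

lemma VF_sub: "VF X \<Longrightarrow> VF Y \<Longrightarrow> VF (\<lambda>p f. X p f - Y p f)"
  using VF_combine[OF C_const[of 1] C_const[of "-1"]] by simp

lemma VF_minus: "VF X \<Longrightarrow> VF (\<lambda>p f. - X p f)"
  using VF_scale[OF C_const[of "-1"]] by simp

lemma VF_zero: "VF (\<lambda>p f. 0)"
  by (auto simp: vector_field_def T_zero C_const)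

lemma one_form_linear: "one_form A \<omega> \<Longrightarrow> linear_at A p (\<omega> p)"
  by (simp add: one_form_def)

lemma one_form_C: "one_form A \<omega> \<Longrightarrow> VF X \<Longrightarrow> (\<lambda>p. \<omega> p (X p)) \<in> C"
  by (simp add: one_form_def)

subsection \<open>The Lie bracket\<close>

abbreviation br where "br \<equiv> lie_bracket A"

lemma br_at: "f \<in> C \<Longrightarrow> br X Y p f = X p (\<lambda>q. Y q f) - Y p (\<lambda>q. X q f)"
  by (simp add: lie_bracket_def)

lemma br_nonsmooth: "f \<notin> C \<Longrightarrow> br X Y p f = 0"
  by (simp add: lie_bracket_def)

lemma br_VF:
  assumes X: "VF X" and Y: "VF Y" shows "VF (br X Y)"
  unfolding vector_field_def
proof (intro conjI allI ballI)
  fix f assume f: "f \<in> C"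
  have "(\<lambda>p. X p (\<lambda>q. Y q f) - Y p (\<lambda>q. X q f)) \<in> C"
    by (intro C_diff VF_C[OF X VF_C[OF Y f]] VF_C[OF Y VF_C[OF X f]])
  then show "(\<lambda>p. br X Y p f) \<in> C" using br_at[OF f] by simp
next
  fix p
  note TX = VF_T[OF X] and TY = VF_T[OF Y] and CX = VF_C[OF X] and CY = VF_C[OF Y]
  show "br X Y p \<in> T p"
  proof (rule TI)
    fix f h :: "'a \<Rightarrow> real" and a b :: real assume f: "f \<in> C" and h: "h \<in> C"
    have "(\<lambda>x. a * f x + b * h x) \<in> C" by (intro C_add C_mult C_const f h)
    then show "br X Y p (\<lambda>x. a * f x + b * h x) = a * br X Y p f + b * br X Y p h"
      by (simp add: br_at f h T_lincomb[OF TX f h] T_lincomb[OF TY f h]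
          T_lincomb[OF TX CY[OF f] CY[OF h]] T_lincomb[OF TY CX[OF f] CX[OF h]] algebra_simps)
    have XY: "X p (\<lambda>q. f q * Y q h + h q * Y q f) =
        (f p * X p (\<lambda>q. Y q h) + Y p h * X p f) + (h p * X p (\<lambda>q. Y q f) + Y p f * X p h)"
      by (simp add: T_add[OF TX C_mult[OF f CY[OF h]] C_mult[OF h CY[OF f]]]
          T_mult[OF TX f CY[OF h]] T_mult[OF TX h CY[OF f]])
    have YX: "Y p (\<lambda>q. f q * X q h + h q * X q f) =
        (f p * Y p (\<lambda>q. X q h) + X p h * Y p f) + (h p * Y p (\<lambda>q. X q f) + X p f * Y p h)"
      by (simp add: T_add[OF TY C_mult[OF f CX[OF h]] C_mult[OF h CX[OF f]]]
          T_mult[OF TY f CX[OF h]] T_mult[OF TY h CX[OF f]])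
    show "br X Y p (\<lambda>x. f x * h x) = f p * br X Y p h + h p * br X Y p f"
      by (simp add: br_at C_mult[OF f h] f h T_mult[OF TX f h] T_mult[OF TY f h] XY YX algebra_simps)
  qed (rule br_nonsmooth)
qed

lemma br_antisym: "br X Y = (\<lambda>p f. - br Y X p f)"
  by (auto simp: lie_bracket_def fun_eq_iff)

lemma br_add_right:
  assumes "VF X" "VF Y" "VF Z"
  shows "br X (\<lambda>p f. Y p f + Z p f) = (\<lambda>p f. br X Y p f + br X Z p f)"
proof (intro ext)
  fix p f show "br X (\<lambda>p f. Y p f + Z p f) p f = br X Y p f + br X Z p f"
    by (cases "f \<in> C") (auto simp: br_at br_nonsmooth T_add[OF VF_T[OF assms(1)]] VF_C assms)
qed

lemma br_scale_right:
  assumes "VF X" "VF Y" "c \<in> C"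
  shows "br X (\<lambda>p f. c p * Y p f) = (\<lambda>p f. X p c * Y p f + c p * br X Y p f)"
proof (intro ext)
  fix p f show "br X (\<lambda>p f. c p * Y p f) p f = X p c * Y p f + c p * br X Y p f"
    by (cases "f \<in> C")
       (auto simp: br_at br_nonsmooth T_mult[OF VF_T[OF assms(1)] assms(3)] VF_C assms
          T_nonsmooth[OF VF_T[OF assms(2)]] algebra_simps)
qed

lemma br_add_left:
  assumes "VF X" "VF Y" "VF Z"
  shows "br (\<lambda>p f. Y p f + Z p f) X = (\<lambda>p f. br Y X p f + br Z X p f)"
  unfolding br_antisym[of _ X] br_add_right[OF assms] by simp

lemma br_scale_left:
  assumes "VF X" "VF Y" "c \<in> C"
  shows "br (\<lambda>p f. c p * Y p f) X = (\<lambda>p f. c p * br Y X p f - X p c * Y p f)"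
  unfolding br_antisym[of _ X] br_scale_right[OF assms] by (intro ext) simp

lemma br_Jacobi:
  assumes X: "VF X" and Y: "VF Y" and Z: "VF Z"
  shows "br X (br Y Z) = (\<lambda>p f. br (br X Y) Z p f + br Y (br X Z) p f)"
proof (intro ext)
  fix p f
  show "br X (br Y Z) p f = br (br X Y) Z p f + br Y (br X Z) p f"
  proof (cases "f \<in> C")
    case True
    note c = VF_C[OF X True] VF_C[OF Y True] VF_C[OF Z True]
    show ?thesis
      using True by (simp add: br_at c VF_C[OF br_VF[OF _ _] True] T_diff[OF VF_T[OF X]] T_diff[OF VF_T[OF Y]]
        T_diff[OF VF_T[OF Z]] VF_C[OF X] VF_C[OF Y] VF_C[OF Z])
  qed (simp add: br_nonsmooth)
qed

end

locale framed_manifold = smooth_manifold A for A :: "'a::t2_space atlas3" +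
  fixes n :: nat and F :: "nat \<Rightarrow> 'a \<Rightarrow> real" and E :: "nat \<Rightarrow> 'a vfield"
  assumes F_C: "F k \<in> smooth_functions A"
    and E_VF: "vector_field A (E k)"
    and expand: "v \<in> tangent_space A q \<Longrightarrow> v = (\<lambda>f. \<Sum>k<n. v (F k) * E k q f)"
begin

lemma VF_expand: "VF X \<Longrightarrow> X = (\<lambda>q f. \<Sum>k<n. X q (F k) * E k q f)"
  by (rule ext) (rule expand[OF VF_T])

lemma extension:
  assumes "u \<in> T p"
  shows "VF (extend_tvec A p u)" "extend_tvec A p u p = u"
proof -
  have "VF (\<lambda>q f. \<Sum>k<n. u (F k) * E k q f)"
    by (intro VF_sum C_const E_VF)
  moreover have "(\<lambda>q f. \<Sum>k<n. u (F k) * E k q f) p = u" by (rule expand[OF assms, symmetric])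
  ultimately have "\<exists>X. VF X \<and> X p = u" by blast
  from someI_ex[OF this] show "VF (extend_tvec A p u)" "extend_tvec A p u p = u"
    unfolding extend_tvec_def by auto
qed

text \<open>Expanding a field in the global frame turns linearity over the smooth functions into dependence on the
  coefficients \<open>X p (F k)\<close> only.\<close>

lemma tensorial:
  fixes \<Phi> :: "'a vfield \<Rightarrow> real"
  assumes add: "\<And>X Y. VF X \<Longrightarrow> VF Y \<Longrightarrow> \<Phi> (\<lambda>q f. X q f + Y q f) = \<Phi> X + \<Phi> Y"
    and hom: "\<And>c X. c \<in> C \<Longrightarrow> VF X \<Longrightarrow> \<Phi> (\<lambda>q f. c q * X q f) = c p * \<Phi> X"
    and X: "VF X" and Y: "VF Y" and XY: "X p = Y p"
  shows "\<Phi> X = \<Phi> Y"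
proof -
  have z: "\<Phi> (\<lambda>q f. 0) = 0" using hom[OF C_const[of 0] VF_zero] by simp
  have s: "\<Phi> (\<lambda>q f. \<Sum>k\<in>I. c k q * E k q f) = (\<Sum>k\<in>I. c k p * \<Phi> (E k))"
    if "\<And>k. c k \<in> C" for c and I :: "nat set"
  proof (induction I rule: infinite_finite_induct)
    case (insert k I)
    then have "\<Phi> (\<lambda>q f. \<Sum>k\<in>insert k I. c k q * E k q f) =
        \<Phi> (\<lambda>q f. c k q * E k q f + (\<Sum>k\<in>I. c k q * E k q f))" by simp
    also have "\<dots> = c k p * \<Phi> (E k) + (\<Sum>k\<in>I. c k p * \<Phi> (E k))"
      using insert by (subst add) (auto intro!: VF_scale VF_sum E_VF that simp: hom E_VF that)
    finally show ?case using insert by simp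
  qed (simp_all add: z)
  have "\<Phi> Z = (\<Sum>k<n. Z p (F k) * \<Phi> (E k))" if Z: "VF Z" for Z
    by (subst VF_expand[OF Z]) (rule s[OF VF_C[OF Z F_C]])
  from this[OF X] this[OF Y] XY show ?thesis by simp
qed

text \<open>The passage from a functional on vector fields, such as Koszul's expression for a connection, to a one-form
  to which the inverse metric can be applied.\<close>

lemma one_form_of_fields:
  assumes add: "\<And>X Y p. VF X \<Longrightarrow> VF Y \<Longrightarrow> \<Phi> (\<lambda>q f. X q f + Y q f) p = \<Phi> X p + \<Phi> Y p"
    and hom: "\<And>c X p. c \<in> C \<Longrightarrow> VF X \<Longrightarrow> \<Phi> (\<lambda>q f. c q * X q f) p = c p * \<Phi> X p"
    and smooth: "\<And>X. VF X \<Longrightarrow> \<Phi> X \<in> C"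
  defines "\<omega> \<equiv> \<lambda>p u. \<Phi> (extend_tvec A p u) p"
  shows "one_form A \<omega>" "VF X \<Longrightarrow> \<omega> p (X p) = \<Phi> X p"
proof -
  have tens: "\<Phi> X p = \<Phi> Y p" if "VF X" "VF Y" "X p = Y p" for X Y p
    by (rule tensorial[where \<Phi> = "\<lambda>X. \<Phi> X p", OF add hom that])
  show eq: "\<omega> p (X p) = \<Phi> X p" if X: "VF X" for X p
    unfolding \<omega>_def by (rule tens) (simp_all add: extension[OF VF_T[OF X]] X)
  show "one_form A \<omega>"
    unfolding one_form_def
  proof (intro conjI allI impI)
    fix p show "linear_at A p (\<omega> p)"
    proof (rule linear_atI)
      fix u v a b assume u: "u \<in> T p" and v: "v \<in> T p"
      let ?U = "extend_tvec A p u" and ?V = "extend_tvec A p v"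
      have V: "VF (\<lambda>q f. a * ?U q f)" "VF (\<lambda>q f. b * ?V q f)"
        by (intro VF_scale C_const extension u v)+
      have "\<omega> p (\<lambda>f. a * u f + b * v f) = \<Phi> (\<lambda>q f. a * ?U q f + b * ?V q f) p"
        using eq[OF VF_add[OF V], of p] by (simp add: extension u v)
      also have "\<dots> = a * \<Phi> ?U p + b * \<Phi> ?V p"
        by (simp add: add V hom[OF C_const] extension u v)
      finally show "\<omega> p (\<lambda>f. a * u f + b * v f) = a * \<omega> p u + b * \<omega> p v" by (simp add: \<omega>_def)
    qed
  next
    fix X assume X: "VF X"
    show "(\<lambda>p. \<omega> p (X p)) \<in> C" using smooth[OF X] by (simp add: eq[OF X])
  qed
qed

subsection \<open>The exterior derivative of a one-form\<close>

lemma ext_deriv_fields_antisym: 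
  assumes "one_form A \<alpha>" "VF X" "VF Y"
  shows "ext_deriv_fields A \<alpha> X Y p = - ext_deriv_fields A \<alpha> Y X p"
  unfolding ext_deriv_fields_def br_antisym[of X Y]
  by (simp add: linear_at_minus[OF one_form_linear[OF assms(1)] VF_T[OF br_VF]] assms)

lemma ext_deriv_fields_add:
  assumes \<alpha>: "one_form A \<alpha>" and X: "VF X" and Y: "VF Y" and Z: "VF Z"
  shows "ext_deriv_fields A \<alpha> X (\<lambda>q f. Y q f + Z q f) p =
    ext_deriv_fields A \<alpha> X Y p + ext_deriv_fields A \<alpha> X Z p"
  unfolding ext_deriv_fields_def br_add_right[OF X Y Z]
  by (simp add: linear_at_add[OF one_form_linear[OF \<alpha>]] VF_T br_VF X Y Z one_form_C[OF \<alpha>]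
      T_add[OF VF_T[OF X]])

lemma ext_deriv_fields_scale:
  assumes \<alpha>: "one_form A \<alpha>" and X: "VF X" and Y: "VF Y" and c: "c \<in> C"
  shows "ext_deriv_fields A \<alpha> X (\<lambda>q f. c q * Y q f) p = c p * ext_deriv_fields A \<alpha> X Y p"
  unfolding ext_deriv_fields_def br_scale_right[OF X Y c]
  by (simp add: linear_at_scale[OF one_form_linear[OF \<alpha>]] linear_at_lincomb[OF one_form_linear[OF \<alpha>]]
      VF_T br_VF X Y one_form_C[OF \<alpha>] T_mult[OF VF_T[OF X] c] algebra_simps)

lemma ext_deriv_fields_C:
  assumes \<alpha>: "one_form A \<alpha>" and X: "VF X" and Y: "VF Y"
  shows "ext_deriv_fields A \<alpha> X Y \<in> C"
proof -
  have "(\<lambda>p. X p (\<lambda>q. \<alpha> q (Y q)) - Y p (\<lambda>q. \<alpha> q (X q)) - \<alpha> p (br X Y p)) \<in> C"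
    by (intro C_diff VF_C[OF X] VF_C[OF Y] one_form_C[OF \<alpha>] br_VF X Y)
  then show ?thesis by (simp add: ext_deriv_fields_def[abs_def])
qed

text \<open>\<open>ext_deriv\<close> is evaluated on chosen extensions of the two vectors; by tensoriality in each argument any other
  extensions give the same value.\<close>

lemma ext_deriv_at:
  assumes \<alpha>: "one_form A \<alpha>" and X: "VF X" and Y: "VF Y"
  shows "ext_deriv A \<alpha> p (X p) (Y p) = ext_deriv_fields A \<alpha> X Y p"
proof -
  have r: "ext_deriv_fields A \<alpha> X Y p = ext_deriv_fields A \<alpha> X Y' p"
    if "VF X" "VF Y" "VF Y'" "Y p = Y' p" for X Y Y'
    by (rule tensorial[where \<Phi> = "\<lambda>Y. ext_deriv_fields A \<alpha> X Y p",
          OF ext_deriv_fields_add[OF \<alpha> that(1)] ext_deriv_fields_scale[OF \<alpha> that(1)] that(2-4)])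
  let ?X = "extend_tvec A p (X p)" and ?Y = "extend_tvec A p (Y p)"
  have e: "VF ?X" "?X p = X p" "VF ?Y" "?Y p = Y p" by (intro extension VF_T X Y)+
  have "ext_deriv_fields A \<alpha> ?X ?Y p = ext_deriv_fields A \<alpha> ?X Y p" by (rule r) (use e Y in auto)
  also have "\<dots> = - ext_deriv_fields A \<alpha> Y ?X p" by (rule ext_deriv_fields_antisym[OF \<alpha> e(1) Y])
  also have "\<dots> = - ext_deriv_fields A \<alpha> Y X p" using r[OF Y e(1) X e(2)] by simp
  also have "\<dots> = ext_deriv_fields A \<alpha> X Y p" using ext_deriv_fields_antisym[OF \<alpha> X Y] by simp
  finally show ?thesis by (simp add: ext_deriv_def)
qed

lemma ext_deriv_C:
  "one_form A \<alpha> \<Longrightarrow> VF X \<Longrightarrow> VF Y \<Longrightarrow> (\<lambda>p. ext_deriv A \<alpha> p (X p) (Y p)) \<in> C"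
  using ext_deriv_fields_C[of \<alpha> X Y] by (simp add: ext_deriv_at)

lemma ext_deriv_antisym:
  assumes "one_form A \<alpha>" "u \<in> T p" "v \<in> T p"
  shows "ext_deriv A \<alpha> p u v = - ext_deriv A \<alpha> p v u"
  unfolding ext_deriv_def
  by (rule ext_deriv_fields_antisym[OF assms(1)]) (intro extension assms)+

lemma ext_deriv_linear_right:
  assumes \<alpha>: "one_form A \<alpha>" and u: "u \<in> T p"
  shows "linear_at A p (ext_deriv A \<alpha> p u)"
proof (rule linear_atI)
  fix v w a b assume v: "v \<in> T p" and w: "w \<in> T p"
  let ?U = "extend_tvec A p u" and ?V = "extend_tvec A p v" and ?W = "extend_tvec A p w"
  have U: "VF ?U" and V: "VF ?V" and W: "VF ?W" by (intro extension u v w)+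
  have V': "VF (\<lambda>q f. a * ?V q f)" "VF (\<lambda>q f. b * ?W q f)"
    by (intro VF_scale C_const V W)+
  have "ext_deriv A \<alpha> p (?U p) (\<lambda>f. a * ?V p f + b * ?W p f) =
      a * ext_deriv_fields A \<alpha> ?U ?V p + b * ext_deriv_fields A \<alpha> ?U ?W p"
    using ext_deriv_at[OF \<alpha> U VF_add[OF V'], of p]
    by (simp add: ext_deriv_fields_add[OF \<alpha> U V'] ext_deriv_fields_scale[OF \<alpha> U _ C_const] V W)
  then show "ext_deriv A \<alpha> p u (\<lambda>f. a * v f + b * w f) = a * ext_deriv A \<alpha> p u v + b * ext_deriv A \<alpha> p u w"
    by (simp add: extension u v w) (simp add: ext_deriv_def)
qed

lemma ext_deriv_linear_left:
  assumes \<alpha>: "one_form A \<alpha>" and v: "v \<in> T p"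
  shows "linear_at A p (\<lambda>u. ext_deriv A \<alpha> p u v)"
proof (rule linear_atI)
  fix u w a b assume u: "u \<in> T p" and w: "w \<in> T p"
  show "ext_deriv A \<alpha> p (\<lambda>f. a * u f + b * w f) v = a * ext_deriv A \<alpha> p u v + b * ext_deriv A \<alpha> p w v"
    using linear_at_lincomb[OF ext_deriv_linear_right[OF \<alpha> v] u w, of a b]
    by (simp add: ext_deriv_antisym[OF \<alpha> _ v] T_combine u w)
qed

lemma T_spanned:
  "\<exists>e. (\<forall>i\<in>{0, 1, 2::nat}. e i \<in> T p) \<and> (\<forall>v\<in>T p. \<exists>d. v = (\<lambda>f. \<Sum>i\<in>{0, 1, 2}. d i * e i f))"
  by (rule local_frame[of p])

text \<open>A 4-form on a 3-dimensional space vanishes; this one is \<open>\<beta> \<and> \<beta>\<close> with \<open>\<beta> = d\<alpha>\<close>.\<close>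

lemma ext_deriv_Pfaffian:
  assumes \<alpha>: "one_form A \<alpha>" and T: "a \<in> T p" "b \<in> T p" "c \<in> T p" "d \<in> T p"
  defines "\<beta> \<equiv> ext_deriv A \<alpha> p"
  shows "\<beta> a b * \<beta> c d - \<beta> a c * \<beta> b d + \<beta> a d * \<beta> b c = 0"
proof -
  obtain e where e': "\<forall>i\<in>{0, 1, 2::nat}. e i \<in> T p"
    and sp: "\<forall>v\<in>T p. \<exists>d. v = (\<lambda>f. \<Sum>i\<in>{0, 1, 2}. d i * e i f)"
    using T_spanned[of p] by (elim exE conjE)
  note e = bspec[OF e']
  have lin: "\<beta> (\<lambda>f. \<Sum>i\<in>{0, 1, 2}. x i * e i f) (\<lambda>f. \<Sum>i\<in>{0, 1, 2}. y i * e i f) =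
      (x 0 * y 1 - x 1 * y 0) * \<beta> (e 0) (e 1) + (x 0 * y 2 - x 2 * y 0) * \<beta> (e 0) (e 2)
      + (x 1 * y 2 - x 2 * y 1) * \<beta> (e 1) (e 2)" for x y
  proof -
    have as: "\<beta> (e i) (e j) = - \<beta> (e j) (e i)" if "i \<in> {0, 1, 2}" "j \<in> {0, 1, 2}" for i j
      unfolding \<beta>_def by (rule ext_deriv_antisym[OF \<alpha> e[OF that(1)] e[OF that(2)]])
    have self: "\<beta> (e i) (e i) = 0" if "i \<in> {0, 1, 2}" for i using as[OF that that] by simp
    have sT: "(\<lambda>f. \<Sum>i\<in>{0, 1, 2}. y i * e i f) \<in> T p" by (rule T_sum_closed[OF e])
    have "\<beta> (\<lambda>f. \<Sum>i\<in>{0, 1, 2}. x i * e i f) (\<lambda>f. \<Sum>i\<in>{0, 1, 2}. y i * e i f) =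
        (\<Sum>i\<in>{0, 1, 2}. x i * \<beta> (e i) (\<lambda>f. \<Sum>i\<in>{0, 1, 2}. y i * e i f))"
      unfolding \<beta>_def by (rule linear_at_sum[OF ext_deriv_linear_left[OF \<alpha> sT]]) (rule e)
    also have "\<dots> = (\<Sum>i\<in>{0, 1, 2}. x i * (\<Sum>j\<in>{0, 1, 2}. y j * \<beta> (e i) (e j)))"
      unfolding \<beta>_def
      by (intro sum.cong refl arg_cong2[where f = "(*)"])
         (rule linear_at_sum[OF ext_deriv_linear_right[OF \<alpha> e]], assumption, rule e)
    finally have "\<beta> (\<lambda>f. \<Sum>i\<in>{0, 1, 2}. x i * e i f) (\<lambda>f. \<Sum>i\<in>{0, 1, 2}. y i * e i f) =
        (\<Sum>i\<in>{0, 1, 2}. x i * (\<Sum>j\<in>{0, 1, 2}. y j * \<beta> (e i) (e j)))" .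
    then show ?thesis
      using as[of 1 0] as[of 2 0] as[of 2 1] self[of 0] self[of 1] self[of 2] by (simp add: algebra_simps)
  qed
  obtain a' where a: "a = (\<lambda>f. \<Sum>i\<in>{0, 1, 2}. a' i * e i f)" using bspec[OF sp T(1)] by (elim exE)
  obtain b' where b: "b = (\<lambda>f. \<Sum>i\<in>{0, 1, 2}. b' i * e i f)" using bspec[OF sp T(2)] by (elim exE)
  obtain c' where c: "c = (\<lambda>f. \<Sum>i\<in>{0, 1, 2}. c' i * e i f)" using bspec[OF sp T(3)] by (elim exE)
  obtain d' where d: "d = (\<lambda>f. \<Sum>i\<in>{0, 1, 2}. d' i * e i f)" using bspec[OF sp T(4)] by (elim exE)
  show ?thesis unfolding a b c d lin by algebra
qed

end


section \<open>Contact metric manifolds\<close>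

context framed_manifold
begin

lemma linear_at_expand:
  assumes "linear_at A p l" "u \<in> T p"
  shows "l u = (\<Sum>k<n. u (F k) * l (E k p))"
proof -
  have "l u = l (\<lambda>f. \<Sum>k<n. u (F k) * E k p f)" using expand[OF assms(2)] by (rule arg_cong)
  also have "\<dots> = (\<Sum>k<n. u (F k) * l (E k p))"
    by (rule linear_at_sum[OF assms(1)]) (rule VF_T[OF E_VF])
  finally show ?thesis .
qed

subsection \<open>Existence of the Reeb field\<close>

lemma wedge_swap:
  assumes "one_form A \<alpha>" "u \<in> T p" "v \<in> T p" "w \<in> T p"
  shows "wedge_ext_deriv A \<alpha> p v u w = - wedge_ext_deriv A \<alpha> p u v w"
  unfolding wedge_ext_deriv_def
  using ext_deriv_antisym[OF assms(1) assms(2,4)] ext_deriv_antisym[OF assms(1) assms(3,4)]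
    ext_deriv_antisym[OF assms(1) assms(2,3)] by (simp add: algebra_simps)

text \<open>A 3-form is determined by its values on a spanning family.\<close>

lemma volume_frame_nonzero:
  assumes "volume_form A \<mu>"
  shows "\<exists>i<n. \<exists>j<n. \<exists>k<n. \<mu> p (E i p) (E j p) (E k p) \<noteq> 0"
proof (rule ccontr)
  assume "\<not> ?thesis"
  then have z: "\<mu> p (E i p) (E j p) (E k p) = 0" if "i < n" "j < n" "k < n" for i j k using that by blast
  have lin: "linear_at A p (\<lambda>u. \<mu> p u v w)" if "v \<in> T p" "w \<in> T p" for v w
    using assms that by (simp add: volume_form_def)
  have sw: "\<mu> p v u w = - \<mu> p u v w" "\<mu> p u w v = - \<mu> p u v w" if "u \<in> T p" "v \<in> T p" "w \<in> T p" for u v w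
    using assms that unfolding volume_form_def by blast+
  note ET = VF_T[OF E_VF]
  have 1: "\<mu> p u (E j p) (E k p) = 0" if "u \<in> T p" "j < n" "k < n" for u j k
    by (subst linear_at_expand[OF lin[OF ET ET] that(1)]) (use z that in simp)
  have 2: "\<mu> p u v (E k p) = 0" if "u \<in> T p" "v \<in> T p" "k < n" for u v k
  proof -
    have "\<mu> p v u (E k p) = 0"
      by (subst linear_at_expand[OF lin[OF that(1) ET] that(2)])
         (use 1 that sw(1)[OF that(1) ET ET] in simp)
    then show ?thesis using sw(1)[OF that(2,1) ET[of k]] by simp
  qed
  have "\<mu> p u v w = 0" if "u \<in> T p" "v \<in> T p" "w \<in> T p" for u v w
  proof -
    have "\<mu> p (E k p) u v = 0" if "k < n" for k
      using sw(1)[OF \<open>u \<in> T p\<close> ET \<open>v \<in> T p\<close>, of k] sw(2)[OF \<open>u \<in> T p\<close> \<open>v \<in> T p\<close> ET, of k]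
        2[OF \<open>u \<in> T p\<close> \<open>v \<in> T p\<close> that] by linarith
    then have "\<mu> p w u v = 0"
      by (subst linear_at_expand[OF lin[OF that(1,2)] that(3)]) simp
    then show ?thesis using sw(1)[OF that(3,1,2)] sw(2)[OF that] by simp
  qed
  then show False using assms unfolding volume_form_def by blast
qed

text \<open>For vectors \<open>a, b, c\<close> the vector \<open>d\<alpha>(b,c) a + d\<alpha>(c,a) b + d\<alpha>(a,b) c\<close> lies in the kernel of \<open>d\<alpha>\<close>, and
  \<open>\<alpha>\<close> takes the value \<open>(\<alpha> \<and> d\<alpha>)(a,b,c)\<close> on it. The Reeb field is the average of these vectors over all
  triples of the frame, weighted by the volume form so that no cancellation occurs.\<close>

lemma Reeb_exists:
  assumes vol: "volume_form A \<mu>" and con: "contact_form A \<mu> \<alpha>"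
  shows "\<exists>X. VF X \<and> (\<forall>p. \<alpha> p (X p) = 1 \<and> (\<forall>u\<in>T p. ext_deriv A \<alpha> p (X p) u = 0))"
proof -
  have \<alpha>: "one_form A \<alpha>" using con by (simp add: contact_form_def)
  let ?d = "ext_deriv A \<alpha>"
  define I where "I = {..<n} \<times> {..<n} \<times> {..<n}"
  define V where "V = (\<lambda>(i, j, k) p f. ?d p (E j p) (E k p) * E i p f
      + (?d p (E k p) (E i p) * E j p f + ?d p (E i p) (E j p) * E k p f))"
  \<comment> \<open>The factors \<open>N t\<close> and \<open>\<alpha>(V t)\<close> have the same sign, so \<open>D\<close> is a sum of nonnegative terms.\<close>
  define N where "N = (\<lambda>(i, j, k) p. \<mu> p (E i p) (E j p) (E k p))"
  note ET = VF_T[OF E_VF]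
  have VV: "VF (V t)" for t
    unfolding V_def by (cases t) (auto intro!: VF_add VF_scale ext_deriv_C[OF \<alpha>] E_VF)
  have NC: "N t \<in> C" for t
    using vol E_VF unfolding N_def volume_form_def by (cases t) simp
  have \<alpha>V: "\<alpha> p (V (i, j, k) p) = wedge_ext_deriv A \<alpha> p (E i p) (E j p) (E k p)" for i j k p
    by (simp add: V_def wedge_ext_deriv_def linear_at_add[OF one_form_linear[OF \<alpha>]]
        linear_at_scale[OF one_form_linear[OF \<alpha>]] ET T_scale T_plus)
  have dV: "?d p (V t p) u = 0" if u: "u \<in> T p" for t p u
  proof -
    obtain i j k where t: "t = (i, j, k)" by (cases t)
    have "?d p (V t p) u = ?d p (E j p) (E k p) * ?d p (E i p) u
      + (?d p (E k p) (E i p) * ?d p (E j p) u + ?d p (E i p) (E j p) * ?d p (E k p) u)"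
      by (simp add: t V_def linear_at_add[OF ext_deriv_linear_left[OF \<alpha> u]]
        linear_at_scale[OF ext_deriv_linear_left[OF \<alpha> u]] ET T_scale T_plus)
    also have "\<dots> = 0"
      using ext_deriv_Pfaffian[OF \<alpha> ET[of i p] ET[of j p] ET[of k p] u]
        ext_deriv_antisym[OF \<alpha> ET[of i p] ET[of k p]] by (simp add: algebra_simps)
    finally show ?thesis .
  qed
  define D where "D = (\<lambda>p. \<Sum>t\<in>I. N t p * \<alpha> p (V t p))"
  have DC: "D \<in> C" unfolding D_def by (intro C_sum C_mult NC one_form_C[OF \<alpha>] VV)
  have pos: "\<mu> p u v w > 0 \<Longrightarrow> wedge_ext_deriv A \<alpha> p u v w > 0"
    if "u \<in> T p" "v \<in> T p" "w \<in> T p" for p u v w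
    using con that by (simp add: contact_form_def)
  have sgn: "N (i, j, k) p * \<alpha> p (V (i, j, k) p) > 0" if "N (i, j, k) p \<noteq> 0" for i j k p
  proof (cases "N (i, j, k) p > 0")
    case True
    then show ?thesis using pos[OF ET ET ET] by (simp add: N_def \<alpha>V)
  next
    case False
    have "\<mu> p (E j p) (E i p) (E k p) = - \<mu> p (E i p) (E j p) (E k p)"
      using vol ET unfolding volume_form_def by blast
    then have "wedge_ext_deriv A \<alpha> p (E j p) (E i p) (E k p) > 0"
      using False that by (intro pos ET) (simp add: N_def)
    then have "\<alpha> p (V (i, j, k) p) < 0"
      using wedge_swap[OF \<alpha> ET[of i p] ET[of j p] ET[of k p]] by (simp add: \<alpha>V)
    then show ?thesis using False that by (simp add: mult_neg_neg)
  qed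
  have Dpos: "D p > 0" for p
  proof -
    obtain i j k where "i < n" "j < n" "k < n" "N (i, j, k) p \<noteq> 0"
      using volume_frame_nonzero[OF vol, of p] by (auto simp: N_def)
    moreover have "N t p * \<alpha> p (V t p) \<ge> 0" for t
      using sgn by (cases t) (metis less_eq_real_def mult_zero_left)
    ultimately show ?thesis
      unfolding D_def using sgn by (intro sum_pos2[of _ "(i, j, k)"]) (auto simp: I_def)
  qed
  define X where "X = (\<lambda>p f. \<Sum>t\<in>I. (N t p / D p) * V t p f)"
  have "VF X"
    unfolding X_def using Dpos by (intro VF_sum C_divide NC DC VV) (metis less_irrefl)
  moreover have "\<alpha> p (X p) = 1" for p
  proof -
    have "\<alpha> p (X p) = (\<Sum>t\<in>I. (N t p / D p) * \<alpha> p (V t p))"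
      unfolding X_def by (rule linear_at_sum[OF one_form_linear[OF \<alpha>]]) (rule VF_T[OF VV])
    also have "\<dots> = D p / D p" by (simp add: D_def sum_divide_distrib[symmetric])
    finally show ?thesis using Dpos[of p] by simp
  qed
  moreover have "?d p (X p) u = 0" if u: "u \<in> T p" for p u
  proof -
    have "?d p (X p) u = (\<Sum>t\<in>I. (N t p / D p) * ?d p (V t p) u)"
      unfolding X_def by (rule linear_at_sum[OF ext_deriv_linear_left[OF \<alpha> u]]) (rule VF_T[OF VV])
    then show ?thesis using dV[OF u] by simp
  qed
  ultimately show ?thesis by blast
qed

end

locale contact_metric = framed_manifold A n F E
  for A :: "'a::t2_space atlas3" and n :: nat and F :: "nat \<Rightarrow> 'a \<Rightarrow> real" and E :: "nat \<Rightarrow> 'a vfield" +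
  fixes \<mu> :: "'a \<Rightarrow> 'a tvec \<Rightarrow> 'a tvec \<Rightarrow> 'a tvec \<Rightarrow> real"
    and \<alpha> :: "'a \<Rightarrow> 'a tvec \<Rightarrow> real" and \<theta> :: real
    and J :: "'a \<Rightarrow> 'a tvec \<Rightarrow> 'a tvec" and g :: "'a \<Rightarrow> 'a tvec \<Rightarrow> 'a tvec \<Rightarrow> real"
  assumes vol: "volume_form A \<mu>" and con: "contact_form A \<mu> \<alpha>"
    and metric: "riemannian_metric A g" and \<theta>_pos: "\<theta> > 0" and cs: "complex_structure A \<alpha> J"
    and compat: "u \<in> tangent_space A p \<Longrightarrow> v \<in> tangent_space A p \<Longrightarrow>
        g p u v = 1 / \<theta> * ext_deriv A \<alpha> p u (extend_J A \<alpha> J p v) + \<alpha> p u * \<alpha> p v"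
begin

abbreviation K where "K \<equiv> ker_form A \<alpha>"
abbreviation d\<alpha> where "d\<alpha> \<equiv> ext_deriv A \<alpha>"
abbreviation X where "X \<equiv> reeb_field A \<alpha>"
abbreviation JJ where "JJ \<equiv> extend_J A \<alpha> J"

lemma \<alpha>_form: "one_form A \<alpha>"
  using con by (simp add: contact_form_def)

lemmas \<alpha>_linear = one_form_linear[OF \<alpha>_form]
lemmas d\<alpha>_left = ext_deriv_linear_left[OF \<alpha>_form]
lemmas d\<alpha>_right = ext_deriv_linear_right[OF \<alpha>_form]
lemmas d\<alpha>_antisym = ext_deriv_antisym[OF \<alpha>_form]

lemma K_iff: "u \<in> K p \<longleftrightarrow> u \<in> T p \<and> \<alpha> p u = 0"
  by (simp add: ker_form_def)

lemma K_T: "u \<in> K p \<Longrightarrow> u \<in> T p"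
  by (simp add: ker_form_def)

lemma K_combine: "u \<in> K p \<Longrightarrow> v \<in> K p \<Longrightarrow> (\<lambda>f. a * u f + b * v f) \<in> K p"
  by (simp add: K_iff T_combine linear_at_lincomb[OF \<alpha>_linear])

lemma K_sub: "u \<in> K p \<Longrightarrow> v \<in> K p \<Longrightarrow> (\<lambda>f. u f - v f) \<in> K p"
  using K_combine[of u p v 1 "-1"] by simp

lemma K_scale: "u \<in> K p \<Longrightarrow> (\<lambda>f. a * u f) \<in> K p"
  using K_combine[of u p u a 0] by simp

lemma J_K: "u \<in> K p \<Longrightarrow> J p u \<in> K p" and J_J: "u \<in> K p \<Longrightarrow> J p (J p u) = (\<lambda>f. - u f)"
  and J_linear: "u \<in> K p \<Longrightarrow> v \<in> K p \<Longrightarrow> J p (\<lambda>f. a * u f + b * v f) = (\<lambda>f. a * J p u f + b * J p v f)"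
  and d\<alpha>_J_pos: "u \<in> K p \<Longrightarrow> u \<noteq> zero_tvec \<Longrightarrow> d\<alpha> p u (J p u) > 0"
  and JJ_VF: "VF Y \<Longrightarrow> VF (\<lambda>p. JJ p (Y p))"
  using cs unfolding complex_structure_def lincomb_def by blast+

lemma Reeb: "VF X" "\<alpha> p (X p) = 1" "u \<in> T p \<Longrightarrow> d\<alpha> p (X p) u = 0"
proof -
  let ?P = "\<lambda>X. VF X \<and> (\<forall>p. \<alpha> p (X p) = 1 \<and> (\<forall>u\<in>T p. d\<alpha> p (X p) u = 0))"
  have "\<exists>!X. ?P X"
  proof (rule ex_ex1I)
    show "\<exists>X. ?P X" by (rule Reeb_exists[OF vol con])
    fix X Y assume X: "?P X" and Y: "?P Y"
    show "X = Y"
    proof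
      fix p
      let ?w = "\<lambda>f. X p f - Y p f"
      have T: "X p \<in> T p" "Y p \<in> T p" using X Y VF_T by auto
      have w: "?w \<in> K p"
        using X Y by (simp add: K_iff T_sub T linear_at_diff[OF \<alpha>_linear])
      have "d\<alpha> p ?w (J p ?w) = 0"
        using X Y K_T[OF J_K[OF w]] by (simp add: linear_at_diff[OF d\<alpha>_left] T)
      then have "?w = zero_tvec" using d\<alpha>_J_pos[OF w] by fastforce
      then show "X p = Y p" by (auto simp: zero_tvec_def fun_eq_iff)
    qed
  qed
  then have "?P X" unfolding reeb_field_def by (rule theI')
  then show "VF X" "\<alpha> p (X p) = 1" "u \<in> T p \<Longrightarrow> d\<alpha> p (X p) u = 0" by auto
qed

lemmas X_T = VF_T[OF Reeb(1)]

lemma proj_K: "u \<in> T p \<Longrightarrow> (\<lambda>f. u f - \<alpha> p u * X p f) \<in> K p"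
  by (simp add: K_iff T_sub T_scale X_T linear_at_diff[OF \<alpha>_linear] linear_at_scale[OF \<alpha>_linear] Reeb)

lemma JJ_eq: "JJ p u = J p (\<lambda>f. u f - \<alpha> p u * X p f)"
  by (simp add: extend_J_def lincomb_def)

lemma JJ_ker: "u \<in> K p \<Longrightarrow> JJ p u = J p u"
  by (simp add: JJ_eq K_iff)

lemma JJ_K: "u \<in> T p \<Longrightarrow> JJ p u \<in> K p"
  by (simp add: JJ_eq proj_K J_K)

lemma JJ_T: "u \<in> T p \<Longrightarrow> JJ p u \<in> T p"
  using JJ_K K_T by blast

lemma JJ_JJ: "u \<in> K p \<Longrightarrow> JJ p (JJ p u) = (\<lambda>f. - u f)"
  by (simp add: JJ_ker J_K J_J)

lemma JJ_linear:
  assumes "u \<in> T p" "v \<in> T p"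
  shows "JJ p (\<lambda>f. a * u f + b * v f) = (\<lambda>f. a * JJ p u f + b * JJ p v f)"
proof -
  have "(\<lambda>f. a * u f + b * v f - \<alpha> p (\<lambda>f. a * u f + b * v f) * X p f) =
      (\<lambda>f. a * (u f - \<alpha> p u * X p f) + b * (v f - \<alpha> p v * X p f))"
    by (simp add: linear_at_lincomb[OF \<alpha>_linear assms] algebra_simps)
  then show ?thesis
    unfolding JJ_eq by (simp only: J_linear[OF proj_K[OF assms(1)] proj_K[OF assms(2)]])
qed

lemma JJ_scale: "u \<in> T p \<Longrightarrow> JJ p (\<lambda>f. a * u f) = (\<lambda>f. a * JJ p u f)"
  using JJ_linear[of u p u a 0] by simp

lemma JJ_add: "u \<in> T p \<Longrightarrow> v \<in> T p \<Longrightarrow> JJ p (\<lambda>f. u f + v f) = (\<lambda>f. JJ p u f + JJ p v f)"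
  using JJ_linear[of u p v 1 1] by simp

lemma JJ_zero: "JJ p (\<lambda>f. 0) = (\<lambda>f. 0)"
  using JJ_scale[OF T_zero, of p 0] by simp

lemma JJ_X: "JJ p (X p) = (\<lambda>f. 0)"
  unfolding JJ_eq Reeb(2) using JJ_zero[of p] by (simp add: JJ_eq linear_at_zero[OF \<alpha>_linear])

subsection \<open>The metric on the contact planes\<close>

lemma g_left: "v \<in> T p \<Longrightarrow> linear_at A p (\<lambda>u. g p u v)"
  and g_sym: "u \<in> T p \<Longrightarrow> v \<in> T p \<Longrightarrow> g p u v = g p v u"
  and g_pos: "u \<in> T p \<Longrightarrow> u \<noteq> zero_tvec \<Longrightarrow> g p u u > 0"
  and g_C: "VF Y \<Longrightarrow> VF Z \<Longrightarrow> (\<lambda>p. g p (Y p) (Z p)) \<in> C"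
  using metric unfolding riemannian_metric_def by blast+

lemma g_right: "u \<in> T p \<Longrightarrow> linear_at A p (g p u)"
proof (rule linear_atI)
  fix v w a b assume u: "u \<in> T p" and v: "v \<in> T p" and w: "w \<in> T p"
  show "g p u (\<lambda>f. a * v f + b * w f) = a * g p u v + b * g p u w"
    using linear_at_lincomb[OF g_left[OF u] v w, of a b]
    by (simp add: g_sym[OF u] v w T_combine)
qed

lemma g_eq_0: "u \<in> T p \<Longrightarrow> g p u u = 0 \<Longrightarrow> u = (\<lambda>f. 0)"
  using g_pos[of u p] unfolding zero_tvec_def by fastforce

lemma g_nonneg: "u \<in> T p \<Longrightarrow> g p u u \<ge> 0"
  using g_pos[of u p] linear_at_zero[OF g_left[OF T_zero], of p] unfolding zero_tvec_def by fastforce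

lemma g_nondegenerate:
  assumes u: "u \<in> T p" and v: "v \<in> T p" and eq: "\<And>w. w \<in> T p \<Longrightarrow> g p u w = g p v w"
  shows "u = v"
proof -
  have "g p (\<lambda>f. u f - v f) (\<lambda>f. u f - v f) = 0"
    using linear_at_diff[OF g_left[OF T_sub[OF u v]] u v] eq[OF T_sub[OF u v]] by simp
  from g_eq_0[OF T_sub[OF u v] this] show ?thesis by (simp add: fun_eq_iff)
qed

lemma g_X: "u \<in> T p \<Longrightarrow> g p u (X p) = \<alpha> p u"
  by (simp add: compat X_T JJ_X Reeb linear_at_zero[OF d\<alpha>_right])

lemma g_K: "u \<in> T p \<Longrightarrow> v \<in> K p \<Longrightarrow> d\<alpha> p u (JJ p v) = \<theta> * g p u v"
  using \<theta>_pos by (simp add: compat K_iff)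

lemma d\<alpha>_g: "u \<in> T p \<Longrightarrow> v \<in> K p \<Longrightarrow> d\<alpha> p u v = - \<theta> * g p u (JJ p v)"
  using g_K[of u p "JJ p v"] by (simp add: JJ_JJ JJ_K K_T linear_at_minus[OF d\<alpha>_right])

lemma g_JJ_skew: "u \<in> K p \<Longrightarrow> v \<in> K p \<Longrightarrow> g p (JJ p u) v = - g p u (JJ p v)"
proof -
  assume u: "u \<in> K p" and v: "v \<in> K p"
  have "\<theta> * (g p (JJ p u) v + g p u (JJ p v)) = 0"
    using d\<alpha>_g[OF K_T[OF u] v] d\<alpha>_g[OF K_T[OF v] u] d\<alpha>_antisym[OF K_T[OF u] K_T[OF v]]
      g_sym[OF K_T[OF v] JJ_T[OF K_T[OF u]]] by (simp add: distrib_left)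
  then show ?thesis using \<theta>_pos by simp
qed

lemma g_JJ_JJ: "u \<in> K p \<Longrightarrow> v \<in> K p \<Longrightarrow> g p (JJ p u) (JJ p v) = g p u v"
  by (simp add: g_JJ_skew JJ_K K_T JJ_JJ linear_at_minus[OF g_right])

lemma g_JJ_self: "u \<in> K p \<Longrightarrow> g p u (JJ p u) = 0"
  using g_JJ_skew[of u p u] g_sym[of u p "JJ p u"] by (simp add: K_T JJ_T)

lemma d\<alpha>_JJ: "u \<in> K p \<Longrightarrow> v \<in> K p \<Longrightarrow> d\<alpha> p (JJ p u) (JJ p v) = d\<alpha> p u v"
  by (simp add: d\<alpha>_g[of u] g_K JJ_T K_T g_JJ_skew)

text \<open>A contact plane is a complex line: \<open>y\<close> and \<open>J y\<close> span it. Otherwise \<open>y, J y, r, J r\<close> with \<open>r\<close>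
  orthogonal to \<open>y\<close> and \<open>J y\<close> would be a frame on which \<open>d\<alpha> \<and> d\<alpha>\<close> does not vanish.\<close>

lemma plane_expansion:
  assumes y: "y \<in> K p" and z: "z \<in> K p"
  shows "(\<lambda>f. g p y y * z f) = (\<lambda>f. g p y z * y f + g p (JJ p y) z * JJ p y f)"
proof -
  let ?Jy = "JJ p y"
  define s where "s = (\<lambda>f. g p y z * y f + g p ?Jy z * ?Jy f)"
  define r where "r = (\<lambda>f. g p y y * z f - s f)"
  note Jy = JJ_K[OF K_T[OF y]]
  note yT = K_T[OF y] and zT = K_T[OF z] and JyT = K_T[OF Jy]
  have sK: "s \<in> K p" unfolding s_def by (rule K_combine[OF y Jy])
  have r: "r \<in> K p" unfolding r_def by (rule K_sub[OF K_scale[OF z] sK])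
  have sy: "g p y s = g p y z * g p y y" "g p ?Jy s = g p ?Jy z * g p y y"
    unfolding s_def using g_JJ_self[OF y] g_sym[OF yT JyT]
    by (simp_all add: linear_at_lincomb[OF g_right] yT JyT g_JJ_JJ y)
  have ry: "g p y r = 0" "g p ?Jy r = 0"
    unfolding r_def
    by (simp_all add: linear_at_diff[OF g_right] linear_at_scale[OF g_right] yT JyT zT K_T[OF sK] T_scale sy)
  have rT: "r \<in> T p" and JrT: "JJ p r \<in> T p" using r K_T JJ_T by auto
  have "d\<alpha> p y ?Jy * d\<alpha> p r (JJ p r) - d\<alpha> p y r * d\<alpha> p ?Jy (JJ p r) + d\<alpha> p y (JJ p r) * d\<alpha> p ?Jy r = 0"
    by (rule ext_deriv_Pfaffian[OF \<alpha>_form yT JyT rT JrT])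
  moreover have "d\<alpha> p y (JJ p r) = 0" "d\<alpha> p ?Jy (JJ p r) = 0"
    using g_K[OF yT r] g_K[OF JyT r] ry by simp_all
  ultimately have "g p y y * g p r r = 0" using \<theta>_pos g_K[OF yT y] g_K[OF rT r] by simp
  then have "g p y y = 0 \<or> r = (\<lambda>f. 0)" using g_eq_0[OF rT] by auto
  then have "r = (\<lambda>f. 0)"
  proof
    assume "g p y y = 0"
    then have "y = (\<lambda>f. 0)" by (rule g_eq_0[OF yT])
    then show ?thesis
      unfolding r_def s_def by (simp add: JJ_zero linear_at_zero[OF g_left[OF zT]] linear_at_zero[OF g_left[OF T_zero]])
  qed
  then show ?thesis unfolding r_def s_def by (simp add: fun_eq_iff)
qed

text \<open>The projections of the frame to the contact planes span the planes, with the same coefficients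
  (\<open>K_expand\<close>).\<close>

definition Y :: "nat \<Rightarrow> 'a vfield" where
  "Y k = (\<lambda>p f. E k p f - \<alpha> p (E k p) * X p f)"

lemma Y_VF: "VF (Y k)"
  unfolding Y_def by (intro VF_sub VF_scale E_VF Reeb(1) one_form_C[OF \<alpha>_form])

lemma Y_K: "Y k p \<in> K p"
  unfolding Y_def by (rule proj_K[OF VF_T[OF E_VF]])

lemma K_expand:
  assumes "w \<in> K p"
  shows "w = (\<lambda>f. \<Sum>k<n. w (F k) * Y k p f)"
proof
  fix f
  have a: "(\<Sum>k<n. w (F k) * \<alpha> p (E k p)) = 0"
    using linear_at_expand[OF \<alpha>_linear K_T[OF assms]] assms by (simp add: K_iff)
  have "(\<Sum>k<n. w (F k) * Y k p f) = (\<Sum>k<n. w (F k) * E k p f) - (\<Sum>k<n. w (F k) * \<alpha> p (E k p)) * X p f"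
    by (simp add: Y_def right_diff_distrib sum_subtractf sum_distrib_right mult.assoc)
  then show "w f = (\<Sum>k<n. w (F k) * Y k p f)"
    unfolding a using fun_cong[OF expand[OF K_T[OF assms]], of f] by simp
qed

lemma K_nontrivial: "\<exists>u\<in>K p. u \<noteq> zero_tvec"
proof (rule ccontr)
  assume "\<not> ?thesis"
  then have "(\<lambda>f. u f - \<alpha> p u * X p f) = zero_tvec" if "u \<in> T p" for u using proj_K[OF that] by blast
  then have u: "u = (\<lambda>f. \<alpha> p u * X p f)" if "u \<in> T p" for u
    using that by (auto simp: zero_tvec_def fun_eq_iff)
  have d: "d\<alpha> p u v = 0" if "u \<in> T p" "v \<in> T p" for u v
  proof -
    have "d\<alpha> p (\<lambda>f. \<alpha> p u * X p f) v = 0"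
      using that by (simp add: linear_at_scale[OF d\<alpha>_left] X_T Reeb)
    then show ?thesis using u[OF that(1)] by metis
  qed
  obtain i j k where "\<mu> p (E i p) (E j p) (E k p) \<noteq> 0"
    using volume_frame_nonzero[OF vol] by blast
  moreover have "\<mu> p (E j p) (E i p) (E k p) = - \<mu> p (E i p) (E j p) (E k p)"
    using vol VF_T[OF E_VF] unfolding volume_form_def by blast
  ultimately have "\<mu> p (E i p) (E j p) (E k p) > 0 \<or> \<mu> p (E j p) (E i p) (E k p) > 0" by linarith
  moreover have "\<not> \<mu> p u v w > 0" if "u \<in> T p" "v \<in> T p" "w \<in> T p" for u v w
  proof -
    have "\<mu> p u v w > 0 \<Longrightarrow> wedge_ext_deriv A \<alpha> p u v w > 0"
      using con that by (simp add: contact_form_def)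
    then show ?thesis using that by (auto simp: wedge_ext_deriv_def d)
  qed
  ultimately show False using VF_T[OF E_VF] by blast
qed

definition G :: "'a \<Rightarrow> real" where
  "G p = (\<Sum>k<n. g p (Y k p) (Y k p))"

lemma G_C: "G \<in> C"
  unfolding G_def[abs_def] by (intro C_sum g_C Y_VF)

lemma G_pos: "G p > 0"
proof -
  obtain w where w: "w \<in> K p" "w \<noteq> zero_tvec" using K_nontrivial by blast
  have "\<exists>k<n. Y k p \<noteq> zero_tvec"
  proof (rule ccontr)
    assume "\<not> ?thesis"
    then have "w f = 0" for f using fun_cong[OF K_expand[OF w(1)], of f] by (auto simp: zero_tvec_def)
    then show False using w(2) by (auto simp: zero_tvec_def)
  qed
  then obtain k where k: "k < n" "Y k p \<noteq> zero_tvec" by blast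
  then show ?thesis
    unfolding G_def using g_pos[OF VF_T[OF Y_VF]] g_nonneg[OF VF_T[OF Y_VF]] by (intro sum_pos2[of _ k]) auto
qed

text \<open>For \<open>y\<close> and \<open>z\<close> in a contact plane, \<open>g(y,z) y + g(J y,z) J y = g(y,y) z\<close>. Summing over the fields \<open>Y k\<close> gives
  a Parseval identity with the positive factor \<open>G\<close>, and with it a smooth formula for the vector dual to
  a one-form.\<close>

lemma sharp:
  assumes \<omega>: "one_form A \<omega>"
  shows "\<exists>W. VF W \<and> (\<forall>p. \<forall>u\<in>T p. g p (W p) u = \<omega> p u)"
proof -
  let ?JY = "\<lambda>k p. JJ p (Y k p)"
  note \<omega>l = one_form_linear[OF \<omega>]
  define W where "W = (\<lambda>p f. \<omega> p (X p) * X p f + (1 / G p) *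
      (\<Sum>k<n. 1 * (\<lambda>p f. \<omega> p (Y k p) * Y k p f + \<omega> p (?JY k p) * ?JY k p f) p f))"
  have JYV: "VF (?JY k)" for k by (rule JJ_VF[OF Y_VF])
  have SV: "VF (\<lambda>p f. \<omega> p (Y k p) * Y k p f + \<omega> p (?JY k p) * ?JY k p f)" for k
    by (intro VF_combine one_form_C[OF \<omega>] Y_VF JYV)
  have "VF W"
    unfolding W_def
    using G_pos by (intro VF_combine VF_sum SV C_const one_form_C[OF \<omega>] Reeb(1) C_divide G_C) (metis less_irrefl)
  moreover have "g p (W p) u = \<omega> p u" if u: "u \<in> T p" for p u
  proof -
    have YT: "Y k p \<in> T p" "?JY k p \<in> T p" "?JY k p \<in> K p" for k
      using Y_K K_T JJ_K JJ_T by auto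
    have S: "(\<lambda>f. \<Sum>k<n. 1 * (\<lambda>p f. \<omega> p (Y k p) * Y k p f + \<omega> p (?JY k p) * ?JY k p f) p f) \<in> T p"
      by (rule T_sum_closed) (rule VF_T[OF SV])
    have W: "g p (W p) v = \<omega> p (X p) * g p (X p) v + (1 / G p) *
        (\<Sum>k<n. \<omega> p (Y k p) * g p (Y k p) v + \<omega> p (?JY k p) * g p (?JY k p) v)" if v: "v \<in> T p" for v
    proof -
      have "g p (\<lambda>f. \<Sum>k<n. 1 * (\<lambda>p f. \<omega> p (Y k p) * Y k p f + \<omega> p (?JY k p) * ?JY k p f) p f) v =
          (\<Sum>k<n. 1 * g p ((\<lambda>p f. \<omega> p (Y k p) * Y k p f + \<omega> p (?JY k p) * ?JY k p f) p) v)"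
        by (rule linear_at_sum[OF g_left[OF v]]) (rule VF_T[OF SV])
      also have "\<dots> = (\<Sum>k<n. \<omega> p (Y k p) * g p (Y k p) v + \<omega> p (?JY k p) * g p (?JY k p) v)"
        by (simp add: linear_at_lincomb[OF g_left[OF v]] YT)
      finally show ?thesis
        unfolding W_def by (subst linear_at_lincomb[OF g_left[OF v] X_T S]) simp
    qed
    have WX: "g p (W p) (X p) = \<omega> p (X p)"
      unfolding W[OF X_T] using Y_K YT(3) by (simp add: g_X X_T YT Reeb K_iff)
    have WK: "g p (W p) z = \<omega> p z" if z: "z \<in> K p" for z
    proof -
      have "\<omega> p (Y k p) * g p (Y k p) z + \<omega> p (?JY k p) * g p (?JY k p) z = g p (Y k p) (Y k p) * \<omega> p z" for k
        using arg_cong[OF plane_expansion[OF Y_K z], of "\<omega> p" k]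
        by (simp add: linear_at_lincomb[OF \<omega>l] linear_at_scale[OF \<omega>l] YT K_T[OF z])
      then have "(\<Sum>k<n. \<omega> p (Y k p) * g p (Y k p) z + \<omega> p (?JY k p) * g p (?JY k p) z) = G p * \<omega> p z"
        by (simp add: G_def sum_distrib_right)
      moreover have "g p (X p) z = 0"
        using g_X[OF K_T[OF z]] g_sym[OF X_T K_T[OF z]] z by (simp add: K_iff)
      ultimately show ?thesis
        unfolding W[OF K_T[OF z]] using G_pos[of p] by simp
    qed
    have uu: "u = (\<lambda>f. 1 * (\<lambda>f. u f - \<alpha> p u * X p f) f + \<alpha> p u * X p f)" by simp
    have zT: "(\<lambda>f. u f - \<alpha> p u * X p f) \<in> T p" by (rule K_T[OF proj_K[OF u]])
    have "g p (W p) (\<lambda>f. 1 * (\<lambda>f. u f - \<alpha> p u * X p f) f + \<alpha> p u * X p f) =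
        \<omega> p (\<lambda>f. 1 * (\<lambda>f. u f - \<alpha> p u * X p f) f + \<alpha> p u * X p f)"
      unfolding linear_at_lincomb[OF g_right[OF VF_T[OF \<open>VF W\<close>]] zT X_T] linear_at_lincomb[OF \<omega>l zT X_T]
        WX WK[OF proj_K[OF u]] ..
    then show ?thesis by simp
  qed
  ultimately show ?thesis by blast
qed

end


context contact_metric
begin

section \<open>The Levi-Civita connection\<close>

definition gf :: "'a vfield \<Rightarrow> 'a vfield \<Rightarrow> 'a \<Rightarrow> real" where
  "gf V Z p = g p (V p) (Z p)"

lemma gf_C: "VF V \<Longrightarrow> VF Z \<Longrightarrow> gf V Z \<in> C"
  using g_C unfolding gf_def[abs_def] .

lemma gf_sym: "VF V \<Longrightarrow> VF Z \<Longrightarrow> gf V Z = gf Z V"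
  by (auto simp: gf_def g_sym VF_T)

lemma gf_add_left: "VF V \<Longrightarrow> VF V' \<Longrightarrow> VF Z \<Longrightarrow> gf (\<lambda>p f. V p f + V' p f) Z = (\<lambda>p. gf V Z p + gf V' Z p)"
  and gf_scale_left: "VF V \<Longrightarrow> VF Z \<Longrightarrow> gf (\<lambda>p f. c p * V p f) Z = (\<lambda>p. c p * gf V Z p)"
  and gf_diff_left: "VF V \<Longrightarrow> VF V' \<Longrightarrow> VF Z \<Longrightarrow> gf (\<lambda>p f. V p f - V' p f) Z = (\<lambda>p. gf V Z p - gf V' Z p)"
  and gf_minus_left: "VF V \<Longrightarrow> VF Z \<Longrightarrow> gf (\<lambda>p f. - V p f) Z = (\<lambda>p. - gf V Z p)"
  by (auto simp: gf_def linear_at_add[OF g_left] linear_at_scale[OF g_left] linear_at_diff[OF g_left]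
      linear_at_minus[OF g_left] VF_T)

lemma gf_add_right: "VF V \<Longrightarrow> VF V' \<Longrightarrow> VF Z \<Longrightarrow> gf Z (\<lambda>p f. V p f + V' p f) = (\<lambda>p. gf Z V p + gf Z V' p)"
  and gf_scale_right: "VF V \<Longrightarrow> VF Z \<Longrightarrow> gf Z (\<lambda>p f. c p * V p f) = (\<lambda>p. c p * gf Z V p)"
  and gf_diff_right: "VF V \<Longrightarrow> VF V' \<Longrightarrow> VF Z \<Longrightarrow> gf Z (\<lambda>p f. V p f - V' p f) = (\<lambda>p. gf Z V p - gf Z V' p)"
  and gf_minus_right: "VF V \<Longrightarrow> VF Z \<Longrightarrow> gf Z (\<lambda>p f. - V p f) = (\<lambda>p. - gf Z V p)"
  by (auto simp: gf_def linear_at_add[OF g_right] linear_at_scale[OF g_right] linear_at_diff[OF g_right]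
      linear_at_minus[OF g_right] VF_T)

lemmas gf_linear = gf_add_left gf_scale_left gf_diff_left gf_minus_left
  gf_add_right gf_scale_right gf_diff_right gf_minus_right

lemma VF_eqI:
  assumes "VF V" "VF W" "\<And>Z p. VF Z \<Longrightarrow> gf V Z p = gf W Z p"
  shows "V = W"
proof
  fix p show "V p = W p"
  proof (rule g_nondegenerate[OF VF_T[OF assms(1)] VF_T[OF assms(2)]])
    fix w assume w: "w \<in> T p"
    show "g p (V p) w = g p (W p) w"
      using assms(3)[OF extension(1)[OF w], of p] extension(2)[OF w] by (simp add: gf_def)
  qed
qed

text \<open>Koszul's expression for \<open>g(\<nabla>\<^sub>U V, W)\<close>.\<close>

definition koszul :: "'a vfield \<Rightarrow> 'a vfield \<Rightarrow> 'a vfield \<Rightarrow> 'a \<Rightarrow> real" where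
  "koszul U V W p = (U p (gf V W) + V p (gf U W) - W p (gf U V)
     + gf (br U V) W p - gf (br U W) V p - gf (br V W) U p) / 2"

lemma VF_T_add: "VF U \<Longrightarrow> f \<in> C \<Longrightarrow> h \<in> C \<Longrightarrow> U p (\<lambda>x. f x + h x) = U p f + U p h"
  and VF_T_mult: "VF U \<Longrightarrow> f \<in> C \<Longrightarrow> h \<in> C \<Longrightarrow> U p (\<lambda>x. f x * h x) = f p * U p h + h p * U p f"
  using T_add[OF VF_T] T_mult[OF VF_T] by blast+

lemma VF_T_const: "VF U \<Longrightarrow> U p (\<lambda>x. c) = 0"
  using T_const[OF VF_T] .

lemmas koszul_simps = gf_linear br_add_left br_add_right br_scale_left br_scale_right VF_T_add VF_T_mult
  gf_C br_VF VF_add VF_scale VF_C C_mult C_add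

lemma koszul_add3:
  "VF U \<Longrightarrow> VF V \<Longrightarrow> VF W \<Longrightarrow> VF W' \<Longrightarrow> koszul U V (\<lambda>p f. W p f + W' p f) p = koszul U V W p + koszul U V W' p"
  unfolding koszul_def by (simp add: koszul_simps add_divide_distrib diff_divide_distrib)

lemma koszul_scale3:
  "VF U \<Longrightarrow> VF V \<Longrightarrow> VF W \<Longrightarrow> c \<in> C \<Longrightarrow> koszul U V (\<lambda>p f. c p * W p f) p = c p * koszul U V W p"
  unfolding koszul_def
  by (simp add: koszul_simps gf_sym[of V U] gf_sym[of W V] gf_sym[of W U]) (simp add: field_simps)

lemma koszul_C:
  assumes "VF U" "VF V" "VF W" shows "koszul U V W \<in> C"
proof -
  have "(\<lambda>p. (1 / 2) * (U p (gf V W) + V p (gf U W) - W p (gf U V)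
     + gf (br U V) W p - gf (br U W) V p - gf (br V W) U p)) \<in> C"
    by (intro C_mult C_const C_diff C_add VF_C[OF assms(1)] VF_C[OF assms(2)] VF_C[OF assms(3)]
        gf_C br_VF assms)
  then show ?thesis by (simp add: koszul_def[abs_def])
qed

text \<open>The connection is defined through \<open>sharp\<close>; each of its properties is an identity between Koszul
  expressions, because a vector field is determined by its inner products.\<close>

definition nabla :: "'a vfield \<Rightarrow> 'a vfield \<Rightarrow> 'a vfield" where
  "nabla U V = (SOME W. VF W \<and> (\<forall>Z p. VF Z \<longrightarrow> gf W Z p = koszul U V Z p))"

lemma nabla:
  assumes U: "VF U" and V: "VF V"
  shows "VF (nabla U V)" "VF Z \<Longrightarrow> gf (nabla U V) Z p = koszul U V Z p"
proof -
  have form: "one_form A (\<lambda>p u. koszul U V (extend_tvec A p u) p)"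
    by (rule one_form_of_fields(1)[where \<Phi> = "koszul U V"])
       (blast intro: koszul_add3[OF U V] koszul_scale3[OF U V] koszul_C[OF U V])+
  have form_at: "koszul U V (extend_tvec A p (Z p)) p = koszul U V Z p" if "VF Z" for Z p
    by (rule one_form_of_fields(2)[where \<Phi> = "koszul U V"])
       (blast intro: koszul_add3[OF U V] koszul_scale3[OF U V] koszul_C[OF U V] that)+
  obtain W where W: "VF W" "\<forall>p. \<forall>u\<in>T p. g p (W p) u = koszul U V (extend_tvec A p u) p"
    using sharp[OF form] by blast
  have "gf W Z p = koszul U V Z p" if Z: "VF Z" for Z p
  proof -
    have "gf W Z p = koszul U V (extend_tvec A p (Z p)) p"
      unfolding gf_def using W(2) VF_T[OF Z] by blast
    also have "\<dots> = koszul U V Z p" by (rule form_at[OF Z])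
    finally show ?thesis .
  qed
  with W(1) have "\<exists>W. VF W \<and> (\<forall>Z p. VF Z \<longrightarrow> gf W Z p = koszul U V Z p)" by blast
  from someI_ex[OF this] show "VF (nabla U V)" "VF Z \<Longrightarrow> gf (nabla U V) Z p = koszul U V Z p"
    unfolding nabla_def by auto
qed

lemma nabla_Levi_Civita: "is_levi_civita A g nabla"
  unfolding is_levi_civita_def lincomb_def
proof (intro conjI allI impI ballI)
  fix U V assume U: "VF U" and V: "VF V"
  show "VF (nabla U V)" by (rule nabla(1)[OF U V])
  show "(\<lambda>p f. 1 * nabla U V p f + - 1 * nabla V U p f) = br U V"
  proof (rule VF_eqI)
    show "VF (\<lambda>p f. 1 * nabla U V p f + - 1 * nabla V U p f)"
      using VF_sub[OF nabla(1)[OF U V] nabla(1)[OF V U]] by simp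
    fix Z p assume Z: "VF Z"
    show "gf (\<lambda>p f. 1 * nabla U V p f + - 1 * nabla V U p f) Z p = gf (br U V) Z p"
      using br_antisym[of V U] by (simp add: gf_linear nabla U V Z br_VF koszul_def gf_sym[OF V U]) (simp add: field_simps)
  qed (rule br_VF[OF U V])
  {
    fix c assume c: "c \<in> C"
    show "nabla (\<lambda>p h. c p * U p h) V = (\<lambda>p h. c p * nabla U V p h)"
      by (rule VF_eqI; (intro nabla(1) VF_scale U V c)?)
         (simp add: nabla U V c VF_scale gf_linear, simp add: koszul_def koszul_simps U V c
           gf_sym[OF V U], simp add: field_simps)
    show "nabla U (\<lambda>p h. c p * V p h) = (\<lambda>p f. U p c * V p f + c p * nabla U V p f)"
    proof (rule VF_eqI)
      show "VF (nabla U (\<lambda>p h. c p * V p h))" "VF (\<lambda>p f. U p c * V p f + c p * nabla U V p f)"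
        by (intro nabla(1) VF_scale VF_combine VF_C[OF U c] U V c)+
      fix Z p assume Z: "VF Z"
      note x = VF_C[OF U c] VF_C[OF Z c]
      show "gf (nabla U (\<lambda>p h. c p * V p h)) Z p = gf (\<lambda>p f. U p c * V p f + c p * nabla U V p f) Z p"
        by (simp add: nabla U V c x Z VF_scale gf_linear)
           (simp add: koszul_def gf_linear br_scale_left br_scale_right VF_T_mult gf_C br_VF VF_scale
              C_mult U V c x Z gf_sym[OF V U], simp add: field_simps)
    qed
  }
  {
    fix W assume W: "VF W"
    show "nabla (\<lambda>p f. 1 * U p f + 1 * V p f) W = (\<lambda>p f. 1 * nabla U W p f + 1 * nabla V W p f)"
      unfolding mult_1
      by (rule VF_eqI; (intro nabla(1) VF_add U V W)?)
         (simp add: nabla U V W VF_add gf_linear, simp add: koszul_def koszul_simps U V W, simp add: field_simps)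
    show "nabla U (\<lambda>p f. 1 * V p f + 1 * W p f) = (\<lambda>p f. 1 * nabla U V p f + 1 * nabla U W p f)"
      unfolding mult_1
      by (rule VF_eqI; (intro nabla(1) VF_add U V W)?)
         (simp add: nabla U V W VF_add gf_linear, simp add: koszul_def koszul_simps U V W, simp add: field_simps)
    fix p
    have "U p (gf V W) = gf (nabla U V) W p + gf V (nabla U W) p"
      using br_antisym[of W U] br_antisym[of W V]
      by (simp add: nabla U V W gf_sym[OF V nabla(1)[OF U W]] koszul_def gf_sym[OF W V] gf_linear br_VF
          br_antisym[of W V]) (simp add: field_simps)
    then show "U p (\<lambda>q. g q (V q) (W q)) = g p (nabla U V p) (W p) + g p (V p) (nabla U W p)"
      by (simp add: gf_def[abs_def])
  }
qed

abbreviation D where "D \<equiv> levi_civita A g"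

lemma D_Levi_Civita: "is_levi_civita A g D"
  unfolding levi_civita_def by (rule someI[where P = "is_levi_civita A g", OF nabla_Levi_Civita])

lemma D_VF: "VF U \<Longrightarrow> VF V \<Longrightarrow> VF (D U V)"
  and D_add_left: "VF U \<Longrightarrow> VF V \<Longrightarrow> VF W \<Longrightarrow> D (\<lambda>p f. U p f + V p f) W = (\<lambda>p f. D U W p f + D V W p f)"
  and D_add_right: "VF U \<Longrightarrow> VF V \<Longrightarrow> VF W \<Longrightarrow> D U (\<lambda>p f. V p f + W p f) = (\<lambda>p f. D U V p f + D U W p f)"
  and D_scale_left: "c \<in> C \<Longrightarrow> VF U \<Longrightarrow> VF V \<Longrightarrow> D (\<lambda>p h. c p * U p h) V = (\<lambda>p h. c p * D U V p h)"
  and D_scale_right: "c \<in> C \<Longrightarrow> VF U \<Longrightarrow> VF V \<Longrightarrow>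
      D U (\<lambda>p h. c p * V p h) = (\<lambda>p f. U p c * V p f + c p * D U V p f)"
  and D_torsion: "VF U \<Longrightarrow> VF V \<Longrightarrow> br U V = (\<lambda>p f. D U V p f - D V U p f)"
  and D_metric: "VF U \<Longrightarrow> VF V \<Longrightarrow> VF W \<Longrightarrow> U p (gf V W) = gf (D U V) W p + gf V (D U W) p"
  using D_Levi_Civita unfolding is_levi_civita_def lincomb_def gf_def[abs_def]
  by simp_all

lemma D_minus_left: "VF U \<Longrightarrow> VF V \<Longrightarrow> D (\<lambda>p h. - U p h) V = (\<lambda>p h. - D U V p h)"
  using D_scale_left[OF C_const[of "-1"]] by simp

lemma D_zero_right: "VF U \<Longrightarrow> D U (\<lambda>p f. 0) = (\<lambda>p f. 0)"
  using D_scale_right[OF C_const[of 0], of U "\<lambda>p f. 0"] by (simp add: VF_zero T_const[OF VF_T])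

text \<open>The connection chosen by \<open>levi_civita\<close> is known by its axioms only; they force Koszul's formula.\<close>

lemma D_koszul:
  assumes U: "VF U" and V: "VF V" and W: "VF W"
  shows "gf (D U V) W p = koszul U V W p"
proof -
  note s = gf_linear D_VF
  have 1: "gf (br U V) W p = gf (D U V) W p - gf (D V U) W p"
    "gf (br U W) V p = gf (D U W) V p - gf (D W U) V p"
    "gf (br V W) U p = gf (D V W) U p - gf (D W V) U p"
    by (simp_all add: D_torsion s U V W)
  have 2: "U p (gf V W) = gf (D U V) W p + gf (D U W) V p"
    "V p (gf U W) = gf (D V U) W p + gf (D V W) U p"
    "W p (gf U V) = gf (D W U) V p + gf (D W V) U p"
    using D_metric[OF U V W] D_metric[OF V U W] D_metric[OF W U V]
      gf_sym[OF V D_VF[OF U W]] gf_sym[OF U D_VF[OF V W]] gf_sym[OF U D_VF[OF W V]] by simp_all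
  show ?thesis unfolding koszul_def 1 2 by simp
qed

section \<open>Tensoriality of the curvature\<close>

abbreviation R where "R \<equiv> riemann_curvature A g"

lemma R_def': "R U V W = (\<lambda>p f. D U (D V W) p f - D V (D U W) p f - D (br U V) W p f)"
  by (simp add: riemann_curvature_def Let_def)

lemmas D_simps = D_VF D_add_left D_add_right D_scale_left D_scale_right br_add_left br_add_right
  br_scale_left br_scale_right VF_add VF_scale VF_C br_VF

lemma R_add1: "VF U \<Longrightarrow> VF U' \<Longrightarrow> VF V \<Longrightarrow> VF W \<Longrightarrow> R (\<lambda>p f. U p f + U' p f) V W p f = R U V W p f + R U' V W p f"
  unfolding R_def' by (simp add: D_simps)

lemma R_antisym: "VF U \<Longrightarrow> VF V \<Longrightarrow> VF W \<Longrightarrow> R U V W p f = - R V U W p f"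
  unfolding R_def' br_antisym[of U V] by (simp add: D_minus_left br_VF)

lemma D_diff_left: "VF U \<Longrightarrow> VF V \<Longrightarrow> VF W \<Longrightarrow> D (\<lambda>p f. U p f - V p f) W = (\<lambda>p f. D U W p f - D V W p f)"
  using D_add_left[of U "\<lambda>p f. - V p f" W] by (simp add: VF_minus D_minus_left)

lemma R_scale1: "VF U \<Longrightarrow> VF V \<Longrightarrow> VF W \<Longrightarrow> c \<in> C \<Longrightarrow> R (\<lambda>p f. c p * U p f) V W p f = c p * R U V W p f"
  unfolding R_def' by (simp add: D_simps D_diff_left) (simp add: algebra_simps)

lemma R_add3: "VF U \<Longrightarrow> VF V \<Longrightarrow> VF W \<Longrightarrow> VF W' \<Longrightarrow> R U V (\<lambda>p f. W p f + W' p f) p f = R U V W p f + R U V W' p f"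
  unfolding R_def' by (simp add: D_simps)

lemma R_scale3:
  assumes "VF U" "VF V" "VF W" "c \<in> C"
  shows "R U V (\<lambda>p f. c p * W p f) p f = c p * R U V W p f"
  unfolding R_def' using assms
  by (simp add: D_simps VF_combine br_at) (simp add: algebra_simps)

text \<open>Sectional curvature is evaluated on chosen extensions of two vectors. Tensoriality allows computing it with the
  Reeb field and a field tangent to the contact planes instead.\<close>

lemma R_tensorial:
  assumes U: "VF U" "VF U'" "U p = U' p" and V: "VF V" "VF V'" "V p = V' p" and W: "VF W" "VF W'" "W p = W' p"
  shows "R U V W p = R U' V' W' p"
proof
  fix f
  have 1: "R U V W p f = R U' V W p f" if "VF U" "VF U'" "U p = U' p" "VF V" "VF W" for U U' V W
    by (rule tensorial[where \<Phi> = "\<lambda>U. R U V W p f", OF R_add1 R_scale1 that(1-3)]) (use that in auto)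
  have 3: "R U V W p f = R U V W' p f" if "VF W" "VF W'" "W p = W' p" "VF U" "VF V" for U V W W'
    by (rule tensorial[where \<Phi> = "\<lambda>W. R U V W p f", OF R_add3 R_scale3 that(1-3)]) (use that in auto)
  have "R U V W p f = R U' V W p f" by (rule 1[OF U V(1) W(1)])
  also have "\<dots> = - R V U' W p f" by (rule R_antisym[OF U(2) V(1) W(1)])
  also have "\<dots> = - R V' U' W p f" using 1[OF V U(2) W(1)] by simp
  also have "\<dots> = R U' V' W p f" using R_antisym[OF U(2) V(2) W(1)] by simp
  also have "\<dots> = R U' V' W' p f" by (rule 3[OF W U(2) V(2)])
  finally show "R U V W p f = R U' V' W' p f" .
qed

section \<open>The Ricci curvature of the Reeb direction\<close>

text \<open>The Lie derivative \<open>L\<^sub>X J\<close>. The two terms in which a factor \<open>c\<close> of the argument is differentiated cancel, so it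
  is a tensor.\<close>

definition LJ :: "'a vfield \<Rightarrow> 'a vfield" where
  "LJ U = (\<lambda>p f. br X (\<lambda>q. JJ q (U q)) p f - JJ p (br X U p) f)"

definition K_field :: "'a vfield \<Rightarrow> bool" where
  "K_field U \<longleftrightarrow> VF U \<and> (\<forall>p. U p \<in> K p)"

lemma K_field_VF: "K_field U \<Longrightarrow> VF U" and K_field_K: "K_field U \<Longrightarrow> U p \<in> K p"
  by (simp_all add: K_field_def)

lemma K_field_Y: "K_field (Y k)"
  by (simp add: K_field_def Y_VF Y_K)

lemma K_field_JJ: "VF U \<Longrightarrow> K_field (\<lambda>p. JJ p (U p))"
  by (simp add: K_field_def JJ_VF JJ_K VF_T)

lemma LJ_VF: "VF U \<Longrightarrow> VF (LJ U)"
  unfolding LJ_def by (intro VF_sub br_VF JJ_VF Reeb(1))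

lemma LJ_add: "VF U \<Longrightarrow> VF V \<Longrightarrow> LJ (\<lambda>p f. U p f + V p f) p f = LJ U p f + LJ V p f"
  unfolding LJ_def by (simp add: JJ_add VF_T br_VF Reeb(1) br_add_right JJ_VF)

lemma LJ_scale: "VF U \<Longrightarrow> c \<in> C \<Longrightarrow> LJ (\<lambda>p f. c p * U p f) p f = c p * LJ U p f"
  unfolding LJ_def
  by (simp add: JJ_scale JJ_linear VF_T br_VF Reeb(1) br_scale_right JJ_VF) (simp add: algebra_simps)

text \<open>This is \<open>d\<alpha>(X, U) = 0\<close>.\<close>

lemma Reeb_deriv: "VF U \<Longrightarrow> X p (\<lambda>q. \<alpha> q (U q)) = \<alpha> p (br X U p)"
  using ext_deriv_at[OF \<alpha>_form Reeb(1), of U p] Reeb(3)[OF VF_T, of U p] T_const[OF VF_T, of U p 1]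
  by (simp add: ext_deriv_fields_def Reeb(2))

lemma br_X_K: "K_field U \<Longrightarrow> K_field (br X U)"
  using Reeb_deriv[of U] T_const[OF X_T, where c = 0]
  by (auto simp: K_field_def K_iff br_VF Reeb(1) VF_T)

lemma LJ_K: "K_field U \<Longrightarrow> K_field (LJ U)"
  using br_X_K[OF K_field_JJ] br_X_K[of U] LJ_VF[of U]
  by (auto simp: K_field_def LJ_def[abs_def] intro!: K_sub JJ_K K_T)

lemma JJ_JJ_field: "K_field U \<Longrightarrow> (\<lambda>p. JJ p (JJ p (U p))) = (\<lambda>p f. - U p f)"
  by (simp add: JJ_JJ K_field_K)

text \<open>The derivative of \<open>J\<^sup>2 = -1\<close>.\<close>

lemma LJ_JJ:
  assumes "K_field U"
  shows "LJ (\<lambda>p. JJ p (U p)) p f = - JJ p (LJ U p) f"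
proof -
  note V = K_field_VF[OF assms]
  have 1: "br X (\<lambda>p f. - U p f) = (\<lambda>p f. - br X U p f)"
    using br_scale_right[OF Reeb(1) V C_const[of "-1"]] by (simp add: T_const[OF X_T])
  have "JJ p (LJ U p) = (\<lambda>f. JJ p (br X (\<lambda>q. JJ q (U q)) p) f - JJ p (JJ p (br X U p)) f)"
    using JJ_linear[OF VF_T[OF br_VF[OF Reeb(1) JJ_VF[OF V]]] JJ_T[OF VF_T[OF br_VF[OF Reeb(1) V]]], of p 1 "-1"]
    by (simp add: LJ_def)
  then show ?thesis
    by (simp add: LJ_def[of "\<lambda>p. JJ p (U p)"] JJ_JJ_field[OF assms] 1 JJ_JJ[OF K_field_K[OF br_X_K[OF assms]]])
qed

text \<open>\<open>\<sigma>\<close> is half the derivative of the metric along the Reeb flow.\<close>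

definition \<sigma> :: "'a vfield \<Rightarrow> 'a vfield \<Rightarrow> 'a \<Rightarrow> real" where
  "\<sigma> U V p = (X p (gf U V) - gf (br X U) V p - gf U (br X V) p) / 2"

lemma \<sigma>_sym: "VF U \<Longrightarrow> VF V \<Longrightarrow> \<sigma> U V p = \<sigma> V U p"
  by (simp add: \<sigma>_def gf_sym br_VF Reeb(1))

lemma gf_K: "VF U \<Longrightarrow> K_field V \<Longrightarrow> \<theta> * gf U V p = ext_deriv_fields A \<alpha> U (\<lambda>p. JJ p (V p)) p"
  using g_K[OF VF_T K_field_K, of U V p]
    ext_deriv_at[OF \<alpha>_form _ JJ_VF[OF K_field_VF], of U V p]
  by (simp add: gf_def)

lemma d\<alpha>_K_fields: "K_field U \<Longrightarrow> K_field V \<Longrightarrow> ext_deriv_fields A \<alpha> U V p = - \<alpha> p (br U V p)"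
  by (simp add: ext_deriv_fields_def K_field_def K_iff VF_T_const)

text \<open>The identity \<open>L\<^sub>X d\<alpha> = 0\<close>. On fields tangent to the contact planes \<open>d\<alpha>(U, V) = - \<alpha>([U, V])\<close>, and \<open>X\<close> differentiates
  \<open>\<alpha>(W)\<close> to \<open>\<alpha>([X, W])\<close>, so it is the Jacobi identity.\<close>

lemma Lie_deriv_d\<alpha>:
  assumes U: "K_field U" and V: "K_field V"
  shows "X p (ext_deriv_fields A \<alpha> U V) =
    ext_deriv_fields A \<alpha> (br X U) V p + ext_deriv_fields A \<alpha> U (br X V) p"
proof -
  note u = K_field_VF[OF U] and v = K_field_VF[OF V]
  have "X p (\<lambda>q. - \<alpha> q (br U V q)) = - \<alpha> p (br X (br U V) p)"
    by (simp add: T_minus[OF X_T] one_form_C[OF \<alpha>_form] br_VF u v Reeb_deriv)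
  also have "\<alpha> p (br X (br U V) p) = \<alpha> p (br (br X U) V p) + \<alpha> p (br U (br X V) p)"
    unfolding br_Jacobi[OF Reeb(1) u v] by (simp add: linear_at_add[OF \<alpha>_linear] VF_T br_VF u v Reeb(1))
  finally show ?thesis
    using d\<alpha>_K_fields[OF U V, abs_def] by (simp add: d\<alpha>_K_fields U V br_X_K)
qed

text \<open>Since \<open>\<theta> g(U, V) = d\<alpha>(U, J V)\<close> and the Reeb flow preserves \<open>d\<alpha>\<close>, only the derivative of \<open>J\<close> contributes.\<close>

lemma \<sigma>_LJ:
  assumes U: "K_field U" and V: "K_field V"
  shows "2 * \<theta> * \<sigma> U V p = d\<alpha> p (U p) (LJ V p)"
proof -
  note u = K_field_VF[OF U] and v = K_field_VF[OF V]
  let ?JV = "\<lambda>p. JJ p (V p)" and ?d = "ext_deriv_fields A \<alpha>"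
  have JV: "K_field ?JV" by (rule K_field_JJ[OF v])
  have bU: "K_field (br X U)" and bV: "K_field (br X V)" by (intro br_X_K U V)+
  have "\<theta> * X p (gf U V) = X p (\<lambda>p. \<theta> * gf U V p)"
    using T_cmult[OF X_T gf_C[OF u v]] by simp
  also have "\<dots> = ?d (br X U) ?JV p + ?d U (br X ?JV) p"
    unfolding gf_K[OF u V] by (rule Lie_deriv_d\<alpha>[OF U JV])
  finally have 1: "\<theta> * X p (gf U V) = ?d (br X U) ?JV p + ?d U (br X ?JV) p" .
  have 2: "\<theta> * gf (br X U) V p = ?d (br X U) ?JV p" by (rule gf_K[OF K_field_VF[OF bU] V])
  have 3: "\<theta> * gf U (br X V) p = ?d U (\<lambda>p. JJ p (br X V p)) p" by (rule gf_K[OF u bV])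
  have "2 * \<theta> * \<sigma> U V p = \<theta> * X p (gf U V) - \<theta> * gf (br X U) V p - \<theta> * gf U (br X V) p"
    by (simp add: \<sigma>_def) (simp add: algebra_simps)
  also have "\<dots> = ?d U (br X ?JV) p - ?d U (\<lambda>p. JJ p (br X V p)) p" unfolding 1 2 3 by simp
  also have "\<dots> = d\<alpha> p (U p) (br X ?JV p) - d\<alpha> p (U p) (JJ p (br X V p))"
    by (simp add: ext_deriv_at[OF \<alpha>_form, symmetric] u br_VF Reeb(1) K_field_VF[OF JV] JJ_VF v)
  also have "\<dots> = d\<alpha> p (U p) (LJ V p)"
    unfolding LJ_def
    by (simp add: linear_at_diff[OF d\<alpha>_right] VF_T u v br_VF Reeb(1) K_field_VF[OF JV] JJ_T)
  finally show ?thesis .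
qed

text \<open>The Reeb flow preserves the area form \<open>d\<alpha>\<close> of the contact planes, so the derivative of the metric on them is
  trace-free. In terms of \<open>J\<close>, this is the anticommutation of \<open>LJ\<close> with \<open>J\<close>.\<close>

lemma \<sigma>_trace:
  assumes U: "K_field U"
  shows "\<sigma> U U p + \<sigma> (\<lambda>p. JJ p (U p)) (\<lambda>p. JJ p (U p)) p = 0"
proof -
  let ?JU = "\<lambda>p. JJ p (U p)"
  have JU: "K_field ?JU" by (rule K_field_JJ[OF K_field_VF[OF U]])
  have LU: "LJ U p \<in> K p" by (rule K_field_K[OF LJ_K[OF U]])
  have "LJ ?JU p = (\<lambda>f. - JJ p (LJ U p) f)" using LJ_JJ[OF U] by auto
  then have "d\<alpha> p (?JU p) (LJ ?JU p) = - d\<alpha> p (?JU p) (JJ p (LJ U p))"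
    by (simp add: linear_at_minus[OF d\<alpha>_right] JJ_T K_T[OF LU] K_T[OF K_field_K[OF U]])
  also have "\<dots> = - d\<alpha> p (U p) (LJ U p)" by (simp add: d\<alpha>_JJ K_field_K[OF U] LU)
  finally have "2 * \<theta> * (\<sigma> U U p + \<sigma> ?JU ?JU p) = 0"
    using \<sigma>_LJ[OF U U] \<sigma>_LJ[OF JU JU] by (simp add: distrib_left)
  then show ?thesis using \<theta>_pos by simp
qed

lemma D_X_X: "D X X = (\<lambda>p f. 0)"
proof (rule VF_eqI[OF D_VF[OF Reeb(1) Reeb(1)] VF_zero])
  fix Z p assume Z: "VF Z"
  have gX: "gf W X = (\<lambda>p. \<alpha> p (W p))" if "VF W" for W
    by (auto simp: gf_def g_X VF_T[OF that])
  have "gf X Z = (\<lambda>p. \<alpha> p (Z p))" using gX[OF Z] gf_sym[OF Reeb(1) Z] by simp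
  moreover have "br X X = (\<lambda>p f. 0)" by (auto simp: lie_bracket_def fun_eq_iff)
  ultimately have "koszul X X Z p = 0"
    by (simp add: koszul_def gX Reeb br_VF Z Reeb_deriv T_const[OF VF_T[OF Z]])
       (simp add: gf_def linear_at_zero[OF g_left[OF VF_T[OF Z]]])
  then show "gf (D X X) Z p = gf (\<lambda>p f. 0) Z p"
    by (simp add: D_koszul Z Reeb(1)) (simp add: gf_def linear_at_zero[OF g_left[OF VF_T[OF Z]]])
qed

text \<open>The symmetric part of \<open>\<nabla>X\<close> is half the Lie derivative of the metric, the antisymmetric part is half of
  \<open>d\<alpha>\<close>, because \<open>\<alpha>\<close> is dual to \<open>X\<close>.\<close>

lemma D_U_X:
  assumes U: "VF U" and V: "VF V"
  shows "gf (D U X) V p = ext_deriv_fields A \<alpha> U V p / 2 + \<sigma> U V p"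
proof -
  have gX: "gf W X = (\<lambda>p. \<alpha> p (W p))" if "VF W" for W
    by (auto simp: gf_def g_X VF_T[OF that])
  have gX': "gf X W = (\<lambda>p. \<alpha> p (W p))" if "VF W" for W
    using gX[OF that] gf_sym[OF Reeb(1) that] by simp
  have b: "gf (br U X) V p = - gf (br X U) V p"
    unfolding br_antisym[of U X] by (simp add: gf_linear br_VF U V Reeb(1))
  show ?thesis
    unfolding D_koszul[OF U Reeb(1) V] koszul_def gX[OF U] gX'[OF V] gX[OF br_VF[OF U V]] b
      ext_deriv_fields_def \<sigma>_def gf_sym[OF U br_VF[OF Reeb(1) V]]
    by (simp add: field_simps)
qed

text \<open>Where \<open>L\<^sub>X J\<close> vanishes, \<open>\<nabla>\<^sub>U X = (\<theta>/2) J U\<close>, which contributes \<open>\<theta>\<^sup>2/4\<close>. The derivative of \<open>\<sigma>\<close> along \<open>X\<close> may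
  be nonzero even there; it disappears only from the trace.\<close>

lemma curvature_at_zero:
  assumes U: "K_field U" and z: "LJ U p = (\<lambda>f. 0)"
  shows "gf (R U X X) U p = \<theta>\<^sup>2 / 4 * gf U U p - X p (\<sigma> U U)"
proof -
  note u = K_field_VF[OF U]
  let ?d = "ext_deriv_fields A \<alpha>"
  define h where "h = \<theta> / 2"
  have \<theta>: "\<theta> = 2 * h" by (simp add: h_def)
  have DUX: "VF (D U X)" by (rule D_VF[OF u Reeb(1)])
  have \<sigma>0: "\<sigma> V U p = 0" if V: "K_field V" for V
    using \<sigma>_LJ[OF V U, of p] z \<theta>_pos linear_at_zero[OF d\<alpha>_right[OF K_T[OF K_field_K[OF V]]], of p] by simp
  have uT: "U p \<in> T p" and JuT: "JJ p (U p) \<in> T p" using VF_T[OF u] JJ_T by auto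
  have at: "D U X p = (\<lambda>f. h * JJ p (U p) f)"
  proof (rule g_nondegenerate[OF VF_T[OF DUX] T_scale[OF JuT]])
    fix w assume w: "w \<in> T p"
    have WK: "g p (D U X p) v = g p (\<lambda>f. h * JJ p (U p) f) v" if v: "v \<in> K p" for v
    proof -
      define V where "V = (\<lambda>q f. extend_tvec A p v q f - \<alpha> q (extend_tvec A p v q) * X q f)"
      note ev = extension[OF K_T[OF v]]
      have V: "K_field V"
        unfolding K_field_def V_def
        using VF_sub[OF ev(1) VF_scale[OF one_form_C[OF \<alpha>_form ev(1)] Reeb(1)]] proj_K[OF VF_T[OF ev(1)]] by blast
      have Vp: "V p = v" using v by (simp add: V_def ev(2) K_iff)
      have "g p (D U X p) v = d\<alpha> p (U p) v / 2 + \<sigma> U V p"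
        using D_U_X[OF u K_field_VF[OF V], of p] ext_deriv_at[OF \<alpha>_form u K_field_VF[OF V], of p]
        by (simp add: gf_def Vp)
      also have "\<sigma> U V p = 0" using \<sigma>0[OF V] \<sigma>_sym[OF u K_field_VF[OF V]] by simp
      finally show ?thesis
        using d\<alpha>_g[OF uT v] g_JJ_skew[OF K_field_K[OF U] v] \<theta>
        by (simp add: linear_at_scale[OF g_left[OF K_T[OF v]] JuT])
    qed
    have WX: "g p (D U X p) (X p) = g p (\<lambda>f. h * JJ p (U p) f) (X p)"
    proof -
      have "gf X X = (\<lambda>p. 1)" by (auto simp: gf_def g_X X_T Reeb)
      then have "gf (D U X) X p + gf X (D U X) p = 0"
        using D_metric[OF u Reeb(1) Reeb(1), of p] T_const[OF uT, of 1] by simp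
      then have "g p (D U X p) (X p) = 0" using gf_sym[OF Reeb(1) DUX] by (simp add: gf_def)
      moreover have "\<alpha> p (JJ p (U p)) = 0" using JJ_K[OF uT] by (simp add: K_iff)
      ultimately show ?thesis by (simp add: g_X T_scale JuT linear_at_scale[OF \<alpha>_linear])
    qed
    have "g p (D U X p) (\<lambda>f. 1 * (\<lambda>f. w f - \<alpha> p w * X p f) f + \<alpha> p w * X p f) =
      g p (\<lambda>f. h * JJ p (U p) f) (\<lambda>f. 1 * (\<lambda>f. w f - \<alpha> p w * X p f) f + \<alpha> p w * X p f)"
      unfolding linear_at_lincomb[OF g_right[OF VF_T[OF DUX]] K_T[OF proj_K[OF w]] X_T]
        linear_at_lincomb[OF g_right[OF T_scale[OF JuT]] K_T[OF proj_K[OF w]] X_T] WX WK[OF proj_K[OF w]] ..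
    then show "g p (D U X p) w = g p (\<lambda>f. h * JJ p (U p) f) w" by simp
  qed
  have norm: "gf (D U X) (D U X) p = \<theta>\<^sup>2 / 4 * gf U U p"
    unfolding gf_def at
    using JuT g_JJ_JJ[OF K_field_K[OF U] K_field_K[OF U]]
    by (simp add: linear_at_scale[OF g_left[OF T_scale[OF JuT]]] linear_at_scale[OF g_right[OF JuT]] power2_eq_square \<theta>)
  have bU: "K_field (br X U)" by (rule br_X_K[OF U])
  note b = K_field_VF[OF bU]
  have t: "D X U = (\<lambda>p f. br X U p f + D U X p f)"
    unfolding D_torsion[OF Reeb(1) u] by simp
  have s: "gf (D U X) U = \<sigma> U U"
  proof
    fix q show "gf (D U X) U q = \<sigma> U U q"
      using D_U_X[OF u u, of q] ext_deriv_fields_antisym[OF \<alpha>_form u u, of q] by simp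
  qed
  have 1: "gf (D X (D U X)) U p = X p (\<sigma> U U) - gf (D U X) (D X U) p"
    using D_metric[OF Reeb(1) DUX u, of p] unfolding s by simp
  have 2: "gf (D U X) (D X U) p = gf (D U X) (br X U) p + gf (D U X) (D U X) p"
    unfolding t by (simp add: gf_linear b DUX)
  have 3: "gf (D (br U X) X) U p = - gf (D (br X U) X) U p"
    unfolding br_antisym[of U X] by (simp add: D_minus_left b Reeb(1) gf_linear D_VF u)
  have 4: "gf (D U X) (br X U) p + gf (D (br X U) X) U p = 0"
    using D_U_X[OF u b, of p] D_U_X[OF b u, of p] ext_deriv_fields_antisym[OF \<alpha>_form u b, of p]
      \<sigma>0[OF bU] \<sigma>_sym[OF u b, of p] by simp
  have "R U X X = (\<lambda>p f. - D X (D U X) p f - D (br U X) X p f)"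
    by (simp add: R_def' D_X_X D_zero_right u)
  then have "gf (R U X X) U p = - gf (D X (D U X)) U p - gf (D (br U X) X) U p"
    by (simp add: gf_linear VF_minus D_VF DUX Reeb(1) u br_VF)
  then show ?thesis unfolding 1 2 3 norm using 4 by simp
qed

definition K_ext :: "'a \<Rightarrow> 'a tvec \<Rightarrow> 'a vfield" where
  "K_ext p v = (\<lambda>q f. extend_tvec A p v q f - \<alpha> q (extend_tvec A p v q) * X q f)"

lemma K_ext: assumes "v \<in> K p" shows "K_field (K_ext p v)" "K_ext p v p = v"
proof -
  note ev = extension[OF K_T[OF assms]]
  show "K_field (K_ext p v)"
    unfolding K_field_def K_ext_def
    using VF_sub[OF ev(1) VF_scale[OF one_form_C[OF \<alpha>_form ev(1)] Reeb(1)]] proj_K[OF VF_T[OF ev(1)]] by blast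
  show "K_ext p v p = v" using assms by (simp add: K_ext_def ev(2) K_iff)
qed

lemma sectional_curvature_Reeb:
  assumes U: "K_field U" and unit: "g p (U p) (U p) = 1"
  shows "sectional_curvature A g p (U p) (X p) = gf (R U X X) U p"
proof -
  have uT: "U p \<in> T p" by (rule VF_T[OF K_field_VF[OF U]])
  note e = extension[OF uT] and x = extension[OF X_T[of p]]
  have "R (extend_tvec A p (U p)) (extend_tvec A p (X p)) (extend_tvec A p (X p)) p = R U X X p"
    by (rule R_tensorial) (simp_all add: e x Reeb(1) K_field_VF[OF U])
  moreover have "g p (X p) (X p) = 1" "g p (U p) (X p) = 0"
    using K_field_K[OF U, of p] by (simp_all add: g_X X_T uT Reeb K_iff)
  ultimately show ?thesis
    by (simp add: sectional_curvature_def Let_def gf_def unit)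
qed

text \<open>Two contributions \<open>\<theta>\<^sup>2/4\<close>, from \<open>e\<close> and from \<open>J e\<close>. The derivative terms cancel, because the trace of \<open>\<sigma>\<close> is zero
  on the whole manifold and not only at \<open>p\<close>.\<close>

lemma ricci_reeb_eq:
  assumes z: "\<And>U. K_field U \<Longrightarrow> LJ U p = (\<lambda>f. 0)"
  shows "ricci_reeb A \<alpha> J g p = \<theta>\<^sup>2 / 2"
proof -
  have sum: "sectional_curvature A g p e (X p) + sectional_curvature A g p (J p e) (X p) = \<theta>\<^sup>2 / 2"
    if e: "e \<in> K p" and unit: "g p e e = 1" for e
  proof -
    define U where "U = K_ext p e"
    define V where "V = (\<lambda>q. JJ q (U q))"
    have U: "K_field U" "U p = e" unfolding U_def by (intro K_ext e)+
    have V: "K_field V" unfolding V_def by (rule K_field_JJ[OF K_field_VF[OF U(1)]])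
    have Vp: "V p = J p e" by (simp add: V_def U(2) JJ_ker e)
    have Vu: "g p (V p) (V p) = 1" using g_JJ_JJ[OF e e] by (simp add: V_def U(2) unit)
    have C: "\<sigma> U U \<in> C" "\<sigma> V V \<in> C"
    proof -
      have "(\<lambda>p. (1/2) * (X p (gf U U) - gf (br X U) U p - gf U (br X U) p)) \<in> C" if "VF U" for U
        by (intro C_mult C_const C_diff VF_C[OF Reeb(1)] gf_C br_VF Reeb(1) that)
      then show "\<sigma> U U \<in> C" "\<sigma> V V \<in> C"
        using K_field_VF[OF U(1)] K_field_VF[OF V] by (simp_all add: \<sigma>_def[abs_def])
    qed
    have "X p (\<sigma> U U) + X p (\<sigma> V V) = X p (\<lambda>q. \<sigma> U U q + \<sigma> V V q)"
      by (rule T_add[OF X_T C, symmetric])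
    also have "\<dots> = 0"
      using \<sigma>_trace[OF U(1)] T_const[OF X_T] by (simp add: V_def)
    finally have tr: "X p (\<sigma> U U) + X p (\<sigma> V V) = 0" .
    have "sectional_curvature A g p e (X p) = \<theta>\<^sup>2 / 4 - X p (\<sigma> U U)"
      using sectional_curvature_Reeb[OF U(1), of p] curvature_at_zero[OF U(1) z[OF U(1)]] unit
      by (simp add: U(2) gf_def)
    moreover have "sectional_curvature A g p (J p e) (X p) = \<theta>\<^sup>2 / 4 - X p (\<sigma> V V)"
      using sectional_curvature_Reeb[OF V, of p] curvature_at_zero[OF V z[OF V]] Vu
      by (simp add: Vp gf_def)
    ultimately show ?thesis using tr by linarith
  qed
  obtain w where w: "w \<in> K p" "w \<noteq> zero_tvec" using K_nontrivial by blast
  define a where "a = 1 / sqrt (g p w w)"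
  define e where "e = (\<lambda>f. a * w f)"
  have pos: "g p w w > 0" by (rule g_pos[OF K_T[OF w(1)] w(2)])
  have eK: "e \<in> K p" unfolding e_def by (rule K_scale[OF w(1)])
  have "g p e e = a * (a * g p w w)"
    unfolding e_def using K_T[OF w(1)] K_T[OF K_scale[OF w(1)]]
    by (simp add: linear_at_scale[OF g_left] linear_at_scale[OF g_right])
  also have "\<dots> = 1" using pos by (simp add: a_def)
  finally have eu: "g p e e = 1" .
  show ?thesis
    unfolding ricci_reeb_def
    by (rule the_equality) (use sum eK eu in auto)
qed

subsection \<open>The derivative of \<open>J\<close> as an antilinear bundle map\<close>

text \<open>The tensor \<open>L\<^sub>X J\<close> as a map of the contact plane at a point. The expansion in the frame makes its continuity
  along maps evident.\<close>

definition P :: "'a \<Rightarrow> 'a tvec \<Rightarrow> 'a tvec" where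
  "P p w = (\<lambda>f. \<Sum>k<n. w (F k) * LJ (Y k) p f)"

lemma LJ_P:
  assumes U: "K_field U" shows "LJ U p = P p (U p)"
proof -
  note V = K_field_VF[OF U]
  have z: "LJ (\<lambda>p f. 0) p f = 0" for f using LJ_scale[OF VF_zero C_const[of 0]] by simp
  have s: "LJ (\<lambda>q f. \<Sum>k\<in>I. c k q * Y k q f) p f = (\<Sum>k\<in>I. c k p * LJ (Y k) p f)"
    if "\<And>k. c k \<in> C" for c and I :: "nat set" and f
  proof (induction I rule: infinite_finite_induct)
    case (insert k I)
    then have "LJ (\<lambda>q f. \<Sum>k\<in>insert k I. c k q * Y k q f) p f =
        LJ (\<lambda>q f. c k q * Y k q f + (\<Sum>k\<in>I. c k q * Y k q f)) p f" by simp
    also have "\<dots> = LJ (\<lambda>q f. c k q * Y k q f) p f + LJ (\<lambda>q f. \<Sum>k\<in>I. c k q * Y k q f) p f"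
      by (intro LJ_add VF_scale VF_sum Y_VF that)
    finally show ?case using insert by (simp add: LJ_scale[OF Y_VF that])
  qed (simp_all add: z)
  have "U = (\<lambda>q f. \<Sum>k<n. U q (F k) * Y k q f)"
    by (rule ext) (rule K_expand[OF K_field_K[OF U]])
  then have "LJ U p = LJ (\<lambda>q f. \<Sum>k<n. U q (F k) * Y k q f) p" by (rule arg_cong)
  then show ?thesis
    unfolding P_def by (intro ext) (simp add: s[OF VF_C[OF V F_C]])
qed

lemma P_K: assumes "w \<in> K p" shows "P p w \<in> K p"
  using K_field_K[OF LJ_K[OF K_ext(1)[OF assms]], of p] LJ_P[OF K_ext(1)[OF assms], of p]
  by (simp add: K_ext(2)[OF assms])

lemma P_linear: "P p (\<lambda>f. a * u f + b * v f) = (\<lambda>f. a * P p u f + b * P p v f)"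
  by (simp add: P_def algebra_simps sum.distrib sum_distrib_left)

lemma P_JJ: assumes "w \<in> K p" shows "P p (JJ p w) = (\<lambda>f. - JJ p (P p w) f)"
proof -
  note U = K_ext[OF assms]
  have "LJ (\<lambda>q. JJ q (K_ext p w q)) p = P p (JJ p w)"
    by (simp add: LJ_P[OF K_field_JJ[OF K_field_VF[OF U(1)]]] U(2))
  then show ?thesis using LJ_JJ[OF U(1), of p] LJ_P[OF U(1), of p] by (intro ext) (simp add: U(2))
qed

text \<open>By antilinearity the map vanishes on a contact plane as soon as it vanishes on one nonzero vector.\<close>

lemma P_nonzero:
  assumes ric: "ricci_reeb A \<alpha> J g p \<noteq> \<theta>\<^sup>2 / 2" and w: "w \<in> K p" "w \<noteq> zero_tvec"
  shows "P p w \<noteq> zero_tvec"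
proof
  assume "P p w = zero_tvec"
  then have z: "P p w = (\<lambda>f. 0)" by (simp add: zero_tvec_def)
  have "P p v = (\<lambda>f. 0)" if v: "v \<in> K p" for v
  proof -
    have "g p w w > 0" by (rule g_pos[OF K_T[OF w(1)] w(2)])
    moreover have "P p (\<lambda>f. g p w w * v f) = (\<lambda>f. 0)"
      unfolding plane_expansion[OF w(1) v] P_linear P_JJ[OF w(1)] z by (simp add: JJ_zero)
    moreover have "P p (\<lambda>f. g p w w * v f) = (\<lambda>f. g p w w * P p v f)"
      using P_linear[of p "g p w w" v 0 v] by simp
    ultimately show ?thesis by (auto simp: fun_eq_iff)
  qed
  then have "ricci_reeb A \<alpha> J g p = \<theta>\<^sup>2 / 2"
    by (intro ricci_reeb_eq) (simp add: LJ_P K_field_K)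
  with ric show False by simp
qed

end


section \<open>Angles along paths of nonzero complex numbers\<close>

definition nz_path :: "(real \<Rightarrow> complex) \<Rightarrow> bool" where
  "nz_path \<gamma> \<longleftrightarrow> continuous_on {0..1} \<gamma> \<and> (\<forall>t\<in>{0..1}. \<gamma> t \<noteq> 0)"

text \<open>The change of the argument in full turns; the path need not be closed.\<close>

definition turns :: "(real \<Rightarrow> complex) \<Rightarrow> real" where
  "turns \<gamma> = Re (winding_number \<gamma> 0)"

lemma nz_path_iff: "nz_path \<gamma> \<longleftrightarrow> path \<gamma> \<and> 0 \<notin> path_image \<gamma>"
  by (auto simp: nz_path_def path_def path_image_def)

lemma turns_cong: "(\<And>t. t \<in> {0..1} \<Longrightarrow> \<gamma> t = \<delta> t) \<Longrightarrow> turns \<gamma> = turns \<delta>"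
  unfolding turns_def by (rule arg_cong[where f = Re], rule winding_number_cong) auto

lemma nz_path_log:
  assumes "nz_path \<gamma>"
  obtains l where "continuous_on {0..1} l" "\<And>t. t \<in> {0..1} \<Longrightarrow> \<gamma> t = exp (l t)"
proof -
  have p: "path \<gamma>" "0 \<notin> path_image \<gamma>" using assms by (auto simp: nz_path_iff)
  show ?thesis
  proof (rule winding_number_as_continuous_log[OF p])
    fix q assume "path q" "\<And>t. t \<in> {0..1} \<Longrightarrow> \<gamma> t = 0 + exp (q t)"
    then show ?thesis by (intro that[of q]) (auto simp: path_def)
  qed
qed

lemma turns_log:
  assumes "continuous_on {0..1} l" "\<And>t. t \<in> {0..1} \<Longrightarrow> \<gamma> t = exp (l t)"
  shows "turns \<gamma> = (Im (l 1) - Im (l 0)) / (2 * pi)"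
proof -
  have "winding_number \<gamma> 0 = winding_number (exp \<circ> l) 0"
    by (rule winding_number_cong) (use assms(2) in auto)
  also have "\<dots> = (l 1 - l 0) / (2 * of_real pi * \<i>)"
    using winding_number_compose_exp[of l] assms(1) by (simp add: path_def pathfinish_def pathstart_def)
  also have "\<dots> = of_real (1 / (2 * pi)) * (- \<i> * (l 1 - l 0))"
    by (simp add: field_simps)
  finally show ?thesis by (simp add: turns_def) (simp add: diff_divide_distrib)
qed

lemma nz_path_mult: "nz_path \<gamma> \<Longrightarrow> nz_path \<delta> \<Longrightarrow> nz_path (\<lambda>t. \<gamma> t * \<delta> t)"
  by (auto simp: nz_path_def intro!: continuous_intros)

lemma turns_mult:
  assumes "nz_path \<gamma>" "nz_path \<delta>"
  shows "turns (\<lambda>t. \<gamma> t * \<delta> t) = turns \<gamma> + turns \<delta>"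
proof -
  obtain l where l: "continuous_on {0..1} l" "\<And>t. t \<in> {0..1} \<Longrightarrow> \<gamma> t = exp (l t)"
    using nz_path_log[OF assms(1)] by blast
  obtain m where m: "continuous_on {0..1} m" "\<And>t. t \<in> {0..1} \<Longrightarrow> \<delta> t = exp (m t)"
    using nz_path_log[OF assms(2)] by blast
  have "turns (\<lambda>t. \<gamma> t * \<delta> t) = (Im (l 1 + m 1) - Im (l 0 + m 0)) / (2 * pi)"
    by (rule turns_log) (auto intro!: continuous_intros l m simp: l m exp_add)
  then show ?thesis using turns_log[OF l] turns_log[OF m] by (simp add: diff_divide_distrib add_divide_distrib)
qed

lemma nz_path_cnj: "nz_path \<gamma> \<Longrightarrow> nz_path (\<lambda>t. cnj (\<gamma> t))"
  by (auto simp: nz_path_def intro!: continuous_intros)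

lemma turns_cnj:
  assumes "nz_path \<gamma>" shows "turns (\<lambda>t. cnj (\<gamma> t)) = - turns \<gamma>"
proof -
  obtain l where l: "continuous_on {0..1} l" "\<And>t. t \<in> {0..1} \<Longrightarrow> \<gamma> t = exp (l t)"
    using nz_path_log[OF assms(1)] by blast
  have "turns (\<lambda>t. cnj (\<gamma> t)) = (Im (cnj (l 1)) - Im (cnj (l 0))) / (2 * pi)"
    by (rule turns_log) (auto intro!: continuous_intros l simp: l exp_cnj)
  then show ?thesis using turns_log[OF l] by (simp add: diff_divide_distrib)
qed

lemma nz_path_pos:
  assumes "continuous_on {0..1} r" "\<And>t. t \<in> {0..1} \<Longrightarrow> r t > 0"
  shows "nz_path (\<lambda>t. complex_of_real (r t))"
  unfolding nz_path_def
proof (intro conjI ballI continuous_on_of_real assms(1))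
  show "complex_of_real (r t) \<noteq> 0" if "t \<in> {0..1}" for t using assms(2)[OF that] by simp
qed

lemma turns_pos:
  assumes "continuous_on {0..1} r" "\<And>t. t \<in> {0..1} \<Longrightarrow> r t > 0"
  shows "turns (\<lambda>t. complex_of_real (r t)) = 0"
proof -
  have "turns (\<lambda>t. complex_of_real (r t)) = (Im (of_real (ln (r 1))) - Im (of_real (ln (r 0)))) / (2 * pi)"
  proof (rule turns_log)
    show "continuous_on {0..1} (\<lambda>t. complex_of_real (ln (r t)))"
    proof (intro continuous_on_of_real continuous_on_ln assms(1) ballI)
      show "r t \<noteq> 0" if "t \<in> {0..1}" for t using assms(2)[OF that] by simp
    qed
    show "complex_of_real (r t) = exp (of_real (ln (r t)))" if "t \<in> {0..1}" for t
      using assms(2)[OF that] by (simp add: exp_of_real)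
  qed
  then show ?thesis by simp
qed

lemma turns_slit:
  assumes "continuous_on {0..1} \<gamma>" "\<And>t. t \<in> {0..1} \<Longrightarrow> \<gamma> t \<notin> \<real>\<^sub>\<le>\<^sub>0"
  shows "turns \<gamma> = (Im (Ln (\<gamma> 1)) - Im (Ln (\<gamma> 0))) / (2 * pi)"
proof (rule turns_log)
  show "continuous_on {0..1} (\<lambda>t. Ln (\<gamma> t))" using assms by (rule continuous_on_Ln')
  show "\<gamma> t = exp (Ln (\<gamma> t))" if "t \<in> {0..1}" for t
    using assms(2)[OF that] by (subst exp_Ln) auto
qed

lemma turns_integer_part:
  assumes "nz_path \<gamma>"
  shows "\<exists>m::int. turns \<gamma> = of_int m + (Im (Ln (\<gamma> 1)) - Im (Ln (\<gamma> 0))) / (2 * pi)"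
proof -
  obtain l where l: "continuous_on {0..1} l" "\<And>t. t \<in> {0..1} \<Longrightarrow> \<gamma> t = exp (l t)"
    using nz_path_log[OF assms(1)] by blast
  have "\<exists>n::int. Im (l t) = Im (Ln (\<gamma> t)) + 2 * of_int n * pi" if t: "t \<in> {0..1}" for t
  proof -
    have "exp (l t) = exp (Ln (\<gamma> t))"
      using l(2)[OF t] assms t by (simp add: nz_path_def)
    then obtain n :: int where "l t = Ln (\<gamma> t) + (of_int (2 * n) * pi) * \<i>"
      unfolding exp_eq by blast
    then show ?thesis by (intro exI[of _ n]) simp
  qed
  from this[of 1] this[of 0] obtain m n :: int where
    "Im (l 1) = Im (Ln (\<gamma> 1)) + 2 * of_int m * pi" "Im (l 0) = Im (Ln (\<gamma> 0)) + 2 * of_int n * pi" by auto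
  then show ?thesis
    using turns_log[OF l] by (intro exI[of _ "m - n"]) (simp add: diff_divide_distrib add_divide_distrib)
qed

text \<open>The three paths are sides of a triangle as in the definition of the boundary loop of a 2-simplex.\<close>

lemma turns_triangle_loop:
  assumes "nz_path a" "nz_path b" "nz_path c" "a 1 = b 0" "b 1 = c 1" "a 0 = c 0"
  shows "winding_number (a +++ (b +++ reversepath c)) 0 \<in> \<int>"
    and "Re (winding_number (a +++ (b +++ reversepath c)) 0) = turns a + (turns b - turns c)"
proof -
  have p: "path a" "path b" "path c" "0 \<notin> path_image a" "0 \<notin> path_image b" "0 \<notin> path_image c"
    using assms by (auto simp: nz_path_iff)
  have bc: "path (b +++ reversepath c)" "0 \<notin> path_image (b +++ reversepath c)"
    using p assms(5) path_image_reversepath[of c]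
    by (auto simp: path_image_join pathfinish_def[of b] pathfinish_def[of c])
  have w: "winding_number (b +++ reversepath c) 0 = winding_number b 0 - winding_number c 0"
    using p assms(5)
    by (simp add: winding_number_join winding_number_reversepath pathfinish_def[of b] pathfinish_def[of c])
  have ab: "pathfinish a = pathstart (b +++ reversepath c)"
    using assms(4) by (simp add: pathfinish_def pathstart_def joinpaths_def)
  show "Re (winding_number (a +++ (b +++ reversepath c)) 0) = turns a + (turns b - turns c)"
    by (simp add: winding_number_join[OF p(1,4) bc ab] w turns_def)
  have "path (a +++ (b +++ reversepath c))" "0 \<notin> path_image (a +++ (b +++ reversepath c))"
    using p bc ab by (auto simp: path_image_join)
  moreover have "pathfinish (a +++ (b +++ reversepath c)) = pathstart (a +++ (b +++ reversepath c))"
    using assms(6) by (simp add: pathfinish_def pathstart_def joinpaths_def reversepath_def)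
  ultimately show "winding_number (a +++ (b +++ reversepath c)) 0 \<in> \<int>"
    by (simp add: integer_winding_number_eq)
qed

section \<open>The standard simplices in dimensions 1 and 2\<close>

(* Keeps the vertices and faces of simplices numbered by numerals. *)
declare One_nat_def [simp del]

abbreviation simplex_topology :: "nat \<Rightarrow> (nat \<Rightarrow> real) topology" where
  "simplex_topology n \<equiv> subtopology (powertop_real UNIV) (standard_simplex n)"

definition triangle :: "(real \<times> real) set" where
  "triangle = {y. 0 \<le> fst y \<and> 0 \<le> snd y \<and> fst y + snd y \<le> 1}"

text \<open>Barycentric coordinates. The closed triangle in the plane replaces the standard 2-simplex, which is a set of
  infinite sequences, so that results on normed spaces apply.\<close>

definition triangle_point :: "real \<times> real \<Rightarrow> nat \<Rightarrow> real" where
  "triangle_point y = (\<lambda>i. if i = 0 then 1 - fst y - snd y else if i = 1 then fst y else if i = 2 then snd y else 0)"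

definition triangle_face :: "nat \<Rightarrow> real \<Rightarrow> real \<times> real" where
  "triangle_face k t = (if k = 2 then (t, 0) else if k = 0 then (1 - t, t) else (0, t))"

lemma triangle_point_face: "k \<le> 2 \<Longrightarrow> triangle_point (triangle_face k t) = simplical_face k (edge_point t)"
  by (rule ext) (auto simp: triangle_point_def triangle_face_def simplical_face_def edge_point_def)

lemma triangle_point_in: "y \<in> triangle \<Longrightarrow> triangle_point y \<in> standard_simplex 2"
  by (auto simp: triangle_def triangle_point_def standard_simplex_def numeral_2_eq_2)

lemma edge_point_in: "t \<in> {0..1} \<Longrightarrow> edge_point t \<in> standard_simplex 1"
  by (auto simp: edge_point_def standard_simplex_def One_nat_def)

lemma triangle_face_in: "t \<in> {0..1} \<Longrightarrow> triangle_face k t \<in> triangle"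
  by (auto simp: triangle_def triangle_face_def)

lemma continuous_triangle_face: "continuous_on S (triangle_face k)"
  unfolding triangle_face_def by (cases "k = 2"; cases "k = 0") (auto intro!: continuous_intros)

lemma convex_triangle: "convex triangle"
proof (rule convexI)
  fix x y :: "real \<times> real" and u v :: real
  assume xy: "x \<in> triangle" "y \<in> triangle" and uv: "0 \<le> u" "0 \<le> v" "u + v = 1"
  have "u * (fst x + snd x) + v * (fst y + snd y) \<le> u * 1 + v * 1"
    using xy uv by (intro add_mono mult_left_mono) (auto simp: triangle_def)
  then show "u *\<^sub>R x + v *\<^sub>R y \<in> triangle"
    using xy uv by (auto simp: triangle_def algebra_simps)
qed

lemma compact_triangle: "compact triangle"
proof (rule compact_Int_closed[of "{0..1} \<times> {0..1}", THEN back_subst[of compact]])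
  show "compact ({0..1::real} \<times> {0..1::real})" by (intro compact_Times compact_Icc)
  show "closed {y::real \<times> real. fst y + snd y \<le> 1}"
    by (intro closed_Collect_le continuous_intros)
  show "({0..1} \<times> {0..1}) \<inter> {y::real \<times> real. fst y + snd y \<le> 1} = triangle"
    by (auto simp: triangle_def)
qed

lemma continuous_map_triangle_point:
  "continuous_map (top_of_set triangle) (simplex_topology 2) triangle_point"
  unfolding continuous_map_in_subtopology
proof
  show "continuous_map (top_of_set triangle) (powertop_real UNIV) triangle_point"
    unfolding continuous_map_componentwise_UNIV continuous_map_iff_continuous
  proof
    fix i show "continuous_on triangle (\<lambda>x. triangle_point x i)"
      unfolding triangle_point_def
      by (cases "i = 0"; cases "i = 1"; cases "i = 2") (auto intro!: continuous_intros)
  qed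
qed (auto intro: triangle_point_in)

lemma continuous_map_edge_point:
  "continuous_map (top_of_set {0..1}) (simplex_topology 1) edge_point"
  unfolding continuous_map_in_subtopology
proof
  show "continuous_map (top_of_set {0..1}) (powertop_real UNIV) edge_point"
    unfolding continuous_map_componentwise_UNIV continuous_map_iff_continuous
  proof
    fix i show "continuous_on {0..1} (\<lambda>x. edge_point x i)"
      unfolding edge_point_def by (cases "i = 0"; cases "i = 1") (auto intro!: continuous_intros)
  qed
qed (auto intro: edge_point_in)

lemma continuous_map_component: "continuous_map (simplex_topology n) euclideanreal (\<lambda>x. x i)"
  by (intro continuous_map_from_subtopology continuous_map_product_projection) simp

lemma triangle_coordinates:
  assumes "x \<in> standard_simplex 2"
  shows "(x 1, x 2) \<in> triangle" "triangle_point (x 1, x 2) = x"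
proof -
  have s: "x 0 + x 1 + x 2 = 1" "\<And>i. 0 \<le> x i" "\<And>i. i > 2 \<Longrightarrow> x i = 0"
    using assms by (auto simp: standard_simplex_def numeral_2_eq_2 One_nat_def)
  show "(x 1, x 2) \<in> triangle" using s(1) s(2)[of 0] s(2)[of 1] s(2)[of 2] by (auto simp: triangle_def)
  show "triangle_point (x 1, x 2) = x"
    using s by (intro ext) (auto simp: triangle_point_def)
qed

lemma edge_coordinate:
  assumes "x \<in> standard_simplex 1"
  shows "x 1 \<in> {0..1}" "edge_point (x 1) = x"
proof -
  have s: "x 0 + x 1 = 1" "\<And>i. 0 \<le> x i" "\<And>i. i > 1 \<Longrightarrow> x i = 0"
    using assms by (auto simp: standard_simplex_def One_nat_def)
  show "x 1 \<in> {0..1}" using s(1) s(2)[of 0] s(2)[of 1] by auto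
  show "edge_point (x 1) = x"
    using s by (intro ext) (auto simp: edge_point_def)
qed

lemma continuous_map_triangle_coordinates:
  "continuous_map (simplex_topology 2) (top_of_set triangle) (\<lambda>x. (x 1, x 2))"
  unfolding continuous_map_in_subtopology
proof
  have "continuous_map (simplex_topology 2) (prod_topology euclideanreal euclideanreal) (\<lambda>x. (x 1, x 2))"
    by (intro continuous_map_pairedI continuous_map_component)
  then show "continuous_map (simplex_topology 2) euclidean (\<lambda>x. (x 1, x 2))"
    by simp
qed (auto simp: triangle_coordinates)

lemma continuous_map_edge_coordinate:
  "continuous_map (simplex_topology 1) (top_of_set {0..1}) (\<lambda>x. x 1)"
  unfolding continuous_map_in_subtopology
  using continuous_map_component edge_coordinate by auto

text \<open>The signed sum over the faces of a 2-simplex, whose boundary runs through the faces 2 and 0 forwards and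
  through the face 1 backwards.\<close>

definition boundary_sum :: "(nat \<Rightarrow> 'b::ab_group_add) \<Rightarrow> 'b" where
  "boundary_sum f = f 2 + (f 0 - f 1)"

text \<open>A function without zeros on a triangle has a logarithm, so the total change of its argument around the
  boundary is 0.\<close>

lemma turns_triangle:
  assumes "continuous_on triangle G" "\<And>y. y \<in> triangle \<Longrightarrow> G y \<noteq> 0"
  shows "boundary_sum (\<lambda>k. turns (\<lambda>t. G (triangle_face k t))) = 0"
proof -
  obtain L where L: "continuous_on triangle L" "\<And>y. y \<in> triangle \<Longrightarrow> G y = exp (L y)"
    using continuous_logarithm_on_contractible[OF assms(1) convex_imp_contractible[OF convex_triangle] assms(2)] by blast
  have "turns (\<lambda>t. G (triangle_face k t)) = (Im (L (triangle_face k 1)) - Im (L (triangle_face k 0))) / (2 * pi)" for k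
  proof (rule turns_log)
    show "continuous_on {0..1} (\<lambda>t. L (triangle_face k t))"
      by (rule continuous_on_compose2[OF L(1) continuous_triangle_face]) (use triangle_face_in in auto)
  qed (use L(2) triangle_face_in in auto)
  from this[of 0] this[of 1] this[of 2] show ?thesis
    by (simp add: boundary_sum_def triangle_face_def diff_divide_distrib)
qed

section \<open>Cohomology classes of 2-cochains\<close>

lemma cochain_eval_superset:
  assumes "finite S" "Poly_Mapping.keys b \<subseteq> S"
  shows "cochain_eval c b = (\<Sum>\<sigma>\<in>S. Poly_Mapping.lookup b \<sigma> * c \<sigma>)"
  unfolding cochain_eval_def
  by (rule sum.mono_neutral_left) (use assms in \<open>auto simp: in_keys_iff\<close>)

lemma cochain_eval_add: "cochain_eval c (a + b) = cochain_eval c a + cochain_eval c b"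
proof -
  let ?S = "Poly_Mapping.keys a \<union> Poly_Mapping.keys b"
  have "cochain_eval c (a + b) = (\<Sum>\<sigma>\<in>?S. Poly_Mapping.lookup (a + b) \<sigma> * c \<sigma>)"
    by (rule cochain_eval_superset) (auto dest: subsetD[OF keys_add])
  moreover have "cochain_eval c a = (\<Sum>\<sigma>\<in>?S. Poly_Mapping.lookup a \<sigma> * c \<sigma>)"
    "cochain_eval c b = (\<Sum>\<sigma>\<in>?S. Poly_Mapping.lookup b \<sigma> * c \<sigma>)"
    by (rule cochain_eval_superset; auto)+
  ultimately show ?thesis by (simp add: lookup_add distrib_right sum.distrib)
qed

lemma cochain_eval_cmul_of: "cochain_eval c (frag_cmul k (frag_of \<sigma>)) = k * c \<sigma>"
proof -
  have "cochain_eval c (frag_cmul k (frag_of \<sigma>)) =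
      (\<Sum>\<tau>\<in>{\<sigma>}. Poly_Mapping.lookup (frag_cmul k (frag_of \<sigma>)) \<tau> * c \<tau>)"
    by (rule cochain_eval_superset) (auto simp: keys_frag_of)
  then show ?thesis by simp
qed

lemma coboundary_at:
  assumes "singular_simplex 2 X \<sigma>"
  shows "coboundary 1 X d \<sigma> = boundary_sum (\<lambda>k. d (singular_face 2 k \<sigma>))"
proof -
  have "chain_boundary 2 (frag_of \<sigma>) = frag_cmul 1 (frag_of (singular_face 2 0 \<sigma>))
      + frag_cmul (- 1) (frag_of (singular_face 2 1 \<sigma>)) + frag_cmul 1 (frag_of (singular_face 2 2 \<sigma>))"
    by (simp add: chain_boundary_of numeral_2_eq_2 One_nat_def)
  then have "cochain_eval d (chain_boundary 2 (frag_of \<sigma>)) =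
      d (singular_face 2 0 \<sigma>) - d (singular_face 2 1 \<sigma>) + d (singular_face 2 2 \<sigma>)"
    by (simp only: cochain_eval_add cochain_eval_cmul_of)
  moreover have "coboundary 1 X d \<sigma> = cochain_eval d (chain_boundary 2 (frag_of \<sigma>))"
    using assms by (simp add: coboundary_def numeral_2_eq_2)
  ultimately show ?thesis by (simp add: boundary_sum_def)
qed

lemma cochain_carrier: "carrier (cochain_group n X) = extensional (singular_simplex_set n X)"
  by (auto simp: cochain_group_def PiE_def)

lemma cochain_mult: "c \<otimes>\<^bsub>cocycle_group n X\<^esub> c' = (\<lambda>\<sigma>\<in>singular_simplex_set n X. c \<sigma> + c' \<sigma>)"
  by (simp add: cocycle_group_def subgroup_generated_def cochain_group_def product_group_def)

lemma coboundary_set_2: "coboundary_set 2 X = coboundary 1 X ` extensional (singular_simplex_set 1 X)"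
  by (simp add: coboundary_set_def cochain_carrier One_nat_def)

lemma coboundary_face_simplex:
  "singular_simplex 2 X \<sigma> \<Longrightarrow> k \<le> 2 \<Longrightarrow> singular_simplex 1 X (singular_face 2 k \<sigma>)"
  using singular_simplex_singular_face[of 2 X \<sigma> k] by simp

definition cochain_comb :: "'a topology \<Rightarrow> int \<Rightarrow> (((nat \<Rightarrow> real) \<Rightarrow> 'a) \<Rightarrow> int) \<Rightarrow> int \<Rightarrow>
    (((nat \<Rightarrow> real) \<Rightarrow> 'a) \<Rightarrow> int) \<Rightarrow> ((nat \<Rightarrow> real) \<Rightarrow> 'a) \<Rightarrow> int" where
  "cochain_comb X a d b e = (\<lambda>\<tau>\<in>singular_simplex_set 1 X. a * d \<tau> + b * e \<tau>)"

lemma coboundary_comb: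
  assumes "singular_simplex 2 X \<sigma>"
  shows "coboundary 1 X (cochain_comb X a d b e) \<sigma> = a * coboundary 1 X d \<sigma> + b * coboundary 1 X e \<sigma>"
  using coboundary_face_simplex[OF assms]
  by (simp add: coboundary_at[OF assms] boundary_sum_def cochain_comb_def algebra_simps)

lemma coboundary_ext: "coboundary 1 X d \<in> extensional (singular_simplex_set 2 X)"
  by (simp add: coboundary_def numeral_2_eq_2)

lemma cohomology_class_eqI:
  assumes d: "d \<in> carrier (cochain_group 1 X)"
    and eq: "\<And>\<sigma>. singular_simplex 2 X \<sigma> \<Longrightarrow> c \<sigma> = c' \<sigma> + coboundary 1 X d \<sigma>"
  shows "cohomology_class 2 X c = cohomology_class 2 X c'"
proof -
  have sub: "cohomology_class 2 X c \<subseteq> cohomology_class 2 X c'"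
    if eq: "\<And>\<sigma>. singular_simplex 2 X \<sigma> \<Longrightarrow> c \<sigma> = c' \<sigma> + s * coboundary 1 X d \<sigma>" for c c' s
  proof
    fix z assume "z \<in> cohomology_class 2 X c"
    then obtain e where z: "z = (\<lambda>\<sigma>\<in>singular_simplex_set 2 X. coboundary 1 X e \<sigma> + c \<sigma>)"
      by (auto simp: cohomology_class_def r_coset_def coboundary_set_2 cochain_mult)
    have "z = (\<lambda>\<sigma>\<in>singular_simplex_set 2 X. coboundary 1 X (cochain_comb X 1 e s d) \<sigma> + c' \<sigma>)"
      unfolding z by (rule restrict_ext) (simp add: coboundary_comb eq)
    moreover have "cochain_comb X 1 e s d \<in> extensional (singular_simplex_set 1 X)"
      by (simp add: cochain_comb_def)
    ultimately show "z \<in> cohomology_class 2 X c'"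
      unfolding cohomology_class_def r_coset_def coboundary_set_2 cochain_mult by blast
  qed
  show ?thesis
  proof
    show "cohomology_class 2 X c \<subseteq> cohomology_class 2 X c'" by (rule sub[of _ _ 1]) (simp add: eq)
    show "cohomology_class 2 X c' \<subseteq> cohomology_class 2 X c" by (rule sub[of _ _ "-1"]) (simp add: eq)
  qed
qed

text \<open>For the coset of \<open>c\<close> modulo the group \<open>B\<close> of coboundaries, the square is the set \<open>B + (B + c) + (B + c)\<close>, which
  is the coset of \<open>2 c\<close>.\<close>

lemma cohomology_class_square_trivial:
  assumes d: "d \<in> carrier (cochain_group 1 X)"
    and eq: "\<And>\<sigma>. singular_simplex 2 X \<sigma> \<Longrightarrow> 2 * c \<sigma> = coboundary 1 X d \<sigma>"
  shows "cohomology_class 2 X c [^]\<^bsub>cohomology_group 2 X\<^esub> (2::nat) = \<one>\<^bsub>cohomology_group 2 X\<^esub>"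
proof -
  let ?S = "singular_simplex_set 2 X" and ?E = "extensional (singular_simplex_set 1 X)"
  let ?d = "coboundary 1 X" and ?G = "cocycle_group 2 X"
  have one: "\<one>\<^bsub>cohomology_group 2 X\<^esub> = ?d ` ?E"
    by (simp add: cohomology_group_def FactGroup_def coboundary_set_2)
  have cl: "cohomology_class 2 X c = {\<lambda>\<sigma>\<in>?S. ?d e \<sigma> + c \<sigma> | e. e \<in> ?E}"
    by (auto simp: cohomology_class_def r_coset_def coboundary_set_2 cochain_mult)
  have "cohomology_class 2 X c [^]\<^bsub>cohomology_group 2 X\<^esub> (2::nat) =
      (\<one>\<^bsub>cohomology_group 2 X\<^esub> <#>\<^bsub>?G\<^esub> cohomology_class 2 X c) <#>\<^bsub>?G\<^esub> cohomology_class 2 X c"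
    by (simp add: numeral_2_eq_2 nat_pow_def cohomology_group_def FactGroup_def)
  also have "\<dots> = ?d ` ?E"
  proof
    show "(\<one>\<^bsub>cohomology_group 2 X\<^esub> <#>\<^bsub>?G\<^esub> cohomology_class 2 X c) <#>\<^bsub>?G\<^esub> cohomology_class 2 X c \<subseteq> ?d ` ?E"
    proof
      fix z assume "z \<in> (\<one>\<^bsub>cohomology_group 2 X\<^esub> <#>\<^bsub>?G\<^esub> cohomology_class 2 X c) <#>\<^bsub>?G\<^esub> cohomology_class 2 X c"
      then obtain e1 e2 e3 where z: "z = (\<lambda>\<sigma>\<in>?S. (\<lambda>\<sigma>\<in>?S. ?d e1 \<sigma> + (\<lambda>\<sigma>\<in>?S. ?d e2 \<sigma> + c \<sigma>) \<sigma>) \<sigma>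
          + (\<lambda>\<sigma>\<in>?S. ?d e3 \<sigma> + c \<sigma>) \<sigma>)"
        unfolding set_mult_def one cl cochain_mult by blast
      let ?e = "cochain_comb X 1 (cochain_comb X 1 (cochain_comb X 1 e1 1 e2) 1 e3) 1 d"
      have "z = ?d ?e"
      proof (rule extensionalityI[OF _ coboundary_ext])
        show "z \<in> extensional ?S" by (simp add: z)
        show "z \<sigma> = ?d ?e \<sigma>" if "\<sigma> \<in> ?S" for \<sigma>
          using that eq[of \<sigma>] by (simp add: z coboundary_comb)
      qed
      moreover have "?e \<in> ?E" by (simp add: cochain_comb_def)
      ultimately show "z \<in> ?d ` ?E" by blast
    qed
    show "?d ` ?E \<subseteq> (\<one>\<^bsub>cohomology_group 2 X\<^esub> <#>\<^bsub>?G\<^esub> cohomology_class 2 X c) <#>\<^bsub>?G\<^esub> cohomology_class 2 X c"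
    proof
      fix z assume "z \<in> ?d ` ?E"
      then obtain e where e: "e \<in> ?E" "z = ?d e" by blast
      let ?f = "cochain_comb X 1 e (- 1) d" and ?o = "cochain_comb X 0 d 0 d"
      have "z = (\<lambda>\<sigma>\<in>?S. (\<lambda>\<sigma>\<in>?S. ?d ?f \<sigma> + (\<lambda>\<sigma>\<in>?S. ?d ?o \<sigma> + c \<sigma>) \<sigma>) \<sigma> + (\<lambda>\<sigma>\<in>?S. ?d ?o \<sigma> + c \<sigma>) \<sigma>)" (is "_ = ?w")
      proof (rule extensionalityI[where A = ?S])
        show "z \<in> extensional ?S" unfolding e(2) by (rule coboundary_ext)
        show "z \<sigma> = ?w \<sigma>" if "\<sigma> \<in> ?S" for \<sigma>
          using that eq[of \<sigma>] by (simp add: e(2) coboundary_comb)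
      qed simp
      moreover have "?f \<in> ?E" "?o \<in> ?E" by (simp_all add: cochain_comb_def)
      ultimately show "z \<in> (\<one>\<^bsub>cohomology_group 2 X\<^esub> <#>\<^bsub>?G\<^esub> cohomology_class 2 X c) <#>\<^bsub>?G\<^esub> cohomology_class 2 X c"
        unfolding set_mult_def one cl cochain_mult by blast
    qed
  qed
  finally show ?thesis using one by simp
qed

text \<open>Along every singular 1-simplex let a path in the punctured plane be given whose end points depend
  only on the vertices. Then the changes of the argument form an integral cochain up to the
  coboundary of a real 0-cochain, so their sums around 2-simplices form an integral coboundary.\<close>

lemma turns_coboundary:
  assumes nz: "\<And>\<tau>. singular_simplex 1 X \<tau> \<Longrightarrow> nz_path (\<gamma> \<tau>)"
    and ends: "\<And>\<tau>. singular_simplex 1 X \<tau> \<Longrightarrow> \<gamma> \<tau> 0 = \<Phi> (\<tau> (edge_point 0))"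
      "\<And>\<tau>. singular_simplex 1 X \<tau> \<Longrightarrow> \<gamma> \<tau> 1 = \<Phi> (\<tau> (edge_point 1))"
  shows "\<exists>d\<in>carrier (cochain_group 1 X). \<forall>\<sigma>. singular_simplex 2 X \<sigma> \<longrightarrow>
    of_int (coboundary 1 X d \<sigma>) = boundary_sum (\<lambda>k. turns (\<gamma> (singular_face 2 k \<sigma>)))"
proof -
  let ?a = "\<lambda>x. Im (Ln (\<Phi> x)) / (2 * pi)"
  have "\<forall>\<tau>. \<exists>m::int. singular_simplex 1 X \<tau> \<longrightarrow>
      turns (\<gamma> \<tau>) = of_int m + (?a (\<tau> (edge_point 1)) - ?a (\<tau> (edge_point 0)))"
    using turns_integer_part[OF nz] ends by (auto simp: diff_divide_distrib)
  then obtain m where m: "\<And>\<tau>. singular_simplex 1 X \<tau> \<Longrightarrow>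
      turns (\<gamma> \<tau>) = of_int (m \<tau>) + (?a (\<tau> (edge_point 1)) - ?a (\<tau> (edge_point 0)))"
    by metis
  define d where "d = (\<lambda>\<tau>\<in>singular_simplex_set 1 X. m \<tau>)"
  have "of_int (coboundary 1 X d \<sigma>) = boundary_sum (\<lambda>k. turns (\<gamma> (singular_face 2 k \<sigma>)))"
    if \<sigma>: "singular_simplex 2 X \<sigma>" for \<sigma>
  proof -
    have s: "singular_simplex 1 X (singular_face 2 k \<sigma>)" if "k \<le> 2" for k
      by (rule coboundary_face_simplex[OF \<sigma> that])
    have v: "singular_face 2 k \<sigma> (edge_point t) = \<sigma> (triangle_point (triangle_face k t))"
      if "k \<le> 2" "t \<in> {0..1}" for k t
      using that edge_point_in by (simp add: singular_face_def triangle_point_face)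
    show ?thesis
      using m[OF s[of 0]] m[OF s[of 1]] m[OF s[of 2]] s
      by (simp add: coboundary_at[OF \<sigma>] boundary_sum_def d_def v triangle_face_def)
  qed
  then show ?thesis by (intro bexI[of _ d]) (auto simp: d_def cochain_carrier)
qed

declare One_nat_def [simp]


section \<open>The contact planes as complex lines\<close>

text \<open>The sign \<open>\<epsilon>\<close> compares the given orientation of the planes with that by \<open>d\<alpha>\<close>: two contact forms with the same
  kernel may induce opposite coorientations.\<close>

locale oriented_contact_metric = contact_metric A n F E \<mu> \<alpha> \<theta> J g
  for A :: "'a::t2_space atlas3" and n F E \<mu> \<alpha> \<theta> J g +
  fixes \<xi> :: "'a oriented_plane_field" and \<epsilon> :: real
  assumes \<epsilon>: "\<epsilon> = 1 \<or> \<epsilon> = - 1"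
    and plane: "plane \<xi> p = ker_form A \<alpha> p"
    and frames: "(u, v) \<in> positive_frames \<xi> p \<longleftrightarrow>
      u \<in> ker_form A \<alpha> p \<and> v \<in> ker_form A \<alpha> p \<and> \<epsilon> * ext_deriv A \<alpha> p u v > 0"
begin

lemma \<epsilon>_cancel: "\<epsilon> * (\<epsilon> * x) = x"
  using \<epsilon> by auto

definition I :: "'a \<Rightarrow> 'a tvec \<Rightarrow> 'a tvec" where
  "I p u = (\<lambda>f. \<epsilon> * JJ p u f)"

text \<open>The Hermitian product of the complex line. Its argument is the oriented angle from \<open>u\<close> to \<open>v\<close>, since
  \<open>|u|\<^sup>2 v\<close> is the complex multiple \<open>h(u, v) u\<close> (\<open>h_expand\<close>).\<close>

definition h :: "'a \<Rightarrow> 'a tvec \<Rightarrow> 'a tvec \<Rightarrow> complex" where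
  "h p u v = Complex (g p v u) (g p v (I p u))"

definition cscale :: "'a \<Rightarrow> complex \<Rightarrow> 'a tvec \<Rightarrow> 'a tvec" where
  "cscale p a v = (\<lambda>f. Re a * v f + Im a * I p v f)"

lemma I_K: "u \<in> K p \<Longrightarrow> I p u \<in> K p"
  unfolding I_def by (intro K_scale JJ_K K_T)

lemma I_I: "u \<in> K p \<Longrightarrow> I p (I p u) = (\<lambda>f. - u f)"
  unfolding I_def by (simp add: JJ_scale JJ_T K_T JJ_JJ \<epsilon>_cancel)

lemma g_I_skew: "u \<in> K p \<Longrightarrow> v \<in> K p \<Longrightarrow> g p (I p u) v = - g p u (I p v)"
  unfolding I_def
  by (simp add: linear_at_scale[OF g_left] linear_at_scale[OF g_right] JJ_T K_T g_JJ_skew)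

lemma g_I_I: "u \<in> K p \<Longrightarrow> v \<in> K p \<Longrightarrow> g p (I p u) (I p v) = g p u v"
  by (simp add: g_I_skew I_K I_I linear_at_minus[OF g_right] K_T)

lemma cscale_K: "v \<in> K p \<Longrightarrow> cscale p a v \<in> K p"
  unfolding cscale_def by (intro K_combine I_K)

lemma h_cscale: "u \<in> K p \<Longrightarrow> v \<in> K p \<Longrightarrow> h p u (cscale p a v) = a * h p u v"
  unfolding h_def cscale_def
  by (simp add: linear_at_lincomb[OF g_left] K_T I_K g_I_I g_I_skew I_I linear_at_minus[OF g_right] complex_eq_iff)

lemma h_real_comb: "u \<in> K p \<Longrightarrow> v \<in> K p \<Longrightarrow> w \<in> K p \<Longrightarrow>
    h p u (\<lambda>f. a * v f + b * w f) = of_real a * h p u v + of_real b * h p u w"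
  unfolding h_def by (simp add: linear_at_lincomb[OF g_left] K_T I_K complex_eq_iff)

lemma h_self: "u \<in> K p \<Longrightarrow> h p u u = of_real (g p u u)"
  using g_I_skew[of u p u] g_sym[of u p "I p u"] by (simp add: h_def complex_eq_iff K_T I_K)

lemma h_cnj: "u \<in> K p \<Longrightarrow> v \<in> K p \<Longrightarrow> h p v u = cnj (h p u v)"
  using g_I_skew[of v p u] g_sym[of v p u] g_sym[of v p "I p u"] g_sym[of u p "I p v"] g_I_skew[of u p v]
  by (simp add: h_def complex_eq_iff K_T I_K)

lemma h_expand:
  assumes "u \<in> K p" "v \<in> K p"
  shows "(\<lambda>f. g p u u * v f) = cscale p (h p u v) u"
proof -
  have sym: "g p v u = g p u v" "g p v (JJ p u) = g p (JJ p u) v"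
    using assms by (simp_all add: g_sym JJ_T K_T)
  have e: "g p v (\<lambda>f. \<epsilon> * JJ p u f) = \<epsilon> * g p (JJ p u) v"
    unfolding sym(2)[symmetric] by (rule linear_at_scale[OF g_right]) (intro JJ_T K_T assms)+
  have c: "(\<epsilon> * x) * (\<epsilon> * y) = x * y" for x y using \<epsilon> by auto
  show ?thesis
    unfolding plane_expansion[OF assms] cscale_def h_def I_def complex.sel e sym(1) c ..
qed

lemma h_mult:
  assumes u: "u \<in> K p" and v: "v \<in> K p" and w: "w \<in> K p"
  shows "h p u v * h p v w = of_real (g p v v) * h p u w"
proof -
  have "h p v w * h p u v = h p u (\<lambda>f. g p v v * w f)"
    unfolding h_expand[OF v w] by (rule h_cscale[OF u v, symmetric])
  also have "\<dots> = of_real (g p v v) * h p u w"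
    using h_real_comb[OF u w w, of "g p v v" 0] by simp
  finally show ?thesis by (simp add: mult.commute)
qed

lemma g_self_pos: "u \<in> K p \<Longrightarrow> u \<noteq> zero_tvec \<Longrightarrow> g p u u > 0"
  by (rule g_pos[OF K_T])

lemma h_nonzero:
  assumes u: "u \<in> K p" "u \<noteq> zero_tvec" and v: "v \<in> K p" "v \<noteq> zero_tvec"
  shows "h p u v \<noteq> 0"
proof
  assume "h p u v = 0"
  then have "(\<lambda>f. g p u u * v f) = (\<lambda>f. 0)" using h_expand[OF u(1) v(1)] by (simp add: cscale_def)
  then have "v = zero_tvec" using g_self_pos[OF u] by (auto simp: fun_eq_iff zero_tvec_def)
  with v(2) show False by simp
qed

lemma zero_K: "zero_tvec \<in> K p"
  by (simp add: K_iff zero_tvec_def T_zero linear_at_zero[OF \<alpha>_linear])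

lemma h_zero: "u \<in> K p \<Longrightarrow> h p u zero_tvec = 0"
  using h_real_comb[of u p u u 0 0] by (simp add: zero_tvec_def)

lemma cscale_nonzero:
  assumes "v \<in> K p" "v \<noteq> zero_tvec" "a \<noteq> 0"
  shows "cscale p a v \<noteq> zero_tvec"
proof
  assume "cscale p a v = zero_tvec"
  then have "a * h p v v = 0" using h_cscale[OF assms(1,1), of a] h_zero[OF assms(1)] by simp
  then show False using assms(3) h_nonzero[OF assms(1,2,1,2)] by simp
qed

text \<open>The quadratic map given by the antilinear map \<open>P\<close>: it transforms by \<open>cnj \<zeta>\<^sup>2\<close> under multiplication of its
  argument by \<open>\<zeta>\<close>, so it trivialises the square of the line bundle wherever \<open>P\<close> does not vanish.\<close>

definition q :: "'a \<Rightarrow> 'a tvec \<Rightarrow> complex" where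
  "q p w = h p w (P p w)"

lemma P_cscale:
  assumes "w \<in> K p" shows "P p (cscale p a w) = cscale p (cnj a) (P p w)"
proof -
  have s: "P p (\<lambda>f. \<epsilon> * JJ p w f) = (\<lambda>f. \<epsilon> * P p (JJ p w) f)"
    using P_linear[of p \<epsilon> "JJ p w" 0 w] by simp
  show ?thesis
    unfolding cscale_def P_linear I_def s P_JJ[OF assms] by simp
qed

lemma q_transform:
  assumes u: "u \<in> K p" and v: "v \<in> K p"
  shows "h p u v * (of_real (g p u u) * q p v) = cnj (h p u v) * (of_real (g p v v) * q p u)"
proof -
  let ?H = "h p u v"
  have Pu: "P p u \<in> K p" and Pv: "P p v \<in> K p" using P_K u v by auto
  have "(\<lambda>f. g p u u * P p v f) = P p (\<lambda>f. g p u u * v f)"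
    using P_linear[of p "g p u u" v 0 v] by simp
  also have "\<dots> = cscale p (cnj ?H) (P p u)"
    unfolding h_expand[OF u v] by (rule P_cscale[OF u])
  finally have "h p v (\<lambda>f. g p u u * P p v f) = cnj ?H * h p v (P p u)"
    by (simp add: h_cscale[OF v Pu])
  then have 1: "of_real (g p u u) * q p v = cnj ?H * h p v (P p u)"
    using h_real_comb[OF v Pv Pv, of "g p u u" 0] by (simp add: q_def)
  have 2: "?H * h p v (P p u) = of_real (g p v v) * q p u"
    using h_mult[OF u v Pu] by (simp add: q_def)
  show ?thesis unfolding 1 by (simp add: 2[symmetric])
qed

subsection \<open>Sections along maps\<close>

text \<open>Continuous sections of the contact planes along a map. Continuity is tested on smooth functions; it passes to
  inner products and to the images under bundle maps through the expansion of the vectors in the frame.\<close>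

definition sec :: "'c::topological_space set \<Rightarrow> ('c \<Rightarrow> 'a) \<Rightarrow> ('c \<Rightarrow> 'a tvec) \<Rightarrow> bool" where
  "sec S \<phi> w \<longleftrightarrow> continuous_on S \<phi> \<and> (\<forall>f\<in>C. continuous_on S (\<lambda>x. w x f)) \<and> (\<forall>x\<in>S. w x \<in> K (\<phi> x))"

definition nz_sec :: "'c::topological_space set \<Rightarrow> ('c \<Rightarrow> 'a) \<Rightarrow> ('c \<Rightarrow> 'a tvec) \<Rightarrow> bool" where
  "nz_sec S \<phi> w \<longleftrightarrow> sec S \<phi> w \<and> (\<forall>x\<in>S. w x \<noteq> zero_tvec)"

lemma secD: "sec S \<phi> w \<Longrightarrow> continuous_on S \<phi>" "sec S \<phi> w \<Longrightarrow> f \<in> C \<Longrightarrow> continuous_on S (\<lambda>x. w x f)"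
  "sec S \<phi> w \<Longrightarrow> x \<in> S \<Longrightarrow> w x \<in> K (\<phi> x)"
  by (auto simp: sec_def)

lemma nz_secD: "nz_sec S \<phi> w \<Longrightarrow> sec S \<phi> w" "nz_sec S \<phi> w \<Longrightarrow> x \<in> S \<Longrightarrow> w x \<in> K (\<phi> x)"
  "nz_sec S \<phi> w \<Longrightarrow> x \<in> S \<Longrightarrow> w x \<noteq> zero_tvec"
  by (auto simp: nz_sec_def sec_def)

lemma C_along: "f \<in> C \<Longrightarrow> continuous_on S \<phi> \<Longrightarrow> continuous_on S (\<lambda>x. f (\<phi> x))"
  by (rule continuous_on_compose2[OF C_continuous]) auto

lemma sec_combination:
  assumes w: "sec S \<phi> w" and B: "\<And>k. VF (B k)" "\<And>k p. B k p \<in> K p"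
  shows "sec S \<phi> (\<lambda>x f. \<Sum>k<n. w x (F k) * B k (\<phi> x) f)"
  unfolding sec_def
proof (intro conjI ballI)
  show "continuous_on S \<phi>" by (rule secD(1)[OF w])
  show "continuous_on S (\<lambda>x. \<Sum>k<n. w x (F k) * B k (\<phi> x) f)" if "f \<in> C" for f
    by (intro continuous_on_sum continuous_on_mult secD(2)[OF w F_C] C_along[OF VF_C[OF B(1) that]] secD(1)[OF w])
  fix x assume "x \<in> S"
  have K_sum: "(\<lambda>f. \<Sum>k\<in>L. c k * B k p f) \<in> K p" for c p and L :: "nat set"
    unfolding K_iff
  proof
    show "(\<lambda>f. \<Sum>k\<in>L. c k * B k p f) \<in> T p" by (rule T_sum_closed[OF K_T[OF B(2)]])
    show "\<alpha> p (\<lambda>f. \<Sum>k\<in>L. c k * B k p f) = 0"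
      using B(2) by (subst linear_at_sum[OF \<alpha>_linear K_T[OF B(2)]]) (simp add: K_iff)
  qed
  then show "(\<lambda>f. \<Sum>k<n. w x (F k) * B k (\<phi> x) f) \<in> K (\<phi> x)" .
qed

lemma sec_cong: "sec S \<phi> w \<Longrightarrow> (\<And>x. x \<in> S \<Longrightarrow> w x = w' x) \<Longrightarrow> sec S \<phi> w'"
  by (auto simp: sec_def cong: continuous_on_cong)

lemma sec_Y: "continuous_on S \<phi> \<Longrightarrow> sec S \<phi> (\<lambda>x. Y k (\<phi> x))"
  unfolding sec_def using C_along[OF VF_C[OF Y_VF]] Y_K by blast

lemma JJ_sum:
  assumes "\<And>k. k \<in> L \<Longrightarrow> v k \<in> T p"
  shows "JJ p (\<lambda>f. \<Sum>k\<in>L. c k * v k f) = (\<lambda>f. \<Sum>k\<in>L. c k * JJ p (v k) f)"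
  using assms
proof (induction L rule: infinite_finite_induct)
  case (insert k L)
  have "JJ p (\<lambda>f. \<Sum>k\<in>insert k L. c k * v k f) = JJ p (\<lambda>f. c k * v k f + 1 * (\<Sum>k\<in>L. c k * v k f))"
    using insert by simp
  also have "\<dots> = (\<lambda>f. c k * JJ p (v k) f + 1 * JJ p (\<lambda>f. \<Sum>k\<in>L. c k * v k f) f)"
    by (rule JJ_linear) (use insert in \<open>auto intro: T_sum_closed\<close>)
  finally show ?case using insert by simp
qed (simp_all add: JJ_zero)

lemma sec_I:
  assumes "sec S \<phi> w" shows "sec S \<phi> (\<lambda>x. I (\<phi> x) (w x))"
proof (rule sec_cong)
  show "sec S \<phi> (\<lambda>x f. \<Sum>k<n. w x (F k) * (\<lambda>k p f. \<epsilon> * JJ p (Y k p) f) k (\<phi> x) f)"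
    by (rule sec_combination[OF assms])
       (rule VF_scale[OF C_const JJ_VF[OF Y_VF]], rule K_scale[OF JJ_K[OF K_T[OF Y_K]]])
  fix x assume "x \<in> S"
  then have w: "w x = (\<lambda>f. \<Sum>k<n. w x (F k) * Y k (\<phi> x) f)"
    by (intro K_expand secD(3)[OF assms])
  have "JJ (\<phi> x) (w x) = JJ (\<phi> x) (\<lambda>f. \<Sum>k<n. w x (F k) * Y k (\<phi> x) f)" using w by (rule arg_cong)
  also have "\<dots> = (\<lambda>f. \<Sum>k<n. w x (F k) * JJ (\<phi> x) (Y k (\<phi> x)) f)"
    by (rule JJ_sum[OF K_T[OF Y_K]])
  finally show "(\<lambda>f. \<Sum>k<n. w x (F k) * (\<lambda>k p f. \<epsilon> * JJ p (Y k p) f) k (\<phi> x) f) = I (\<phi> x) (w x)"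
    unfolding I_def by (simp add: sum_distrib_left mult_ac)
qed

lemma sec_P: assumes "sec S \<phi> w" shows "sec S \<phi> (\<lambda>x. P (\<phi> x) (w x))"
  unfolding P_def
  by (rule sec_combination[OF assms LJ_VF[OF Y_VF] K_field_K[OF LJ_K[OF K_field_Y]]])

lemma sec_g:
  assumes u: "sec S \<phi> u" and v: "sec S \<phi> v"
  shows "continuous_on S (\<lambda>x. g (\<phi> x) (u x) (v x))"
proof -
  have "continuous_on S (\<lambda>x. \<Sum>i<n. u x (F i) * (\<Sum>j<n. v x (F j) * gf (Y i) (Y j) (\<phi> x)))"
    by (intro continuous_on_sum continuous_on_mult secD(2)[OF u F_C] secD(2)[OF v F_C]
        C_along[OF gf_C[OF Y_VF Y_VF]] secD(1)[OF u])
  moreover have "g (\<phi> x) (u x) (v x) = (\<Sum>i<n. u x (F i) * (\<Sum>j<n. v x (F j) * gf (Y i) (Y j) (\<phi> x)))"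
    if x: "x \<in> S" for x
  proof -
    let ?p = "\<phi> x"
    note uK = secD(3)[OF u x] and vK = secD(3)[OF v x]
    have "g ?p (u x) (v x) = g ?p (\<lambda>f. \<Sum>k<n. u x (F k) * Y k ?p f) (v x)"
      using K_expand[OF uK] by (rule arg_cong)
    also have "\<dots> = (\<Sum>i<n. u x (F i) * g ?p (Y i ?p) (v x))"
      by (rule linear_at_sum[OF g_left[OF K_T[OF vK]] K_T[OF Y_K]])
    also have "\<dots> = (\<Sum>i<n. u x (F i) * (\<Sum>j<n. v x (F j) * gf (Y i) (Y j) ?p))"
    proof (intro sum.cong refl arg_cong2[where f = "(*)"])
      fix i
      have "g ?p (Y i ?p) (v x) = g ?p (Y i ?p) (\<lambda>f. \<Sum>k<n. v x (F k) * Y k ?p f)"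
        using K_expand[OF vK] by (rule arg_cong)
      also have "\<dots> = (\<Sum>j<n. v x (F j) * g ?p (Y i ?p) (Y j ?p))"
        by (rule linear_at_sum[OF g_right[OF K_T[OF Y_K]] K_T[OF Y_K]])
      finally show "g ?p (Y i ?p) (v x) = (\<Sum>j<n. v x (F j) * gf (Y i) (Y j) ?p)" by (simp add: gf_def)
    qed
    finally show ?thesis .
  qed
  ultimately show ?thesis by (simp cong: continuous_on_cong)
qed

lemma sec_h:
  assumes "sec S \<phi> u" "sec S \<phi> v"
  shows "continuous_on S (\<lambda>x. h (\<phi> x) (u x) (v x))"
  unfolding h_def Complex_eq
  by (intro continuous_intros sec_g sec_I assms)

lemma sec_q: "sec S \<phi> w \<Longrightarrow> continuous_on S (\<lambda>x. q (\<phi> x) (w x))"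
  unfolding q_def by (intro sec_h sec_P)

lemma sec_cscale:
  assumes w: "sec S \<phi> w" and a: "continuous_on S a"
  shows "sec S \<phi> (\<lambda>x. cscale (\<phi> x) (a x) (w x))"
  using secD(2)[OF w] secD(2)[OF sec_I[OF w]] secD(1,3)[OF w] a
  by (auto simp: sec_def cscale_def intro!: continuous_intros K_combine I_K)

lemma nz_sec_pullback:
  assumes "nz_sec S \<phi> w" "continuous_on S' k" "k ` S' \<subseteq> S"
  shows "nz_sec S' (\<lambda>x. \<phi> (k x)) (\<lambda>x. w (k x))"
  using assms unfolding nz_sec_def sec_def
  by (auto intro!: continuous_on_compose2[of S _ S' k])

lemma nz_path_h:
  assumes "nz_sec {0..1} \<phi> u" "nz_sec {0..1} \<phi> v"
  shows "nz_path (\<lambda>t. h (\<phi> t) (u t) (v t))"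
  unfolding nz_path_def
  using sec_h[OF nz_secD(1)[OF assms(1)] nz_secD(1)[OF assms(2)]]
    h_nonzero[OF nz_secD(2,3)[OF assms(1)] nz_secD(2,3)[OF assms(2)]] by blast

lemma nz_path_g:
  assumes "nz_sec {0..1} \<phi> u"
  shows "nz_path (\<lambda>t. complex_of_real (g (\<phi> t) (u t) (u t)))" "turns (\<lambda>t. complex_of_real (g (\<phi> t) (u t) (u t))) = 0"
  by (rule nz_path_pos turns_pos; (rule sec_g | rule g_self_pos); use nz_secD[OF assms] in blast)+

lemma turns_h_mult:
  assumes u: "nz_sec {0..1} \<phi> u" and v: "nz_sec {0..1} \<phi> v" and w: "nz_sec {0..1} \<phi> w"
  shows "turns (\<lambda>t. h (\<phi> t) (u t) (w t)) = turns (\<lambda>t. h (\<phi> t) (u t) (v t)) + turns (\<lambda>t. h (\<phi> t) (v t) (w t))"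
proof -
  have "turns (\<lambda>t. h (\<phi> t) (u t) (v t)) + turns (\<lambda>t. h (\<phi> t) (v t) (w t)) =
      turns (\<lambda>t. h (\<phi> t) (u t) (v t) * h (\<phi> t) (v t) (w t))"
    by (rule turns_mult[symmetric]) (intro nz_path_h u v w)+
  also have "\<dots> = turns (\<lambda>t. complex_of_real (g (\<phi> t) (v t) (v t)) * h (\<phi> t) (u t) (w t))"
    by (rule turns_cong) (intro h_mult nz_secD(2)[OF u] nz_secD(2)[OF v] nz_secD(2)[OF w])
  also have "\<dots> = turns (\<lambda>t. complex_of_real (g (\<phi> t) (v t) (v t))) + turns (\<lambda>t. h (\<phi> t) (u t) (w t))"
    by (rule turns_mult) (intro nz_path_h nz_path_g u v w)+
  finally show ?thesis using nz_path_g(2)[OF v] by simp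
qed

text \<open>Relative to \<open>u\<close>, the section \<open>v\<close> turns by the angle of \<open>h(u, v)\<close>, and \<open>q\<close> turns by \<open>-2\<close> times that angle.\<close>

lemma turns_q:
  assumes u: "nz_sec {0..1} \<phi> u" and v: "nz_sec {0..1} \<phi> v"
    and nz: "\<And>p w. w \<in> K p \<Longrightarrow> w \<noteq> zero_tvec \<Longrightarrow> q p w \<noteq> 0"
  shows "turns (\<lambda>t. q (\<phi> t) (v t)) = turns (\<lambda>t. q (\<phi> t) (u t)) - 2 * turns (\<lambda>t. h (\<phi> t) (u t) (v t))"
proof -
  have qp: "nz_path (\<lambda>t. q (\<phi> t) (w t))" if w: "nz_sec {0..1} \<phi> w" for w
    unfolding nz_path_def using sec_q[OF nz_secD(1)[OF w]] nz[OF nz_secD(2,3)[OF w]] by blast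
  let ?H = "\<lambda>t. h (\<phi> t) (u t) (v t)"
  let ?gu = "\<lambda>t. complex_of_real (g (\<phi> t) (u t) (u t))" and ?gv = "\<lambda>t. complex_of_real (g (\<phi> t) (v t) (v t))"
  note H = nz_path_h[OF u v] and gu = nz_path_g(1)[OF u] and gv = nz_path_g(1)[OF v]
  have "turns (\<lambda>t. ?H t * (?gu t * q (\<phi> t) (v t))) = turns (\<lambda>t. cnj (?H t) * (?gv t * q (\<phi> t) (u t)))"
    by (rule turns_cong) (intro q_transform nz_secD(2)[OF u] nz_secD(2)[OF v])
  moreover have "turns (\<lambda>t. ?H t * (?gu t * q (\<phi> t) (v t))) = turns ?H + (turns ?gu + turns (\<lambda>t. q (\<phi> t) (v t)))"
    using turns_mult[OF H nz_path_mult[OF gu qp[OF v]]] turns_mult[OF gu qp[OF v]] by simp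
  moreover have "turns (\<lambda>t. cnj (?H t) * (?gv t * q (\<phi> t) (u t))) =
      turns (\<lambda>t. cnj (?H t)) + (turns ?gv + turns (\<lambda>t. q (\<phi> t) (u t)))"
    using turns_mult[OF nz_path_cnj[OF H] nz_path_mult[OF gv qp[OF u]]] turns_mult[OF gv qp[OF u]] by simp
  ultimately show ?thesis
    using turns_cnj[OF H] nz_path_g(2)[OF u] nz_path_g(2)[OF v] by simp
qed

subsection \<open>Coordinates in a positive frame\<close>

lemma frame_Im_pos:
  assumes "(u, v) \<in> positive_frames \<xi> p"
  shows "u \<in> K p" "v \<in> K p" "Im (h p u v) > 0" "u \<noteq> zero_tvec"
proof -
  show u: "u \<in> K p" and v: "v \<in> K p" using assms by (simp_all add: frames)
  have "d\<alpha> p v u = - \<theta> * g p v (JJ p u)" by (rule d\<alpha>_g[OF K_T[OF v] u])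
  then have "d\<alpha> p u v = \<theta> * g p v (JJ p u)" using d\<alpha>_antisym[OF K_T[OF u] K_T[OF v]] by simp
  then have "\<epsilon> * d\<alpha> p u v = \<theta> * Im (h p u v)"
    using u v by (simp add: h_def I_def linear_at_scale[OF g_right] K_T JJ_T)
  then show i: "Im (h p u v) > 0" using assms \<theta>_pos by (simp add: frames zero_less_mult_iff)
  show "u \<noteq> zero_tvec"
  proof
    assume "u = zero_tvec"
    then have "h p u v = 0" using h_cnj[OF v u] h_zero[OF v] by simp
    then show False using i by simp
  qed
qed

lemma positive_frameI:
  assumes "u \<in> K p" "u \<noteq> zero_tvec" shows "(u, I p u) \<in> positive_frames \<xi> p"
proof -
  have "\<epsilon> * d\<alpha> p u (I p u) = \<theta> * g p u u"
    unfolding I_def using assms g_K[OF K_T[OF assms(1)] assms(1)]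
    by (simp add: linear_at_scale[OF d\<alpha>_right] JJ_T K_T \<epsilon>_cancel)
  then show ?thesis using assms g_self_pos[OF assms] \<theta>_pos by (simp add: frames I_K)
qed

text \<open>Cramer's rule.\<close>

definition frame_coord :: "'a \<Rightarrow> 'a tvec \<Rightarrow> 'a tvec \<Rightarrow> 'a tvec \<Rightarrow> complex" where
  "frame_coord p u v w = (let y = Im (h p u w) / Im (h p u v)
     in Complex ((Re (h p u w) - y * Re (h p u v)) / g p u u) y)"

lemma frame_coordinate_eq:
  assumes fr: "(u, v) \<in> positive_frames \<xi> p" and w: "w \<in> K p"
  shows "frame_coordinate u v w = frame_coord p u v w"
    and "h p u w = of_real (Re (frame_coord p u v w)) * of_real (g p u u) + of_real (Im (frame_coord p u v w)) * h p u v"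
proof -
  note u = frame_Im_pos(1)[OF fr] and v = frame_Im_pos(2)[OF fr] and i = frame_Im_pos(3)[OF fr]
  have gp: "g p u u > 0" by (rule g_self_pos[OF u frame_Im_pos(4)[OF fr]])
  let ?z = "frame_coord p u v w"
  show e: "h p u w = of_real (Re ?z) * of_real (g p u u) + of_real (Im ?z) * h p u v"
    using i gp by (simp add: complex_eq_iff frame_coord_def Let_def)
  have hl: "h p u (lincomb a u b v) = of_real a * of_real (g p u u) + of_real b * h p u v" for a b
    using h_real_comb[OF u u v, of a b] by (simp add: lincomb_def h_self[OF u])
  have lK: "lincomb a u b v \<in> K p" for a b using K_combine[OF u v] by (simp add: lincomb_def)
  show "frame_coordinate u v w = ?z"
    unfolding frame_coordinate_def
  proof (rule the_equality)
    let ?l = "lincomb (Re ?z) u (Im ?z) v"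
    have "h p u (\<lambda>f. 1 * w f + - 1 * ?l f) = 0"
      by (subst h_real_comb[OF u w lK]) (simp add: hl e[symmetric])
    moreover have "(\<lambda>f. 1 * w f + - 1 * ?l f) \<in> K p" by (rule K_combine[OF w lK])
    ultimately have "(\<lambda>f. 1 * w f + - 1 * ?l f) = zero_tvec"
      using h_nonzero[OF u frame_Im_pos(4)[OF fr]] by blast
    then show "w = ?l" by (auto simp: fun_eq_iff zero_tvec_def)
  next
    fix z assume "w = lincomb (Re z) u (Im z) v"
    then have "of_real (Re z) * of_real (g p u u) + of_real (Im z) * h p u v =
        of_real (Re ?z) * of_real (g p u u) + of_real (Im ?z) * h p u v" using hl e by simp
    then have *: "Im z * Im (h p u v) = Im ?z * Im (h p u v)"
      "Re z * g p u u + Im z * Re (h p u v) = Re ?z * g p u u + Im ?z * Re (h p u v)"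
      by (simp_all add: complex_eq_iff)
    then have "Im z = Im ?z" using i by simp
    then show "z = ?z" using * gp by (simp add: complex_eq_iff)
  qed
qed

lemma frame_coord_nonzero:
  assumes fr: "(u, v) \<in> positive_frames \<xi> p" and w: "w \<in> K p" "w \<noteq> zero_tvec"
  shows "frame_coord p u v w \<noteq> 0"
  using frame_coordinate_eq(2)[OF fr w(1)] h_nonzero[OF frame_Im_pos(1,4)[OF fr] w] by auto

text \<open>Passing from the coordinate in a positive frame \<open>u, v\<close> to that in \<open>u, I u\<close> never turns a vector into an
  opposite direction, so the ratio of the two coordinates has a globally defined argument.\<close>

lemma frame_ratio:
  assumes fr: "(u, v) \<in> positive_frames \<xi> p" and w: "w \<in> K p" "w \<noteq> zero_tvec"
  shows "h p u w / frame_coord p u v w \<notin> \<real>\<^sub>\<le>\<^sub>0"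
proof
  let ?z = "frame_coord p u v w"
  assume "h p u w / ?z \<in> \<real>\<^sub>\<le>\<^sub>0"
  then obtain r where r: "h p u w / ?z = of_real r" "r \<le> 0" by (auto elim!: nonpos_Reals_cases)
  have z: "?z \<noteq> 0" by (rule frame_coord_nonzero[OF fr w])
  have gp: "g p u u > 0" by (rule g_self_pos[OF frame_Im_pos(1,4)[OF fr]])
  have "h p u w = of_real r * ?z" using r(1) z by (simp add: field_simps)
  then have *: "Im ?z * Im (h p u v) = r * Im ?z" "Re ?z * g p u u + Im ?z * Re (h p u v) = r * Re ?z"
    using frame_coordinate_eq(2)[OF fr w(1)] by (simp_all add: complex_eq_iff)
  then have "Im ?z * (Im (h p u v) - r) = 0" by (simp add: algebra_simps)
  then have i: "Im ?z = 0" using frame_Im_pos(3)[OF fr] r(2) by simp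
  then have "Re ?z * (g p u u - r) = 0" using *(2) by (simp add: algebra_simps)
  then have "Re ?z = 0" using gp r(2) by simp
  with i z show False by (simp add: complex_eq_iff)
qed

end


context oriented_contact_metric
begin

section \<open>Nowhere vanishing sections over simplices\<close>

lemma K_sum: "(\<And>k. k \<in> L \<Longrightarrow> v k \<in> K p) \<Longrightarrow> (\<lambda>f. \<Sum>k\<in>L. v k f) \<in> K p"
  and h_sum: "(\<And>k. k \<in> L \<Longrightarrow> v k \<in> K p) \<Longrightarrow> u \<in> K p \<Longrightarrow> h p u (\<lambda>f. \<Sum>k\<in>L. v k f) = (\<Sum>k\<in>L. h p u (v k))"
proof (induction L rule: infinite_finite_induct)
  case (insert k L)
  {
    case 1
    then show ?case using insert K_combine[of "v k" p "\<lambda>f. \<Sum>k\<in>L. v k f" 1 1] by simp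
  next
    case 2
    then show ?case using insert h_real_comb[of u p "v k" "\<lambda>f. \<Sum>k\<in>L. v k f" 1 1] by simp
  }
qed (use zero_K h_zero in \<open>simp_all add: zero_tvec_def\<close>)

text \<open>Transport from the plane at \<open>p\<close> to the plane at \<open>p'\<close> through the trivial bundle spanned by the fields
  \<open>Y k\<close>. It is complex linear, and \<open>kappa p p'\<close> is the squared modulus of its
  coefficient with respect to unit vectors.\<close>

definition transport :: "'a \<Rightarrow> 'a \<Rightarrow> 'a tvec \<Rightarrow> 'a tvec" where
  "transport p p' v = (\<lambda>f. \<Sum>k<n. cscale p' (h p (Y k p) v) (Y k p') f)"

definition kappa :: "'a \<Rightarrow> 'a \<Rightarrow> complex" where
  "kappa p p' = (\<Sum>k<n. \<Sum>l<n. h p (Y k p) (Y l p) * h p' (Y l p') (Y k p'))"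

lemma transport_nonzero:
  assumes v: "v \<in> K p" "v \<noteq> zero_tvec" and k: "kappa p p' \<noteq> 0"
  shows "transport p p' v \<noteq> zero_tvec"
proof
  assume z: "transport p p' v = zero_tvec"
  let ?b = "\<lambda>k. h p (Y k p) v"
  have "(\<Sum>k<n. ?b k * h p' (Y l p') (Y k p')) = 0" for l
  proof -
    have "h p' (Y l p') (transport p p' v) = (\<Sum>k<n. ?b k * h p' (Y l p') (Y k p'))"
      unfolding transport_def by (subst h_sum) (simp_all add: cscale_K Y_K h_cscale)
    then show ?thesis unfolding z using h_zero[OF Y_K] by simp
  qed
  then have "0 = (\<Sum>l<n. cnj (?b l) * (\<Sum>k<n. ?b k * h p' (Y l p') (Y k p')))" by simp
  also have "\<dots> = (\<Sum>l<n. \<Sum>k<n. of_real (g p v v) * (h p (Y k p) (Y l p) * h p' (Y l p') (Y k p')))"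
    unfolding sum_distrib_left
  proof (intro sum.cong refl)
    fix l k
    have e: "?b k * cnj (?b l) = of_real (g p v v) * h p (Y k p) (Y l p)"
      using h_mult[OF Y_K[of k] v(1) Y_K[of l]] h_cnj[OF Y_K[of l] v(1)] by simp
    have "cnj (?b l) * (?b k * h p' (Y l p') (Y k p')) = (?b k * cnj (?b l)) * h p' (Y l p') (Y k p')"
      by (simp only: mult_ac)
    then show "cnj (?b l) * (?b k * h p' (Y l p') (Y k p')) =
        of_real (g p v v) * (h p (Y k p) (Y l p) * h p' (Y l p') (Y k p'))"
      unfolding e by (simp only: mult.assoc)
  qed
  also have "\<dots> = of_real (g p v v) * kappa p p'"
    unfolding kappa_def sum_distrib_left by (rule sum.swap)
  finally show False using k g_self_pos[OF v] by simp
qed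

text \<open>On the diagonal the double sum factorises into \<open>G(p)\<^sup>2\<close>.\<close>

lemma kappa_diagonal: "kappa p p \<noteq> 0"
proof -
  have "h p (Y k p) (Y l p) * h p (Y l p) (Y k p) = of_real (g p (Y k p) (Y k p) * g p (Y l p) (Y l p))" for k l
    using h_mult[OF Y_K[of k p] Y_K[of l p] Y_K[of k p]] by (simp add: h_self Y_K)
  then have "kappa p p = of_real (\<Sum>k<n. \<Sum>l<n. g p (Y k p) (Y k p) * g p (Y l p) (Y l p))"
    by (simp add: kappa_def)
  also have "(\<Sum>k<n. \<Sum>l<n. g p (Y k p) (Y k p) * g p (Y l p) (Y l p)) = G p * G p"
    unfolding G_def by (rule sum_product[symmetric])
  finally show ?thesis using G_pos[of p] by simp
qed

lemma sec_transport:
  assumes w: "sec S \<phi> w" and \<phi>': "continuous_on S \<phi>'"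
  shows "sec S \<phi>' (\<lambda>x. transport (\<phi> x) (\<phi>' x) (w x))"
  unfolding sec_def
proof (intro conjI ballI)
  have s: "sec S \<phi>' (\<lambda>x. cscale (\<phi>' x) (h (\<phi> x) (Y k (\<phi> x)) (w x)) (Y k (\<phi>' x)))" for k
    by (rule sec_cscale[OF sec_Y[OF \<phi>'] sec_h[OF sec_Y[OF secD(1)[OF w]] w]])
  show "continuous_on S \<phi>'" by (rule \<phi>')
  show "continuous_on S (\<lambda>x. transport (\<phi> x) (\<phi>' x) (w x) f)" if "f \<in> C" for f
    unfolding transport_def by (rule continuous_on_sum) (rule secD(2)[OF s that])
  show "transport (\<phi> x) (\<phi>' x) (w x) \<in> K (\<phi>' x)" for x
    unfolding transport_def by (rule K_sum) (rule cscale_K[OF Y_K])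
qed

lemma kappa_uniform:
  fixes S :: "'c::euclidean_space set"
  assumes S: "compact S" and \<phi>: "continuous_on S \<phi>"
  shows "\<exists>\<delta>>0. \<forall>x\<in>S. \<forall>y\<in>S. dist x y < \<delta> \<longrightarrow> kappa (\<phi> x) (\<phi> y) \<noteq> 0"
proof -
  let ?k = "\<lambda>z. kappa (\<phi> (fst z)) (\<phi> (snd z))"
  have h: "continuous_on S (\<lambda>x. h (\<phi> x) (Y k (\<phi> x)) (Y l (\<phi> x)))" for k l
    by (intro sec_h sec_Y \<phi>)
  have "continuous_on (S \<times> S) (\<lambda>z. h (\<phi> (fst z)) (Y k (\<phi> (fst z))) (Y l (\<phi> (fst z))))"
    "continuous_on (S \<times> S) (\<lambda>z. h (\<phi> (snd z)) (Y k (\<phi> (snd z))) (Y l (\<phi> (snd z))))" for k l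
    by (rule continuous_on_compose2[OF h]; auto intro!: continuous_intros)+
  then have cont: "continuous_on (S \<times> S) ?k"
    unfolding kappa_def by (intro continuous_on_sum continuous_on_mult)
  \<comment> \<open>The zeros form a compact set disjoint from the diagonal.\<close>
  define Z where "Z = (S \<times> S) \<inter> ?k -` {0}"
  have "closed Z"
    unfolding Z_def using S by (intro continuous_closed_preimage[OF cont] closed_Times compact_imp_closed) auto
  moreover have "bounded Z"
    unfolding Z_def using S by (intro bounded_subset[OF bounded_Times[of S S]]) (auto simp: compact_imp_bounded)
  ultimately have Z: "compact Z" by (simp add: compact_eq_bounded_closed)
  show ?thesis
  proof (cases "Z = {}")
    case True
    then show ?thesis by (intro exI[of _ 1]) (auto simp: Z_def)
  next
    case False
    have "continuous_on Z (\<lambda>z. dist (fst z) (snd z))" by (intro continuous_intros)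
    from continuous_attains_inf[OF Z False this] obtain z where z: "z \<in> Z"
      "\<And>y. y \<in> Z \<Longrightarrow> dist (fst z) (snd z) \<le> dist (fst y) (snd y)" by blast
    have "fst z \<noteq> snd z" using z(1) kappa_diagonal by (auto simp: Z_def)
    moreover have "kappa (\<phi> x) (\<phi> y) \<noteq> 0" if "x \<in> S" "y \<in> S" "dist x y < dist (fst z) (snd z)" for x y
      using z(2)[of "(x, y)"] that by (auto simp: Z_def)
    ultimately show ?thesis by (intro exI[of _ "dist (fst z) (snd z)"]) auto
  qed
qed

text \<open>A section over a convex compact set is obtained by transporting a vector from a base point along
  straight segments, in steps so small that no transport degenerates.\<close>

lemma section_exists:
  fixes S :: "'c::euclidean_space set"
  assumes S: "compact S" "convex S" "x0 \<in> S" and \<phi>: "continuous_on S \<phi>"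
  shows "\<exists>w. nz_sec S \<phi> w"
proof -
  obtain \<delta> where \<delta>: "\<delta> > 0" "\<And>x y. x \<in> S \<Longrightarrow> y \<in> S \<Longrightarrow> dist x y < \<delta> \<Longrightarrow> kappa (\<phi> x) (\<phi> y) \<noteq> 0"
    using kappa_uniform[OF S(1) \<phi>] by blast
  obtain B where B: "\<And>x. x \<in> S \<Longrightarrow> dist x0 x \<le> B"
    using compact_imp_bounded[OF S(1)] bounded_any_center[of S x0] by blast
  obtain N where N: "B < real N * \<delta>" "N > 0"
  proof -
    obtain M where "B < real M * \<delta>" using reals_Archimedean3[OF \<delta>(1)] by blast
    then have "B < real (Suc M) * \<delta>" using \<delta>(1) by (simp add: distrib_right)
    then show ?thesis using that by blast
  qed
  define pt where "pt = (\<lambda>j x. x0 + (real j / real N) *\<^sub>R (x - x0))"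
  have ptS: "pt j x \<in> S" if "j \<le> N" "x \<in> S" for j x
  proof -
    have "(1 - real j / real N) *\<^sub>R x0 + (real j / real N) *\<^sub>R x \<in> S"
      using that N S(3) by (intro convexD[OF S(2)]) auto
    then show ?thesis by (simp add: pt_def algebra_simps)
  qed
  have contpt: "continuous_on S (\<lambda>x. \<phi> (pt j x))" if "j \<le> N" for j
    by (rule continuous_on_compose2[OF \<phi>]) (use ptS that in \<open>auto simp: pt_def intro!: continuous_intros\<close>)
  have step: "dist (pt j x) (pt (Suc j) x) < \<delta>" if "x \<in> S" for j x
  proof -
    have "pt (Suc j) x - pt j x = (1 / real N) *\<^sub>R (x - x0)"
      using N(2) by (simp add: pt_def scaleR_diff_left[symmetric] diff_divide_distrib[symmetric])
    then have "dist (pt j x) (pt (Suc j) x) = dist x0 x / real N"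
      by (simp add: dist_norm norm_minus_commute[of "pt j x"] norm_minus_commute[of x0])
    also have "\<dots> < \<delta>" using B[OF that] N by (simp add: field_simps)
    finally show ?thesis .
  qed
  have "\<exists>w. nz_sec S (\<lambda>x. \<phi> (pt j x)) w" if "j \<le> N" for j
    using that
  proof (induction j)
    case 0
    obtain w where "w \<in> K (\<phi> x0)" "w \<noteq> zero_tvec" using K_nontrivial by blast
    then have "nz_sec S (\<lambda>x. \<phi> (pt 0 x)) (\<lambda>x. w)"
      by (simp add: nz_sec_def sec_def pt_def)
    then show ?case by blast
  next
    case (Suc j)
    then obtain w where w: "nz_sec S (\<lambda>x. \<phi> (pt j x)) w" by auto
    have "nz_sec S (\<lambda>x. \<phi> (pt (Suc j) x)) (\<lambda>x. transport (\<phi> (pt j x)) (\<phi> (pt (Suc j) x)) (w x))"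
      unfolding nz_sec_def
    proof (intro conjI ballI)
      show "sec S (\<lambda>x. \<phi> (pt (Suc j) x)) (\<lambda>x. transport (\<phi> (pt j x)) (\<phi> (pt (Suc j) x)) (w x))"
        by (rule sec_transport[OF nz_secD(1)[OF w] contpt[OF Suc.prems]])
      show "transport (\<phi> (pt j x)) (\<phi> (pt (Suc j) x)) (w x) \<noteq> zero_tvec" if "x \<in> S" for x
        using Suc.prems that
        by (intro transport_nonzero nz_secD(2,3)[OF w] \<delta>(2) ptS step) auto
    qed
    then show ?case by blast
  qed
  from this[of N] N(2) show ?thesis by (simp add: pt_def)
qed

text \<open>The end values are prescribed by multiplying a section with a path of nonzero complex numbers, obtained by
  interpolating logarithms.\<close>

lemma edge_section:
  fixes \<phi> :: "real \<Rightarrow> 'a"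
  assumes \<phi>: "continuous_on {0..1} \<phi>" and a: "a \<in> K (\<phi> 0)" "a \<noteq> zero_tvec" and b: "b \<in> K (\<phi> 1)" "b \<noteq> zero_tvec"
  shows "\<exists>w. nz_sec {0..1} \<phi> w \<and> w 0 = a \<and> w 1 = b"
proof -
  obtain w where w: "nz_sec {0..1} \<phi> w"
    using section_exists[OF compact_Icc convex_real_interval(5), of 0 0 1 \<phi>] \<phi> by auto
  define z where "z = (\<lambda>t v. h (\<phi> t) (w t) v / of_real (g (\<phi> t) (w t) (w t)))"
  have z: "cscale (\<phi> t) (z t v) (w t) = v" "z t v \<noteq> 0"
    if t: "t \<in> {0..1}" and v: "v \<in> K (\<phi> t)" "v \<noteq> zero_tvec" for t v
  proof -
    note wt = nz_secD(2,3)[OF w t]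
    have gp: "g (\<phi> t) (w t) (w t) > 0" by (rule g_self_pos[OF wt])
    show "z t v \<noteq> 0" using h_nonzero[OF wt v] gp by (simp add: z_def)
    have "g (\<phi> t) (w t) (w t) * cscale (\<phi> t) (z t v) (w t) f = cscale (\<phi> t) (h (\<phi> t) (w t) v) (w t) f" for f
      using gp by (simp add: cscale_def z_def field_simps)
    also have "\<dots> f = g (\<phi> t) (w t) (w t) * v f" for f
      using fun_cong[OF h_expand[OF wt(1) v(1)], of f] by simp
    finally show "cscale (\<phi> t) (z t v) (w t) = v" using gp by (intro ext) simp
  qed
  define c where "c = (\<lambda>t. exp (of_real (1 - t) * Ln (z 0 a) + of_real t * Ln (z 1 b)))"
  have cc: "continuous_on {0..1} c" unfolding c_def by (intro continuous_intros)
  have "nz_sec {0..1} \<phi> (\<lambda>t. cscale (\<phi> t) (c t) (w t))"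
    unfolding nz_sec_def
  proof (intro conjI ballI)
    show "sec {0..1} \<phi> (\<lambda>t. cscale (\<phi> t) (c t) (w t))" by (rule sec_cscale[OF nz_secD(1)[OF w] cc])
    show "cscale (\<phi> t) (c t) (w t) \<noteq> zero_tvec" if "t \<in> {0..1}" for t
      by (rule cscale_nonzero[OF nz_secD(2,3)[OF w that]]) (simp add: c_def)
  qed
  moreover have "cscale (\<phi> 0) (c 0) (w 0) = a" "cscale (\<phi> 1) (c 1) (w 1) = b"
    using z[of 0 a] z[of 1 b] a b by (simp_all add: c_def)
  ultimately show ?thesis by blast
qed

subsection \<open>Sections along singular simplices\<close>

lemma nz_sec_of_simplex:
  assumes \<tau>: "singular_simplex m euclidean \<tau>" and w: "continuous_along A m w"
    and nz: "\<And>x. x \<in> standard_simplex m \<Longrightarrow> w x \<in> K (\<tau> x) \<and> w x \<noteq> zero_tvec"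
    and \<kappa>: "continuous_map (top_of_set S) (simplex_topology m) \<kappa>"
  shows "nz_sec S (\<lambda>x. \<tau> (\<kappa> x)) (\<lambda>x. w (\<kappa> x))"
proof -
  have "continuous_map (simplex_topology m) euclidean \<tau>" using \<tau> by (simp add: singular_simplex_def)
  from continuous_map_compose[OF \<kappa> this] have 1: "continuous_on S (\<lambda>x. \<tau> (\<kappa> x))" by (simp add: o_def)
  have 2: "continuous_on S (\<lambda>x. w (\<kappa> x) f)" if "f \<in> C" for f
  proof -
    have "continuous_map (simplex_topology m) euclideanreal (\<lambda>x. w x f)"
      using w that by (simp add: continuous_along_def)
    from continuous_map_compose[OF \<kappa> this] show ?thesis by (simp add: o_def)
  qed
  have "\<kappa> x \<in> standard_simplex m" if "x \<in> S" for x
    using continuous_map_image_subset_topspace[OF \<kappa>] that by auto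
  with 1 2 nz show ?thesis by (simp add: nz_sec_def sec_def)
qed

lemma simplex_of_nz_sec:
  assumes w: "nz_sec S (\<lambda>x. \<tau> (\<kappa> x)) w"
    and \<iota>: "continuous_map (simplex_topology m) (top_of_set S) \<iota>"
    and inv: "\<And>x. x \<in> standard_simplex m \<Longrightarrow> \<kappa> (\<iota> x) = x"
  shows "continuous_along A m (\<lambda>x. w (\<iota> x))"
    and "x \<in> standard_simplex m \<Longrightarrow> w (\<iota> x) \<in> K (\<tau> x) \<and> w (\<iota> x) \<noteq> zero_tvec"
proof -
  show "continuous_along A m (\<lambda>x. w (\<iota> x))"
    unfolding continuous_along_def
  proof
    fix f assume "f \<in> C"
    then have "continuous_map (top_of_set S) euclideanreal (\<lambda>y. w y f)"
      using secD(2)[OF nz_secD(1)[OF w]] by simp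
    from continuous_map_compose[OF \<iota> this]
    show "continuous_map (simplex_topology m) euclideanreal (\<lambda>x. w (\<iota> x) f)" by (simp add: o_def)
  qed
  assume x: "x \<in> standard_simplex m"
  have "\<iota> x \<in> S" using continuous_map_image_subset_topspace[OF \<iota>] x by auto
  then show "w (\<iota> x) \<in> K (\<tau> x) \<and> w (\<iota> x) \<noteq> zero_tvec"
    using nz_secD(2,3)[OF w, of "\<iota> x"] inv[OF x] by simp
qed

lemma edge_vertex: "edge_point 0 = simplex_vertex 0" "edge_point 1 = simplex_vertex 1"
  by (auto simp: edge_point_def simplex_vertex_def fun_eq_iff)

lemma one_skeleton_section_exists: "\<exists>s0 s1. one_skeleton_section A \<xi> s0 s1"
proof -
  have "\<exists>u. u \<in> K p \<and> u \<noteq> zero_tvec" for p using K_nontrivial by blast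
  then obtain s0 where s0: "\<And>p. s0 p \<in> K p" "\<And>p. s0 p \<noteq> zero_tvec" by metis
  have "\<exists>s. nonvanishing_section A \<xi> 1 \<tau> s \<and> (\<forall>i\<in>{0, 1}. s (simplex_vertex i) = s0 (\<tau> (simplex_vertex i)))"
    if \<tau>: "singular_simplex 1 euclidean \<tau>" for \<tau>
  proof -
    have "continuous_map (simplex_topology 1) euclidean \<tau>" using \<tau> by (simp add: singular_simplex_def)
    from continuous_map_compose[OF continuous_map_edge_point this]
    have "continuous_on {0..1} (\<lambda>t. \<tau> (edge_point t))" by (simp add: o_def)
    from edge_section[OF this s0 s0] obtain w where w: "nz_sec {0..1} (\<lambda>t. \<tau> (edge_point t)) w"
      "w 0 = s0 (\<tau> (edge_point 0))" "w 1 = s0 (\<tau> (edge_point 1))" by blast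
    note s = simplex_of_nz_sec[OF w(1) continuous_map_edge_coordinate edge_coordinate(2)]
    have "nonvanishing_section A \<xi> 1 \<tau> (\<lambda>x. w (x 1))"
      unfolding nonvanishing_section_def plane using s by blast
    moreover have "w (simplex_vertex 0 1) = s0 (\<tau> (simplex_vertex 0))" "w (simplex_vertex 1 1) = s0 (\<tau> (simplex_vertex 1))"
      using w(2,3) by (simp_all add: edge_vertex) (simp_all add: simplex_vertex_def)
    ultimately show ?thesis by (intro exI[of _ "\<lambda>x. w (x 1)"]) auto
  qed
  then obtain s1 where "\<And>\<tau>. singular_simplex 1 euclidean \<tau> \<Longrightarrow> nonvanishing_section A \<xi> 1 \<tau> (s1 \<tau>) \<and>
      (\<forall>i\<in>{0, 1}. s1 \<tau> (simplex_vertex i) = s0 (\<tau> (simplex_vertex i)))" by metis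
  then have "one_skeleton_section A \<xi> s0 s1"
    unfolding one_skeleton_section_def plane using s0 by blast
  then show ?thesis by blast
qed

lemma positive_frame_exists:
  assumes \<sigma>: "singular_simplex 2 euclidean s"
  shows "\<exists>t1 t2. positive_frame A \<xi> 2 s t1 t2"
proof -
  have "continuous_map (simplex_topology 2) euclidean s" using \<sigma> by (simp add: singular_simplex_def)
  from continuous_map_compose[OF continuous_map_triangle_point this]
  have c: "continuous_on triangle (\<lambda>y. s (triangle_point y))" by (simp add: o_def)
  have "(0, 0) \<in> triangle" by (simp add: triangle_def)
  from section_exists[OF compact_triangle convex_triangle this c]
  obtain w where w: "nz_sec triangle (\<lambda>y. s (triangle_point y)) w" by blast
  let ?Iw = "\<lambda>y. I (s (triangle_point y)) (w y)"
  have Iw: "nz_sec triangle (\<lambda>y. s (triangle_point y)) ?Iw"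
    unfolding nz_sec_def
  proof (intro conjI ballI)
    show "sec triangle (\<lambda>y. s (triangle_point y)) ?Iw" by (rule sec_I[OF nz_secD(1)[OF w]])
    fix y assume y: "y \<in> triangle"
    have "cscale (s (triangle_point y)) \<i> (w y) \<noteq> zero_tvec"
      by (rule cscale_nonzero[OF nz_secD(2,3)[OF w y]]) simp
    then show "?Iw y \<noteq> zero_tvec" by (simp add: cscale_def)
  qed
  note s1 = simplex_of_nz_sec[OF w continuous_map_triangle_coordinates triangle_coordinates(2)]
    and s2 = simplex_of_nz_sec[OF Iw continuous_map_triangle_coordinates triangle_coordinates(2)]
  have "positive_frame A \<xi> 2 s (\<lambda>x. w (x 1, x 2)) (\<lambda>x. ?Iw (x 1, x 2))"
    unfolding positive_frame_def
  proof (intro conjI ballI)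
    fix x assume x: "x \<in> standard_simplex 2"
    show "(w (x 1, x 2), ?Iw (x 1, x 2)) \<in> positive_frames \<xi> (s x)"
      unfolding triangle_coordinates(2)[OF x] using s1(2)[OF _ x] by (intro positive_frameI) auto
  qed (rule s1(1), assumption, rule s2(1), assumption)
  then show ?thesis by blast
qed

section \<open>The obstruction cochain\<close>

lemma edge_section_path:
  assumes s: "one_skeleton_section A \<xi> s0 s1" and \<tau>: "singular_simplex 1 euclidean \<tau>"
  shows "nz_sec {0..1} (\<lambda>t. \<tau> (edge_point t)) (\<lambda>t. s1 \<tau> (edge_point t))"
    and "s1 \<tau> (edge_point 0) = s0 (\<tau> (edge_point 0))" "s1 \<tau> (edge_point 1) = s0 (\<tau> (edge_point 1))"
proof -
  have n: "nonvanishing_section A \<xi> 1 \<tau> (s1 \<tau>)"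
    "\<forall>i\<in>{0, 1}. s1 \<tau> (simplex_vertex i) = s0 (\<tau> (simplex_vertex i))"
    using s \<tau> unfolding one_skeleton_section_def by blast+
  show "nz_sec {0..1} (\<lambda>t. \<tau> (edge_point t)) (\<lambda>t. s1 \<tau> (edge_point t))"
    using n(1) unfolding nonvanishing_section_def plane
    by (intro nz_sec_of_simplex[OF \<tau> _ _ continuous_map_edge_point]) auto
  show "s1 \<tau> (edge_point 0) = s0 (\<tau> (edge_point 0))" "s1 \<tau> (edge_point 1) = s0 (\<tau> (edge_point 1))"
    using n(2) by (auto simp: edge_vertex)
qed

lemma face_edge_point:
  assumes "k \<le> 2" "t \<in> {0..1}"
  shows "singular_face 2 k s (edge_point t) = s (triangle_point (triangle_face k t))"
  using edge_point_in[OF assms(2)] assms(1) by (simp add: singular_face_def triangle_point_face)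

lemma nz_sec_cong:
  "nz_sec S \<phi> w \<Longrightarrow> (\<And>x. x \<in> S \<Longrightarrow> \<phi> x = \<phi>' x) \<Longrightarrow> nz_sec S \<phi>' w"
  by (auto simp: nz_sec_def sec_def cong: continuous_on_cong)

lemma face_section:
  assumes s: "one_skeleton_section A \<xi> s0 s1" and \<sigma>: "singular_simplex 2 euclidean s" and k: "k \<le> 2"
  shows "nz_sec {0..1} (\<lambda>t. s (triangle_point (triangle_face k t))) (\<lambda>t. s1 (singular_face 2 k s) (edge_point t))"
    and "s1 (singular_face 2 k s) (edge_point 0) = s0 (s (triangle_point (triangle_face k 0)))"
    and "s1 (singular_face 2 k s) (edge_point 1) = s0 (s (triangle_point (triangle_face k 1)))"
proof -
  note e = edge_section_path[OF s coboundary_face_simplex[OF \<sigma> k]]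
  show "nz_sec {0..1} (\<lambda>t. s (triangle_point (triangle_face k t))) (\<lambda>t. s1 (singular_face 2 k s) (edge_point t))"
    by (rule nz_sec_cong[OF e(1) face_edge_point[OF k]])
  show "s1 (singular_face 2 k s) (edge_point 0) = s0 (s (triangle_point (triangle_face k 0)))"
    "s1 (singular_face 2 k s) (edge_point 1) = s0 (s (triangle_point (triangle_face k 1)))"
    unfolding e(2,3) by (simp_all add: face_edge_point[OF k])
qed

abbreviation nz_triangle :: "((nat \<Rightarrow> real) \<Rightarrow> 'a) \<Rightarrow> ((nat \<Rightarrow> real) \<Rightarrow> 'a tvec) \<Rightarrow> bool" where
  "nz_triangle s t \<equiv> nz_sec triangle (\<lambda>y. s (triangle_point y)) (\<lambda>y. t (triangle_point y))"

lemma frame_section: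
  assumes fr: "positive_frame A \<xi> 2 s t1 t2" and \<sigma>: "singular_simplex 2 euclidean s"
  shows "nz_triangle s t1"
    "nz_triangle s t2"
proof -
  have f: "(t1 x, t2 x) \<in> positive_frames \<xi> (s x)" if "x \<in> standard_simplex 2" for x
    using fr that by (simp add: positive_frame_def)
  have "t1 x \<in> K (s x) \<and> t1 x \<noteq> zero_tvec" if "x \<in> standard_simplex 2" for x
    using frame_Im_pos[OF f[OF that]] by simp
  then show "nz_triangle s t1"
    using fr by (intro nz_sec_of_simplex[OF \<sigma> _ _ continuous_map_triangle_point]) (auto simp: positive_frame_def)
  have "t2 x \<in> K (s x) \<and> t2 x \<noteq> zero_tvec" if "x \<in> standard_simplex 2" for x
    using frame_Im_pos[OF f[OF that]] h_zero[of "t1 x" "s x"] by auto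
  then show "nz_triangle s t2"
    using fr by (intro nz_sec_of_simplex[OF \<sigma> _ _ continuous_map_triangle_point]) (auto simp: positive_frame_def)
qed

definition face_turns ::
    "(((nat \<Rightarrow> real) \<Rightarrow> 'a) \<Rightarrow> (nat \<Rightarrow> real) \<Rightarrow> 'a tvec) \<Rightarrow> ((nat \<Rightarrow> real) \<Rightarrow> 'a) \<Rightarrow> ((nat \<Rightarrow> real) \<Rightarrow> 'a tvec) \<Rightarrow> nat \<Rightarrow> real" where
  "face_turns s1 s t1 k = turns (\<lambda>t. h (s (triangle_point (triangle_face k t))) (t1 (triangle_point (triangle_face k t)))
     (s1 (singular_face 2 k s) (edge_point t)))"

lemma frame_face:
  assumes "nz_triangle s t1"
  shows "nz_sec {0..1} (\<lambda>t. s (triangle_point (triangle_face k t))) (\<lambda>t. t1 (triangle_point (triangle_face k t)))"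
  by (rule nz_sec_pullback[OF assms continuous_triangle_face]) (use triangle_face_in in blast)

text \<open>The obstruction is defined by coordinates in an arbitrary positive frame \<open>t1, t2\<close>, the turns of the faces by the
  angle from \<open>t1\<close>. On each face they differ by the turning of a ratio that avoids the negative reals, hence by
  a difference \<open>\<rho>(x) - \<rho>(y)\<close> of values at the end points of the face, and these differences cancel around the triangle.\<close>

lemma boundary_loop_winding:
  assumes s: "one_skeleton_section A \<xi> s0 s1" and \<sigma>: "singular_simplex 2 euclidean s"
    and fr: "positive_frame A \<xi> 2 s t1 t2"
  shows "winding_number (boundary_loop s1 s t1 t2) 0 \<in> \<int>"
    and "Re (winding_number (boundary_loop s1 s t1 t2) 0) =
      boundary_sum (face_turns s1 s t1)"
proof -
  let ?x = "\<lambda>k t. triangle_point (triangle_face k t)"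
  let ?w = "\<lambda>k t. s1 (singular_face 2 k s) (edge_point t)"
  let ?fp = "face_path s1 s t1 t2"
  let ?h = "\<lambda>k t. h (s (?x k t)) (t1 (?x k t)) (?w k t)"
  note fs = frame_section[OF fr \<sigma>]
  define \<rho> where "\<rho> = (\<lambda>x. Im (Ln (h (s x) (t1 x) (s0 (s x)) / frame_coordinate (t1 x) (t2 x) (s0 (s x)))) / (2 * pi))"
  have face: "nz_path (?fp k)" "?fp k t = frame_coordinate (t1 (?x k t)) (t2 (?x k t)) (?w k t)"
    "face_turns s1 s t1 k = turns (?fp k) + (\<rho> (?x k 1) - \<rho> (?x k 0))"
    if k: "k \<le> 2" for k t
  proof -
    note w = face_section[OF s \<sigma> k] and u = frame_face[OF fs(1), of k] and v = frame_face[OF fs(2), of k]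
    have f: "(t1 (?x k t), t2 (?x k t)) \<in> positive_frames \<xi> (s (?x k t))" if "t \<in> {0..1}" for t
      using fr triangle_point_in[OF triangle_face_in[OF that]] by (simp add: positive_frame_def)
    show fp: "?fp k t = frame_coordinate (t1 (?x k t)) (t2 (?x k t)) (?w k t)" for t
      by (simp add: face_path_def Let_def triangle_point_face[OF k])
    let ?c = "\<lambda>t. frame_coord (s (?x k t)) (t1 (?x k t)) (t2 (?x k t)) (?w k t)"
    have fc: "?fp k t = ?c t" if "t \<in> {0..1}" for t
      unfolding fp by (rule frame_coordinate_eq(1)[OF f[OF that] nz_secD(2)[OF w(1) that]])
    have nz: "?fp k t \<noteq> 0" if "t \<in> {0..1}" for t
      unfolding fc[OF that] by (rule frame_coord_nonzero[OF f[OF that] nz_secD(2,3)[OF w(1) that]])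
    have cont: "continuous_on {0..1} ?c"
    proof -
      have i: "Im (h (s (?x k t)) (t1 (?x k t)) (t2 (?x k t))) \<noteq> 0" if "t \<in> {0..1}" for t
        using frame_Im_pos(3)[OF f[OF that]] by simp
      have gn: "g (s (?x k t)) (t1 (?x k t)) (t1 (?x k t)) \<noteq> 0" if "t \<in> {0..1}" for t
        using g_self_pos[OF nz_secD(2,3)[OF u that]] by simp
      note S = nz_secD(1)[OF u] nz_secD(1)[OF v] nz_secD(1)[OF w(1)]
      show ?thesis
        unfolding frame_coord_def Let_def Complex_eq
        by (intro continuous_on_add continuous_on_mult continuous_on_of_real continuous_on_divide
            continuous_on_diff continuous_on_Re continuous_on_Im continuous_on_const sec_h sec_g S ballI i gn)
    qed
    have cfp: "continuous_on {0..1} (?fp k)" using cont by (rule continuous_on_eq) (simp add: fc)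
    show fpn: "nz_path (?fp k)" using cfp nz by (simp add: nz_path_def)
    let ?r = "\<lambda>t. ?h k t / ?fp k t"
    have hp: "nz_path (?h k)" by (rule nz_path_h[OF u w(1)])
    have cr: "continuous_on {0..1} ?r"
      using hp nz cfp by (auto simp: nz_path_def intro!: continuous_intros)
    have sl: "?r t \<notin> \<real>\<^sub>\<le>\<^sub>0" if "t \<in> {0..1}" for t
      unfolding fc[OF that] by (rule frame_ratio[OF f[OF that] nz_secD(2,3)[OF w(1) that]])
    then have rp: "nz_path ?r" using cr unfolding nz_path_def by force
    have "face_turns s1 s t1 k = turns (\<lambda>t. ?fp k t * ?r t)"
      unfolding face_turns_def by (rule turns_cong) (simp add: nz)
    also have "\<dots> = turns (?fp k) + turns ?r" by (rule turns_mult[OF fpn rp])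
    also have "turns ?r = (Im (Ln (?r 1)) - Im (Ln (?r 0))) / (2 * pi)" by (rule turns_slit[OF cr sl])
    also have "\<dots> = \<rho> (?x k 1) - \<rho> (?x k 0)"
      unfolding \<rho>_def fp w(2,3) by (simp add: diff_divide_distrib)
    finally show "face_turns s1 s t1 k = turns (?fp k) + (\<rho> (?x k 1) - \<rho> (?x k 0))" .
  qed
  have ends: "?fp 2 1 = ?fp 0 0" "?fp 0 1 = ?fp 1 1" "?fp 2 0 = ?fp 1 0"
    using face_section(2,3)[OF s \<sigma>, of 0] face_section(2,3)[OF s \<sigma>, of 1] face_section(2,3)[OF s \<sigma>, of 2]
    by (simp_all add: face(2) triangle_face_def)
  have n: "nz_path (?fp 2)" "nz_path (?fp 0)" "nz_path (?fp 1)" by (rule face(1); simp)+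
  note loop = turns_triangle_loop[OF n ends]
  show "winding_number (boundary_loop s1 s t1 t2) 0 \<in> \<int>"
    unfolding boundary_loop_def by (rule loop(1))
  show "Re (winding_number (boundary_loop s1 s t1 t2) 0) =
      boundary_sum (face_turns s1 s t1)"
    unfolding boundary_loop_def loop(2) using face(3)[of 0] face(3)[of 1] face(3)[of 2]
    by (simp add: boundary_sum_def triangle_face_def)
qed

lemma obstruction_cochain_exists: "\<exists>c. obstruction_cochain A \<xi> c"
proof -
  obtain s0 s1 where s: "one_skeleton_section A \<xi> s0 s1" using one_skeleton_section_exists by blast
  have "\<exists>m::int. singular_simplex 2 euclidean s \<longrightarrow> (\<exists>t1 t2. positive_frame A \<xi> 2 s t1 t2 \<and>
      winding_number (boundary_loop s1 s t1 t2) 0 = of_int m)" for s :: "(nat \<Rightarrow> real) \<Rightarrow> 'a"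
  proof (cases "singular_simplex 2 euclidean s")
    case True
    obtain t1 t2 where fr: "positive_frame A \<xi> 2 s t1 t2" using positive_frame_exists[OF True] by blast
    from boundary_loop_winding(1)[OF s True fr] obtain m where
      "winding_number (boundary_loop s1 s t1 t2) 0 = of_int m" by (auto elim: Ints_cases)
    with fr show ?thesis by blast
  qed simp
  then obtain m where m: "\<And>s. singular_simplex 2 euclidean s \<Longrightarrow> (\<exists>t1 t2. positive_frame A \<xi> 2 s t1 t2 \<and>
      winding_number (boundary_loop s1 s t1 t2) 0 = of_int (m s))" by metis
  have "obstruction_cochain A \<xi> (\<lambda>s\<in>singular_simplex_set 2 euclidean. m s)"
    unfolding obstruction_cochain_def cochain_carrier using m s by auto
  then show ?thesis by blast
qed

lemma obstruction_cochainD: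
  assumes "obstruction_cochain A \<xi> c"
  obtains s0 s1 where "one_skeleton_section A \<xi> s0 s1"
    "\<And>s. singular_simplex 2 euclidean s \<Longrightarrow> \<exists>t1. nz_triangle s t1 \<and>
      of_int (c s) = boundary_sum (face_turns s1 s t1)"
proof -
  obtain s0 s1 where s: "one_skeleton_section A \<xi> s0 s1"
    and c: "\<And>s. singular_simplex 2 euclidean s \<Longrightarrow> \<exists>t1 t2. positive_frame A \<xi> 2 s t1 t2 \<and>
      winding_number (boundary_loop s1 s t1 t2) 0 = of_int (c s)"
    using assms unfolding obstruction_cochain_def by blast
  show ?thesis
  proof (rule that[OF s])
    fix s :: "(nat \<Rightarrow> real) \<Rightarrow> 'a" assume \<sigma>: "singular_simplex 2 euclidean s"
    obtain t1 t2 where fr: "positive_frame A \<xi> 2 s t1 t2"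
      and w: "winding_number (boundary_loop s1 s t1 t2) 0 = of_int (c s)" using c[OF \<sigma>] by blast
    show "\<exists>t1. nz_triangle s t1 \<and>
      of_int (c s) = boundary_sum (face_turns s1 s t1)"
      using frame_section(1)[OF fr \<sigma>] boundary_loop_winding(2)[OF s \<sigma> fr] w by (intro exI[of _ t1]) simp
  qed
qed

text \<open>Two choices of sections differ by a ratio, which over each simplex of dimension 1 is a path of nonzero
  complex numbers with end points determined by the vertices.\<close>

lemma obstruction_class_unique:
  assumes c: "obstruction_cochain A \<xi> c" and c': "obstruction_cochain A \<xi> c'"
  shows "cohomology_class 2 euclidean c = cohomology_class 2 euclidean c'"
proof -
  obtain s0 s1 where s: "one_skeleton_section A \<xi> s0 s1" and t:
    "\<And>s. singular_simplex 2 euclidean s \<Longrightarrow> \<exists>t1. nz_triangle s t1 \<and>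
      of_int (c s) = boundary_sum (face_turns s1 s t1)"
    using obstruction_cochainD[OF c] by blast
  obtain s0' s1' where s': "one_skeleton_section A \<xi> s0' s1'" and t':
    "\<And>s. singular_simplex 2 euclidean s \<Longrightarrow> \<exists>t1. nz_triangle s t1 \<and>
      of_int (c' s) = boundary_sum (face_turns s1' s t1)"
    using obstruction_cochainD[OF c'] by blast
  define \<gamma> where "\<gamma> = (\<lambda>\<tau> t. h (\<tau> (edge_point t)) (s1' \<tau> (edge_point t)) (s1 \<tau> (edge_point t)))"
  have "\<exists>d\<in>carrier (cochain_group 1 euclidean). \<forall>s. singular_simplex 2 euclidean s \<longrightarrow>
    of_int (coboundary 1 euclidean d s) = boundary_sum (\<lambda>k. turns (\<gamma> (singular_face 2 k s)))"
  proof (rule turns_coboundary[where \<Phi> = "\<lambda>p. h p (s0' p) (s0 p)"])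
    fix \<tau> :: "(nat \<Rightarrow> real) \<Rightarrow> 'a" assume \<tau>: "singular_simplex 1 euclidean \<tau>"
    note e = edge_section_path[OF s \<tau>] and e' = edge_section_path[OF s' \<tau>]
    show "nz_path (\<gamma> \<tau>)" unfolding \<gamma>_def by (rule nz_path_h[OF e'(1) e(1)])
    show "\<gamma> \<tau> 0 = h (\<tau> (edge_point 0)) (s0' (\<tau> (edge_point 0))) (s0 (\<tau> (edge_point 0)))"
      "\<gamma> \<tau> 1 = h (\<tau> (edge_point 1)) (s0' (\<tau> (edge_point 1))) (s0 (\<tau> (edge_point 1)))"
      by (simp_all add: \<gamma>_def e e')
  qed
  then obtain d where d: "d \<in> carrier (cochain_group 1 euclidean)"
    "\<And>s. singular_simplex 2 euclidean s \<Longrightarrow> of_int (coboundary 1 euclidean d s) = boundary_sum (\<lambda>k. turns (\<gamma> (singular_face 2 k s)))" by blast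
  show ?thesis
  proof (rule cohomology_class_eqI[OF d(1)])
    fix s :: "(nat \<Rightarrow> real) \<Rightarrow> 'a" assume \<sigma>: "singular_simplex 2 euclidean s"
    obtain t1 where t1: "nz_triangle s t1"
      "of_int (c s) = boundary_sum (face_turns s1 s t1)"
      using t[OF \<sigma>] by blast
    obtain t1' where t1': "nz_triangle s t1'"
      "of_int (c' s) = boundary_sum (face_turns s1' s t1')"
      using t'[OF \<sigma>] by blast
    define G where "G = (\<lambda>y. h (s (triangle_point y)) (t1 (triangle_point y)) (t1' (triangle_point y)))"
    have "continuous_on triangle G" unfolding G_def by (rule sec_h[OF nz_secD(1)[OF t1(1)] nz_secD(1)[OF t1'(1)]])
    moreover have "G y \<noteq> 0" if "y \<in> triangle" for y
      unfolding G_def by (rule h_nonzero[OF nz_secD(2,3)[OF t1(1) that] nz_secD(2,3)[OF t1'(1) that]])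
    ultimately have G0: "boundary_sum (\<lambda>k. turns (\<lambda>t. G (triangle_face k t))) = 0"
      by (rule turns_triangle)
    have f: "face_turns s1 s t1 k = turns (\<lambda>t. G (triangle_face k t)) + face_turns s1' s t1' k + turns (\<gamma> (singular_face 2 k s))"
      if k: "k \<le> 2" for k
    proof -
      note u = frame_face[OF t1(1), of k] and u' = frame_face[OF t1'(1), of k]
        and w = face_section(1)[OF s \<sigma> k] and w' = face_section(1)[OF s' \<sigma> k]
      have "turns (\<gamma> (singular_face 2 k s)) = turns (\<lambda>t. h (s (triangle_point (triangle_face k t)))
          (s1' (singular_face 2 k s) (edge_point t)) (s1 (singular_face 2 k s) (edge_point t)))"
        unfolding \<gamma>_def by (rule turns_cong) (simp only: face_edge_point[OF k])
      then show ?thesis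
        unfolding face_turns_def G_def using turns_h_mult[OF u u' w] turns_h_mult[OF u' w' w] by simp
    qed
    have "real_of_int (c s) = of_int (c' s + coboundary 1 euclidean d s)"
      using f[of 0] f[of 1] f[of 2] G0 t1(2) t1'(2) d(2)[OF \<sigma>] by (simp add: boundary_sum_def)
    then show "c s = c' s + coboundary 1 euclidean d s" by linarith
  qed
qed

lemma euler_class_eq: "obstruction_cochain A \<xi> c \<Longrightarrow> euler_class A \<xi> = cohomology_class 2 euclidean c"
  unfolding euler_class_def using obstruction_class_unique by (intro the_equality) blast+

text \<open>The arguments of \<open>q\<close> along the edges give an integral cochain whose coboundary is \<open>-2\<close> times the
  obstruction: over a 2-simplex, \<open>q\<close> of the frame vector \<open>t1\<close> has no zeros and does not turn around the boundary,
  and relative to it \<open>q\<close> of the section turns by \<open>-2\<close> times the angle from \<open>t1\<close> to the section.\<close>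

lemma euler_class_square_trivial:
  assumes nz: "\<And>p w. w \<in> K p \<Longrightarrow> w \<noteq> zero_tvec \<Longrightarrow> q p w \<noteq> 0"
  shows "euler_class A \<xi> [^]\<^bsub>cohomology_group 2 euclidean\<^esub> (2::nat) = \<one>\<^bsub>cohomology_group 2 euclidean\<^esub>"
proof -
  obtain c where c: "obstruction_cochain A \<xi> c" using obstruction_cochain_exists by blast
  obtain s0 s1 where s: "one_skeleton_section A \<xi> s0 s1" and t:
    "\<And>s. singular_simplex 2 euclidean s \<Longrightarrow> \<exists>t1. nz_triangle s t1 \<and>
      of_int (c s) = boundary_sum (face_turns s1 s t1)"
    using obstruction_cochainD[OF c] by blast
  define \<gamma> where "\<gamma> = (\<lambda>\<tau> t. q (\<tau> (edge_point t)) (s1 \<tau> (edge_point t)))"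
  have "\<exists>d\<in>carrier (cochain_group 1 euclidean). \<forall>s. singular_simplex 2 euclidean s \<longrightarrow>
    of_int (coboundary 1 euclidean d s) = boundary_sum (\<lambda>k. turns (\<gamma> (singular_face 2 k s)))"
  proof (rule turns_coboundary[where \<Phi> = "\<lambda>p. q p (s0 p)"])
    fix \<tau> :: "(nat \<Rightarrow> real) \<Rightarrow> 'a" assume \<tau>: "singular_simplex 1 euclidean \<tau>"
    note e = edge_section_path[OF s \<tau>]
    show "nz_path (\<gamma> \<tau>)"
      unfolding \<gamma>_def nz_path_def using sec_q[OF nz_secD(1)[OF e(1)]] nz[OF nz_secD(2,3)[OF e(1)]] by blast
    show "\<gamma> \<tau> 0 = q (\<tau> (edge_point 0)) (s0 (\<tau> (edge_point 0)))"
      "\<gamma> \<tau> 1 = q (\<tau> (edge_point 1)) (s0 (\<tau> (edge_point 1)))"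
      by (simp_all add: \<gamma>_def e)
  qed
  then obtain d where d: "d \<in> carrier (cochain_group 1 euclidean)"
    "\<And>s. singular_simplex 2 euclidean s \<Longrightarrow> of_int (coboundary 1 euclidean d s) = boundary_sum (\<lambda>k. turns (\<gamma> (singular_face 2 k s)))" by blast
  have eq: "2 * c s = coboundary 1 euclidean (cochain_comb euclidean (- 1) d 0 d) s"
    if \<sigma>: "singular_simplex 2 euclidean s" for s
  proof -
    obtain t1 where t1: "nz_triangle s t1"
      "of_int (c s) = boundary_sum (face_turns s1 s t1)"
      using t[OF \<sigma>] by blast
    define G where "G = (\<lambda>y. q (s (triangle_point y)) (t1 (triangle_point y)))"
    have "continuous_on triangle G" unfolding G_def by (rule sec_q[OF nz_secD(1)[OF t1(1)]])
    moreover have "G y \<noteq> 0" if "y \<in> triangle" for y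
      unfolding G_def by (rule nz[OF nz_secD(2,3)[OF t1(1) that]])
    ultimately have G0: "boundary_sum (\<lambda>k. turns (\<lambda>t. G (triangle_face k t))) = 0"
      by (rule turns_triangle)
    have f: "turns (\<gamma> (singular_face 2 k s)) = turns (\<lambda>t. G (triangle_face k t)) - 2 * face_turns s1 s t1 k"
      if k: "k \<le> 2" for k
    proof -
      have "turns (\<gamma> (singular_face 2 k s)) =
          turns (\<lambda>t. q (s (triangle_point (triangle_face k t))) (s1 (singular_face 2 k s) (edge_point t)))"
        unfolding \<gamma>_def by (rule turns_cong) (simp only: face_edge_point[OF k])
      then show ?thesis
        unfolding face_turns_def G_def
        using turns_q[OF frame_face[OF t1(1), of k] face_section(1)[OF s \<sigma> k] nz] by simp
    qed
    have "real_of_int (coboundary 1 euclidean d s) = of_int (- 2 * c s)"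
      using f[of 0] f[of 1] f[of 2] G0 t1(2) d(2)[OF \<sigma>] by (simp add: boundary_sum_def)
    then have "coboundary 1 euclidean d s = - 2 * c s" by linarith
    then show ?thesis unfolding coboundary_comb[OF \<sigma>] by simp
  qed
  have "cochain_comb euclidean (- 1) d 0 d \<in> carrier (cochain_group 1 euclidean)"
    by (simp add: cochain_carrier cochain_comb_def)
  from cohomology_class_square_trivial[OF this eq] show ?thesis
    unfolding euler_class_eq[OF c] .
qed

end

section \<open>Ricci curvature and the Euler class\<close>

theorem theorem1p10:
  fixes A :: "'a::{t2_space, second_countable_topology} atlas3"
    and \<mu> :: "'a \<Rightarrow> 'a tvec \<Rightarrow> 'a tvec \<Rightarrow> 'a tvec \<Rightarrow> real"
    and \<xi> :: "'a oriented_plane_field"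
    and \<alpha> :: "'a \<Rightarrow> 'a tvec \<Rightarrow> real"
    and \<theta> :: real
    and J :: "'a \<Rightarrow> 'a tvec \<Rightarrow> 'a tvec"
    and g :: "'a \<Rightarrow> 'a tvec \<Rightarrow> 'a tvec \<Rightarrow> real"
  assumes "smooth_atlas A"
    and "compact (UNIV :: 'a set)"
    and "connected (UNIV :: 'a set)"
    and "volume_form A \<mu>"
    and "contact_structure A \<mu> \<xi>"
    and "euler_class A \<xi> [^]\<^bsub>cohomology_group 2 euclidean\<^esub> (2::nat)
           \<noteq> \<one>\<^bsub>cohomology_group 2 euclidean\<^esub>"
    and "compatible_metric A \<mu> \<xi> \<alpha> \<theta> J g"
  shows "\<exists>x. ricci_reeb A \<alpha> J g x = \<theta>\<^sup>2 / 2"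
proof (rule ccontr)
  assume "\<not> ?thesis"
  then have ric: "ricci_reeb A \<alpha> J g p \<noteq> \<theta>\<^sup>2 / 2" for p by blast
  interpret smooth_manifold A by unfold_locales (rule assms(1))
  obtain n F E where fr: "\<And>k. F k \<in> C" "\<And>k. VF (E k)" "\<And>q v. v \<in> T q \<Longrightarrow> v = (\<lambda>f. \<Sum>k<n::nat. v (F k) * E k q f)"
    by (rule global_frame[OF assms(2)]) blast
  interpret framed_manifold A n F E
    by unfold_locales (rule fr(1), rule fr(2), rule fr(3))
  interpret contact_metric A n F E \<mu> \<alpha> \<theta> J g
    by unfold_locales (use assms(4,7) in \<open>auto simp: compatible_metric_def\<close>)
  obtain \<beta> where \<beta>: "contact_form A \<mu> \<beta>" and \<xi>: "\<xi> = contact_planes A \<beta>"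
    using assms(5) by (auto simp: contact_structure_def)
  have \<beta>1: "one_form A \<beta>" using \<beta> by (simp add: contact_form_def)
  have ker: "ker_form A \<beta> p = K p" for p
    using assms(7) by (simp add: compatible_metric_def \<xi> contact_planes_def)
  \<comment> \<open>The form defining the orientation of the planes is a multiple of \<open>\<alpha>\<close>, with a factor of constant sign.\<close>
  define c where "c = (\<lambda>p. \<beta> p (X p))"
  have \<beta>\<alpha>: "\<beta> p u = c p * \<alpha> p u" if u: "u \<in> T p" for p u
  proof -
    have "(\<lambda>f. u f - \<alpha> p u * X p f) \<in> ker_form A \<beta> p" unfolding ker by (rule proj_K[OF u])
    then have "\<beta> p (\<lambda>f. u f - \<alpha> p u * X p f) = 0" by (simp add: ker_form_def)
    then show ?thesis
      by (simp add: linear_at_diff[OF one_form_linear[OF \<beta>1]] linear_at_scale[OF one_form_linear[OF \<beta>1]]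
          u X_T T_scale c_def)
  qed
  have c_nz: "c p \<noteq> 0" for p
  proof
    assume "c p = 0"
    then have "X p \<in> ker_form A \<beta> p" by (simp add: ker_form_def X_T c_def)
    then show False unfolding ker by (simp add: K_iff Reeb)
  qed
  have d\<beta>: "ext_deriv A \<beta> p u v = c p * d\<alpha> p u v" if u: "u \<in> K p" and v: "v \<in> K p" for p u v
  proof -
    have kf: "ext_deriv_fields A \<gamma> U V p = - \<gamma> p (br U V p)"
      if U: "K_field U" and V: "K_field V" and \<gamma>: "\<And>q w. w \<in> K q \<Longrightarrow> \<gamma> q w = 0" for \<gamma> U V
      using K_field_K[OF U] K_field_K[OF V]
      by (simp add: ext_deriv_fields_def \<gamma> VF_T_const[OF K_field_VF[OF U]] VF_T_const[OF K_field_VF[OF V]])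
    define U V where "U = K_ext p u" and "V = K_ext p v"
    have U: "K_field U" "U p = u" and V: "K_field V" "V p = v"
      unfolding U_def V_def by (intro K_ext u v)+
    have "ext_deriv A \<beta> p (U p) (V p) = - \<beta> p (br U V p)"
      unfolding ext_deriv_at[OF \<beta>1 K_field_VF[OF U(1)] K_field_VF[OF V(1)]]
      by (rule kf[OF U(1) V(1)]) (simp add: \<beta>\<alpha> K_iff)
    moreover have "d\<alpha> p (U p) (V p) = - \<alpha> p (br U V p)"
      unfolding ext_deriv_at[OF \<alpha>_form K_field_VF[OF U(1)] K_field_VF[OF V(1)]]
      by (rule kf[OF U(1) V(1)]) (simp add: K_iff)
    ultimately show ?thesis
      using \<beta>\<alpha>[OF VF_T[OF br_VF[OF K_field_VF[OF U(1)] K_field_VF[OF V(1)]]], of p] by (simp add: U(2) V(2))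
  qed
  have "c \<in> C" unfolding c_def by (rule one_form_C[OF \<beta>1 Reeb(1)])
  then have conn: "connected (range c)"
    using connected_continuous_image[OF C_continuous assms(3)] by simp
  have same: "c x > 0" if "c y > 0" for x y
  proof (rule ccontr)
    assume "\<not> c x > 0"
    then have "c x \<le> 0" by simp
    then have "0 \<in> range c" using connectedD_interval[OF conn, of "c x" "c y" 0] that by auto
    then show False using c_nz by auto
  qed
  define \<epsilon> :: real where "\<epsilon> = (if \<exists>x. c x > 0 then 1 else - 1)"
  have \<epsilon>c: "\<epsilon> * c p > 0" for p
  proof (cases "\<exists>x. c x > 0")
    case True
    then show ?thesis using same by (auto simp: \<epsilon>_def)
  next
    case False
    then have "c p < 0" using c_nz[of p] by (metis linorder_neqE_linordered_idom)
    then show ?thesis using False by (simp add: \<epsilon>_def)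
  qed
  interpret oriented_contact_metric A n F E \<mu> \<alpha> \<theta> J g \<xi> \<epsilon>
  proof
    show "\<epsilon> = 1 \<or> \<epsilon> = - 1" by (simp add: \<epsilon>_def)
    show "plane \<xi> p = K p" for p using ker by (simp add: \<xi> contact_planes_def)
    fix u v p
    have "c p * d\<alpha> p u v > 0 \<longleftrightarrow> \<epsilon> * d\<alpha> p u v > 0"
      using \<epsilon>c[of p] by (auto simp: \<epsilon>_def zero_less_mult_iff split: if_splits)
    then show "(u, v) \<in> positive_frames \<xi> p \<longleftrightarrow> u \<in> K p \<and> v \<in> K p \<and> \<epsilon> * d\<alpha> p u v > 0"
      using d\<beta>[of u p v] by (auto simp: \<xi> contact_planes_def ker)
  qed
  have "q p w \<noteq> 0" if "w \<in> K p" "w \<noteq> zero_tvec" for p w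
    unfolding q_def by (rule h_nonzero[OF that P_K[OF that(1)] P_nonzero[OF ric that]])
  from euler_class_square_trivial[OF this] assms(6) show False by blast
qed

end
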